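(* Let $\theta_1,\theta_2,\theta_3,\theta_\infty\in\mathbb{C}$ with $\theta_\infty\neq 0,\ \pm(\theta_1+\theta_2+\theta_3)$. Consider the system $$\partial_k V=[V_k,V],\quad k=1,2,3,\qquad V_k=\left(\frac{V_{ij}(\delta_{ik}-\delta_{jk})}{u_i-u_j}\right)_{i,j=1}^3,\qquad ( * )$$ for a $3\times3$ matrix $V(u)$, $u=(u_1,u_2,u_3)$, with the constraints $$\mathrm{diag}\,V=\mathrm{diag}(-\theta_1,-\theta_2,-\theta_3),\qquad \text{eigenvalues of }V:\ 0,\ \tfrac{\theta_\infty-\theta_1-\theta_2-\theta_3}{2},\ \tfrac{-\theta_\infty-\theta_1-\theta_2-\theta_3}{2}\ \text{(distinct)}.\qquad( ** )$$ Then $( * )$ with constraints $( ** )$ is equivalent to the sixth Painlev\'e equation PVI (written in the context) with coefficients $2\beta=-\theta_1^2$, $2\delta=1-\theta_2^2$, $2\gamma=\theta_3^2$, $2\alpha=(\theta_\infty-1)^2$. Equivalently, writing $V(u)=(u_3-u_1)^{\Theta}\,\Omega(x)\,(u_3-u_1)^{-\Theta}$, $\Theta=\mathrm{diag}(\theta_1,\theta_2,\theta_3)$, $x=\frac{u_2-u_1}{u_3-u_1}$, the system $$\frac{d\Omega}{dx}=[\Omega,\widehat\Omega_2],\qquad \widehat\Omega_2=\begin{pmatrix}0&-\Omega_{12}/x&0\\-\Omega_{21}/x&0&\Omega_{23}/(1-x)\\0&\Omega_{32}/(1-x)&0\end{pmatrix},$$ with $\Omega$ satisfying the constraints $( ** )$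 (with $\Omega$ in place of $V$), is equivalent to PVI. There is a one-to-one correspondence between solutions $y(x)$ of PVI and equivalence classes $$\{K^0V(K^0)^{-1}\ :\ K^0=\mathrm{diag}(k_1^0,k_2^0,1),\ k_1^0,k_2^0\in\mathbb{C}\setminus\{0\}\}$$ of solutions of $( * )$, $( ** )$ (or the corresponding classes $\{K^0\Omega(K^0)^{-1}\}$), given by $\mathrm{diag}\,\Omega=\mathrm{diag}(-\theta_1,-\theta_2,-\theta_3)$ and the explicit formulae (with $y'=dy/dx$) \begin{align*} \Omega_{12}&=\frac{k_1}{k_2}\cdot\frac{(x^2-x)y'+(\theta_\infty-1)y^2+(\theta_2-\theta_1+1-(\theta_\infty+\theta_2)x)y+\theta_1x}{2(x-1)y},\\ \Omega_{21}&=\frac{k_2}{k_1}\cdot\frac{(x^2-x)y'+(\theta_\infty-1)y^2+(\theta_1-\theta_2+1-(\theta_\infty-\theta_2)x)y-\theta_1x}{2(x-y)},\\ \Omega_{13}&=k_1\cdot\frac{(x-x^2)y'+(1-\theta_\infty)y^2+((\theta_1-\theta_3)x+\theta_\infty+\theta_3-1)y-\theta_1x}{2(x-1)y},\\ \Omega_{31}&=\frac1{k_1}\cdot\frac{(x-x^2)y'+(1-\theta_\infty)y^2+((\theta_3-\theta_1)x+\theta_\infty-\theta_3-1)y+\theta_1x}{2x(y-1)},\\ \Omega_{23}&=k_2\cdot\frac{(x-x^2)y'+(1-\theta_\infty)y^2+((\theta_\infty-\theta_2)x+\theta_\infty+\theta_3-1)y-x(\theta_\infty-\theta_2+\theta_3)}{2(x-y)},\\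 \Omega_{32}&=\frac1{k_2}\cdot\frac{(x-x^2)y'+(1-\theta_\infty)y^2+((\theta_\infty+\theta_2)x+\theta_\infty-\theta_3-1)y-x(\theta_\infty+\theta_2-\theta_3)}{2x(1-y)}, \end{align*} where $k_j(x)=k_j^0\exp\left\{\int^x l_j(\xi)\,d\xi\right\}$, $k_j^0\in\mathbb{C}\setminus\{0\}$, $j=1,2$, with $$l_1(x)=\frac{x(1-x)y'+(\theta_2-\theta_1-\theta_3+1)y^2+((\theta_1+\theta_3)x+\theta_1-\theta_2-1)y-\theta_1x}{2x(x-1)(y-1)y},$$ \begin{align*} l_2(x)=\frac{1}{2x(1-x)(1-y)(x-y)}\Big(&-x(x-1)^2y'+\big((\theta_1-3\theta_2+\theta_3+1)x-\theta_1+\theta_2+\theta_3-1\big)y^2\\ &+\big((2\theta_2-\theta_1-\theta_3)x^2+(3\theta_2-3\theta_3-1)x+\theta_1-\theta_2+1\big)y\\ &+\big((\theta_1-2\theta_2+2\theta_3)x-\theta_1\big)x\Big). \end{align*}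
   Context: PVI is the equation $$y''=\tfrac12\Big[\tfrac1y+\tfrac1{y-1}+\tfrac1{y-x}\Big](y')^2-\Big[\tfrac1x+\tfrac1{x-1}+\tfrac1{y-x}\Big]y'+\frac{y(y-1)(y-x)}{x^2(x-1)^2}\Big[\alpha+\beta\frac{x}{y^2}+\gamma\frac{x-1}{(y-1)^2}+\delta\frac{x(x-1)}{(y-x)^2}\Big].$$ Here $\partial_k=\partial/\partial u_k$, $[A,B]=AB-BA$, $\delta_{ik}$ is the Kronecker delta, and the diagonal entries of $V_k$ are $0$. The system $( * )$ is the Frobenius integrability condition $d\omega=\omega\wedge\omega$ of the Pfaffian system $dY=\omega Y$, $\omega=(U+V/z)dz+\sum_k(zE_k+V_k)du_k$, with $U=\mathrm{diag}(u_1,u_2,u_3)$ and $E_k$ the matrix unit in position $(k,k)$. Solutions $V$ are holomorphic functions of $u$ in a domain of $\mathbb{C}^3$ (with pairwise distinct $u_i$, or including points with $u_i=u_j$ provided $V_{ij}\to0$ holomorphically as $u_i-u_j\to0$); the formulae hold wherever the expressions involved make sense.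
   Formalization: The one-to-one correspondence covers solutions V whose y is finite and avoids 0, 1, x (e.g. some diagonal V come from no y), on domains where x(u) has connected fibres and simply connected image and (u3-u1)^Θ has a branch, so Ω and k_j are single-valued. *)

theory Defs
  imports "HOL-Analysis.Analysis"
begin

definition eigenvalues :: "complex^'n^'n \<Rightarrow> complex set" where
  "eigenvalues A = {c. \<exists>v. v \<noteq> 0 \<and> A *v v = c *s v}"

definition commutator :: "complex^'n^'n \<Rightarrow> complex^'n^'n \<Rightarrow> complex^'n^'n" where
  "commutator A B = A ** B - B ** A"

definition diagonal_matrix :: "complex^'n \<Rightarrow> complex^'n^'n" where
  "diagonal_matrix d = (\<chi> i j. if i = j then d $ i else 0)"

text \<open>
  Throughout, \<open>\<theta> = (\<theta>\<^sub>1, \<theta>\<^sub>2, \<theta>\<^sub>3)\<close> and \<open>\<theta>inf\<close> is the parameter at infinity.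
  The three prescribed eigenvalues are distinct iff \<open>\<theta>inf\<close> differs from 0 and from
  plus or minus \<open>\<theta>\<^sub>1 + \<theta>\<^sub>2 + \<theta>\<^sub>3\<close>.
\<close>

definition mu_plus :: "complex^3 \<Rightarrow> complex \<Rightarrow> complex" where
  "mu_plus \<theta> \<theta>inf = (\<theta>inf - \<theta>$1 - \<theta>$2 - \<theta>$3) / 2"

definition mu_minus :: "complex^3 \<Rightarrow> complex \<Rightarrow> complex" where
  "mu_minus \<theta> \<theta>inf = (- \<theta>inf - \<theta>$1 - \<theta>$2 - \<theta>$3) / 2"

definition constraints :: "complex^3 \<Rightarrow> complex \<Rightarrow> complex^3^3 \<Rightarrow> bool" where
  "constraints \<theta> \<theta>inf A \<longleftrightarrow>
     (\<forall>i. A $ i $ i = - \<theta> $ i) \<and>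
     eigenvalues A = {0, mu_plus \<theta> \<theta>inf, mu_minus \<theta> \<theta>inf}"


section \<open>The system in three variables\<close>

definition distinct_entries :: "complex^3 \<Rightarrow> bool" where
  "distinct_entries u \<longleftrightarrow> (\<forall>i j. i \<noteq> j \<longrightarrow> u $ i \<noteq> u $ j)"

text \<open>Holomorphy in several variables: complex-linear Frechet derivative at every point
  (used for open sets only).\<close>

definition holomorphic3_on :: "(complex^3 \<Rightarrow> complex) \<Rightarrow> (complex^3) set \<Rightarrow> bool" where
  "holomorphic3_on f D \<longleftrightarrow>
     (\<forall>u\<in>D. \<exists>f'. (f has_derivative f') (at u) \<and> (\<forall>c h. f' (c *s h) = c * f' h))"

definition partial :: "3 \<Rightarrow> (complex^3 \<Rightarrow> complex) \<Rightarrow> complex^3 \<Rightarrow> complex" where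
  "partial k f u = deriv (\<lambda>t. f (u + t *s axis k 1)) 0"

definition partial_matrix ::
    "3 \<Rightarrow> (complex^3 \<Rightarrow> complex^3^3) \<Rightarrow> complex^3 \<Rightarrow> complex^3^3" where
  "partial_matrix k V u = (\<chi> i j. partial k (\<lambda>w. V w $ i $ j) u)"

definition kron :: "3 \<Rightarrow> 3 \<Rightarrow> complex" where
  "kron i k = (if i = k then 1 else 0)"

definition V_sub :: "3 \<Rightarrow> complex^3 \<Rightarrow> complex^3^3 \<Rightarrow> complex^3^3" where
  "V_sub k u A =
     (\<chi> i j. if i = j then 0 else A $ i $ j * (kron i k - kron j k) / (u $ i - u $ j))"

text \<open>
  Solutions on an open set \<open>D\<close>, which may contain points with \<open>u\<^sub>i = u\<^sub>j\<close>. At such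
  points the entry \<open>V\<^sub>i\<^sub>j\<close> has to vanish, so that \<open>V\<^sub>i\<^sub>j / (u\<^sub>i - u\<^sub>j)\<close> extends
  holomorphically, and the differential equation is the one obtained by continuity from
  points with distinct entries. Functions are extensional, so that equality of solutions is
  equality on the domain.
\<close>

definition V_regular_on :: "(complex^3) set \<Rightarrow> (complex^3 \<Rightarrow> complex^3^3) \<Rightarrow> bool" where
  "V_regular_on D V \<longleftrightarrow>
     (\<forall>i j. holomorphic3_on (\<lambda>u. V u $ i $ j) D) \<and>
     (\<forall>u\<in>D. \<forall>i j. i \<noteq> j \<and> u $ i = u $ j \<longrightarrow> V u $ i $ j = 0)"

definition V_solutions ::
    "complex^3 \<Rightarrow> complex \<Rightarrow> (complex^3) set \<Rightarrow> (complex^3 \<Rightarrow> complex^3^3) set" where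
  "V_solutions \<theta> \<theta>inf D =
     {V \<in> extensional D. V_regular_on D V \<and>
        (\<forall>u\<in>D. distinct_entries u \<longrightarrow>
           (\<forall>k. partial_matrix k V u = commutator (V_sub k u (V u)) (V u))) \<and>
        (\<forall>u\<in>D. constraints \<theta> \<theta>inf (V u))}"


section \<open>The reduced system\<close>

definition x_of :: "complex^3 \<Rightarrow> complex" where
  "x_of u = (u$2 - u$1) / (u$3 - u$1)"

definition Omega_hat :: "complex \<Rightarrow> complex^3^3 \<Rightarrow> complex^3^3" where
  "Omega_hat x A = vector
     [vector [0,             - A$1$2 / x,         0],
      vector [- A$2$1 / x,   0,                   A$2$3 / (1 - x)],
      vector [0,             A$3$2 / (1 - x),     0]]"

definition Omega_solutions ::
    "complex^3 \<Rightarrow> complex \<Rightarrow> complex set \<Rightarrow> (complex \<Rightarrow> complex^3^3) set" where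
  "Omega_solutions \<theta> \<theta>inf X =
     {W \<in> extensional X.
        (\<forall>x\<in>X. \<forall>i j. ((\<lambda>t. W t $ i $ j) has_field_derivative
             commutator (W x) (Omega_hat x (W x)) $ i $ j) (at x)) \<and>
        (\<forall>x\<in>X. constraints \<theta> \<theta>inf (W x))}"

text \<open>\<open>V(u) = (u\<^sub>3 - u\<^sub>1)\<^sup>\<Theta> \<Omega>(x) (u\<^sub>3 - u\<^sub>1)\<^sup>-\<^sup>\<Theta>\<close>, where \<open>L\<close> is a branch of
  \<open>log (u\<^sub>3 - u\<^sub>1)\<close> on \<open>D\<close>.\<close>

definition lift_Omega ::
    "complex^3 \<Rightarrow> (complex^3) set \<Rightarrow> (complex^3 \<Rightarrow> complex) \<Rightarrow>
     (complex \<Rightarrow> complex^3^3) \<Rightarrow> complex^3 \<Rightarrow> complex^3^3" where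
  "lift_Omega \<theta> D L W = restrict (\<lambda>u.
     diagonal_matrix (\<chi> i. exp (L u * \<theta> $ i)) ** W (x_of u) **
     diagonal_matrix (\<chi> i. exp (- (L u * \<theta> $ i)))) D"


section \<open>The sixth Painleve equation\<close>

definition PVI_rhs ::
    "complex \<Rightarrow> complex \<Rightarrow> complex \<Rightarrow> complex \<Rightarrow> complex \<Rightarrow> complex \<Rightarrow> complex \<Rightarrow> complex" where
  "PVI_rhs \<alpha> \<beta> \<gamma> \<delta> x y p =
     (1/2) * (1/y + 1/(y - 1) + 1/(y - x)) * p^2
     - (1/x + 1/(x - 1) + 1/(y - x)) * p
     + y * (y - 1) * (y - x) / (x^2 * (x - 1)^2) *
       (\<alpha> + \<beta> * x / y^2 + \<gamma> * (x - 1) / (y - 1)^2 + \<delta> * x * (x - 1) / (y - x)^2)"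

definition PVI_domain :: "complex set \<Rightarrow> (complex \<Rightarrow> complex) set" where
  "PVI_domain X =
     {y \<in> extensional X. y holomorphic_on X \<and> (\<forall>x\<in>X. y x \<noteq> 0 \<and> y x \<noteq> 1 \<and> y x \<noteq> x)}"

definition PVI_solutions :: "complex^3 \<Rightarrow> complex \<Rightarrow> complex set \<Rightarrow> (complex \<Rightarrow> complex) set" where
  "PVI_solutions \<theta> \<theta>inf X =
     {y \<in> PVI_domain X. \<forall>x\<in>X. deriv (deriv y) x =
        PVI_rhs ((\<theta>inf - 1)^2 / 2) (- ((\<theta>$1)^2) / 2) ((\<theta>$3)^2 / 2) ((1 - (\<theta>$2)^2) / 2)
          x (y x) (deriv y x)}"


section \<open>The explicit formulae\<close>

text \<open>In the following three definitions \<open>y\<close>, \<open>p\<close>, \<open>k1\<close>, \<open>k2\<close> stand for the values of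
  \<open>y\<close>, \<open>dy/dx\<close>, \<open>k\<^sub>1\<close>, \<open>k\<^sub>2\<close> at the point \<open>x\<close>.\<close>

definition Omega_formula ::
    "complex^3 \<Rightarrow> complex \<Rightarrow> complex \<Rightarrow> complex \<Rightarrow> complex \<Rightarrow> complex \<Rightarrow> complex \<Rightarrow> complex^3^3" where
  "Omega_formula \<theta> \<theta>inf x y p k1 k2 =
    (let \<theta>1 = \<theta>$1; \<theta>2 = \<theta>$2; \<theta>3 = \<theta>$3;
       W12 = k1 / k2 *
         (((x^2 - x) * p + (\<theta>inf - 1) * y^2
            + (\<theta>2 - \<theta>1 + 1 - (\<theta>inf + \<theta>2) * x) * y + \<theta>1 * x) / (2 * (x - 1) * y));
       W21 = k2 / k1 *
         (((x^2 - x) * p + (\<theta>inf - 1) * y^2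
            + (\<theta>1 - \<theta>2 + 1 - (\<theta>inf - \<theta>2) * x) * y - \<theta>1 * x) / (2 * (x - y)));
       W13 = k1 *
         (((x - x^2) * p + (1 - \<theta>inf) * y^2
            + ((\<theta>1 - \<theta>3) * x + \<theta>inf + \<theta>3 - 1) * y - \<theta>1 * x) / (2 * (x - 1) * y));
       W31 = 1 / k1 *
         (((x - x^2) * p + (1 - \<theta>inf) * y^2
            + ((\<theta>3 - \<theta>1) * x + \<theta>inf - \<theta>3 - 1) * y + \<theta>1 * x) / (2 * x * (y - 1)));
       W23 = k2 *
         (((x - x^2) * p + (1 - \<theta>inf) * y^2
            + ((\<theta>inf - \<theta>2) * x + \<theta>inf + \<theta>3 - 1) * y - x * (\<theta>inf - \<theta>2 + \<theta>3)) / (2 * (x - y)));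
       W32 = 1 / k2 *
         (((x - x^2) * p + (1 - \<theta>inf) * y^2
            + ((\<theta>inf + \<theta>2) * x + \<theta>inf - \<theta>3 - 1) * y - x * (\<theta>inf + \<theta>2 - \<theta>3)) / (2 * x * (1 - y)))
     in vector [vector [- \<theta>1, W12, W13],
                vector [W21, - \<theta>2, W23],
                vector [W31, W32, - \<theta>3]])"

definition l1_formula :: "complex^3 \<Rightarrow> complex \<Rightarrow> complex \<Rightarrow> complex \<Rightarrow> complex" where
  "l1_formula \<theta> x y p =
    (let \<theta>1 = \<theta>$1; \<theta>2 = \<theta>$2; \<theta>3 = \<theta>$3 in
     (x * (1 - x) * p + (\<theta>2 - \<theta>1 - \<theta>3 + 1) * y^2
       + ((\<theta>1 + \<theta>3) * x + \<theta>1 - \<theta>2 - 1) * y - \<theta>1 * x)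
     / (2 * x * (x - 1) * (y - 1) * y))"

definition l2_formula :: "complex^3 \<Rightarrow> complex \<Rightarrow> complex \<Rightarrow> complex \<Rightarrow> complex" where
  "l2_formula \<theta> x y p =
    (let \<theta>1 = \<theta>$1; \<theta>2 = \<theta>$2; \<theta>3 = \<theta>$3 in
     1 / (2 * x * (1 - x) * (1 - y) * (x - y)) *
     (- x * (x - 1)^2 * p
       + ((\<theta>1 - 3 * \<theta>2 + \<theta>3 + 1) * x - \<theta>1 + \<theta>2 + \<theta>3 - 1) * y^2
       + ((2 * \<theta>2 - \<theta>1 - \<theta>3) * x^2 + (3 * \<theta>2 - 3 * \<theta>3 - 1) * x + \<theta>1 - \<theta>2 + 1) * y
       + ((\<theta>1 - 2 * \<theta>2 + 2 * \<theta>3) * x - \<theta>1) * x))"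

text \<open>All functions \<open>k(x) = k\<^sup>0 exp (\<integral>\<^sup>x l)\<close> on \<open>X\<close>; the indefinite integral is a
  holomorphic primitive \<open>P\<close> of \<open>l\<close>.\<close>

definition exp_integrals :: "complex set \<Rightarrow> (complex \<Rightarrow> complex) \<Rightarrow> (complex \<Rightarrow> complex) set" where
  "exp_integrals X l =
     {k. \<exists>k0 P. k0 \<noteq> 0 \<and> (\<forall>x\<in>X. (P has_field_derivative l x) (at x)) \<and>
           (\<forall>x\<in>X. k x = k0 * exp (P x))}"

definition Omega_family ::
    "complex^3 \<Rightarrow> complex \<Rightarrow> complex set \<Rightarrow> (complex \<Rightarrow> complex) \<Rightarrow> (complex \<Rightarrow> complex^3^3) set" where
  "Omega_family \<theta> \<theta>inf X y =
     {restrict (\<lambda>x. Omega_formula \<theta> \<theta>inf x (y x) (deriv y x) (k1 x) (k2 x)) X | k1 k2.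
        k1 \<in> exp_integrals X (\<lambda>x. l1_formula \<theta> x (y x) (deriv y x)) \<and>
        k2 \<in> exp_integrals X (\<lambda>x. l2_formula \<theta> x (y x) (deriv y x))}"

definition conj_class ::
    "'a set \<Rightarrow> ('a \<Rightarrow> complex^3^3) \<Rightarrow> ('a \<Rightarrow> complex^3^3) set" where
  "conj_class S W =
     {restrict (\<lambda>s. diagonal_matrix (vector [c1, c2, 1]) ** W s **
                    matrix_inv (diagonal_matrix (vector [c1, c2, 1]))) S | c1 c2.
        c1 \<noteq> 0 \<and> c2 \<noteq> 0}"


section \<open>Where the correspondence makes sense\<close>

text \<open>
  Let \<open>l\<close> and \<open>r\<close> be the left and right eigenvectors (unique up to scaling) of \<open>A\<close> for the
  eigenvalues \<open>mu_plus\<close> and \<open>mu_minus\<close>, so that \<open>\<Sum>\<^sub>i l\<^sub>i r\<^sub>i = 0\<close>. The value of \<open>y\<close> that belongs to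
  \<open>A\<close> is the zero \<open>s\<close> of the rational function \<open>\<Sum>\<^sub>i l\<^sub>i r\<^sub>i / (s - u\<^sub>i)\<close>, normalised to
  \<open>(u\<^sub>1, u\<^sub>2, u\<^sub>3) = (0, x, 1)\<close>; this function is the (1,2) entry of the associated 2 by 2
  Fuchsian system. Explicitly \<open>y = x l\<^sub>1 r\<^sub>1 / (x l\<^sub>1 r\<^sub>1 + (x - 1) l\<^sub>3 r\<^sub>3)\<close>. The zero is finite
  iff \<open>\<Sum>\<^sub>i u\<^sub>i l\<^sub>i r\<^sub>i \<noteq> 0\<close>, and it is different from \<open>u\<^sub>1, u\<^sub>2, u\<^sub>3\<close> iff all \<open>l\<^sub>i r\<^sub>i\<close> are nonzero.
  At the points excluded by the predicate, \<open>y\<close> would take one of the values 0, 1, \<open>x\<close>,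
  infinity (or be undetermined), and the right-hand sides of PVI and of the explicit
  formulae make no sense.
\<close>

definition formulae_defined ::
    "complex^3 \<Rightarrow> complex \<Rightarrow> complex^3 \<Rightarrow> complex^3^3 \<Rightarrow> bool" where
  "formulae_defined \<theta> \<theta>inf u A \<longleftrightarrow>
     (\<exists>l r. l v* A = mu_plus \<theta> \<theta>inf *s l \<and> A *v r = mu_minus \<theta> \<theta>inf *s r \<and>
        (\<forall>i. l $ i * r $ i \<noteq> 0) \<and> (\<Sum>i\<in>UNIV. u $ i * (l $ i * r $ i)) \<noteq> 0)"

definition Omega_solutions_def_on ::
    "complex^3 \<Rightarrow> complex \<Rightarrow> complex set \<Rightarrow> (complex \<Rightarrow> complex^3^3) set" where
  "Omega_solutions_def_on \<theta> \<theta>inf X =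
     {W \<in> Omega_solutions \<theta> \<theta>inf X.
        \<forall>x\<in>X. formulae_defined \<theta> \<theta>inf (vector [0, x, 1]) (W x)}"

definition V_solutions_def_on ::
    "complex^3 \<Rightarrow> complex \<Rightarrow> (complex^3) set \<Rightarrow> (complex^3 \<Rightarrow> complex^3^3) set" where
  "V_solutions_def_on \<theta> \<theta>inf D =
     {V \<in> V_solutions \<theta> \<theta>inf D. \<forall>u\<in>D. formulae_defined \<theta> \<theta>inf u (V u)}"

text \<open>
  Domains. \<open>D\<close> is a domain with pairwise distinct \<open>u\<^sub>i\<close>, and \<open>x\<close> maps it onto \<open>X\<close>.
  Connectedness of the fibres of \<open>x\<close> makes \<open>\<Omega>\<close> a single-valued function of \<open>x\<close>; simple
  connectedness of \<open>X\<close> does the same for the integrals in \<open>k\<^sub>1\<close>, \<open>k\<^sub>2\<close>; and \<open>L\<close> fixes the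
  branch of \<open>(u\<^sub>3 - u\<^sub>1)\<^sup>\<Theta>\<close>. (For convex \<open>D\<close> the fibres are convex.)
\<close>

definition admissible_domains ::
    "complex set \<Rightarrow> (complex^3) set \<Rightarrow> (complex^3 \<Rightarrow> complex) \<Rightarrow> bool" where
  "admissible_domains X D L \<longleftrightarrow>
     open X \<and> simply_connected X \<and>
     open D \<and> connected D \<and> D \<noteq> {} \<and> (\<forall>u\<in>D. distinct_entries u) \<and>
     x_of ` D = X \<and> (\<forall>x\<in>X. connected {u\<in>D. x_of u = x}) \<and>
     continuous_on D L \<and> (\<forall>u\<in>D. exp (L u) = u$3 - u$1)"

end

theory Submission
  imports Defs "HOL-Complex_Analysis.Riemann_Mapping"
begin

text \<open>
  Up to conjugation by a diagonal matrix, a matrix \<open>\<Omega>\<close> with the prescribed diagonal and spectrum has the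
  right eigenvector \<open>(1, 1, 1)\<close> for the eigenvalue \<open>mu_minus\<close>, and the left eigenvector \<open>w\<close> for
  \<open>mu_plus\<close> satisfies \<open>\<Sum>\<^sub>i w\<^sub>i = 0\<close>, so that it depends on a single parameter: the zero \<open>y\<close> of
  \<open>\<Sum>\<^sub>i w\<^sub>i / (s - u\<^sub>i)\<close>. The matrices with given diagonal and given two eigenvectors form an affine
  line, with coordinate \<open>y'\<close>; the explicit formulae are a parametrisation of this line. Along a
  solution the eigenvectors satisfy \<open>r' = - H r + a r\<close> and \<open>l' = l H + b l\<close>, where
  \<open>H = Omega_hat x \<Omega>\<close>. This gives the equations for \<open>k\<^sub>1\<close> and \<open>k\<^sub>2\<close> and identifies the coordinate with \<open>y'\<close>.
  Conversely, these relations force the defect \<open>\<Omega>' - [\<Omega>, H]\<close> to annihilate both eigenvectors, hence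
  to lie in a one-dimensional space, and its (1,2) entry is a multiple of the defect of PVI.
\<close>

section \<open>Linear algebra of 3 by 3 matrices\<close>

text \<open>Because the three eigenvalues are distinct, eigenvectors are unique up to a scalar, and
  \<open>y\<close>, \<open>k1\<close>, \<open>k2\<close> are ratios that do not see this scalar.
  Eigenvectors are at first chosen separately at each point, without any regularity. Rows and
  columns of the adjugate of \<open>A - mat c\<close> are eigenvectors that are polynomial in the
  entries, hence holomorphic along a solution; comparison with them shows that the ratios are
  differentiable. They may vanish at some points, so each of them serves only locally. The same
  vectors give holomorphic functions that detect where the formulae fail, so such points are
  isolated unless they fill \<open>X\<close>. In the variables \<open>u\<close>, translations change
  nothing and dilations act by conjugation, so that after removal of this conjugation a solution is
  constant on the fibres of \<open>x\<close>. On larger domains every condition is rewritten as the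
  vanishing of a function that is holomorphic on complex lines, with the coefficients of the
  characteristic polynomial in place of eigenvalues; the identity theorem in one variable then
  suffices.\<close>

lemma mat_mult_vec: "mat c *v v = c *s v" for c :: complex
  by (simp add: mat_def matrix_vector_mult_def vec_eq_iff if_distrib if_distribR cong: if_cong)

lemma eigen_right_iff: "A *v v = c *s v \<longleftrightarrow> (A - mat c) *v v = 0"
  for A :: "complex^'n^'n"
  by (simp add: matrix_vector_mult_diff_rdistrib mat_mult_vec)

lemma eigen_left_iff: "v v* A = c *s v \<longleftrightarrow> v v* (A - mat c) = 0"
  for A :: "complex^'n^'n"
proof -
  have "transpose (A - mat c) = transpose A - mat c"
    by (simp add: transpose_def mat_def vec_eq_iff)
  thus ?thesis using eigen_right_iff[of "transpose A" v c]
    by (metis transpose_matrix_vector)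
qed

lemma mem_eigenvalues_iff: "c \<in> eigenvalues A \<longleftrightarrow> det (A - mat c) = 0"
proof -
  have "c \<in> eigenvalues A \<longleftrightarrow> (\<exists>v. v \<noteq> 0 \<and> (A - mat c) *v v = 0)"
    unfolding eigenvalues_def by (simp add: eigen_right_iff)
  also have "\<dots> \<longleftrightarrow> det (A - mat c) = 0"
    using invertible_det_nz[of "A - mat c"] invertible_left_inverse[of "A - mat c"]
      matrix_left_invertible_ker[of "A - mat c"] by blast
  finally show ?thesis .
qed

text \<open>The second elementary symmetric function of the eigenvalues; together with the trace and
  \<open>det\<close> it fixes the characteristic polynomial.\<close>

definition minor_sum :: "complex^3^3 \<Rightarrow> complex" where
  "minor_sum A = A$1$1 * A$2$2 - A$1$2 * A$2$1 + (A$1$1 * A$3$3 - A$1$3 * A$3$1)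
     + (A$2$2 * A$3$3 - A$2$3 * A$3$2)"

lemma det_minus_mat:
  "det (A - mat c) = - (c^3) + (A$1$1 + A$2$2 + A$3$3) * c^2 - minor_sum A * c + det A"
  for A :: "complex^3^3"
  by (simp add: det_3 mat_def minor_sum_def power3_eq_cube power2_eq_square algebra_simps)

text \<open>Written out entry by entry, since its rows and columns serve as eigenvectors that are
  polynomial in the matrix entries.\<close>

definition adjugate3 :: "complex^3^3 \<Rightarrow> complex^3^3" where
  "adjugate3 A = vector
     [vector [A$2$2 * A$3$3 - A$2$3 * A$3$2, A$1$3 * A$3$2 - A$1$2 * A$3$3, A$1$2 * A$2$3 - A$1$3 * A$2$2],
      vector [A$2$3 * A$3$1 - A$2$1 * A$3$3, A$1$1 * A$3$3 - A$1$3 * A$3$1, A$1$3 * A$2$1 - A$1$1 * A$2$3],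
      vector [A$2$1 * A$3$2 - A$2$2 * A$3$1, A$1$2 * A$3$1 - A$1$1 * A$3$2, A$1$1 * A$2$2 - A$1$2 * A$2$1]]"

lemma adjugate3_transpose: "adjugate3 (transpose A) = transpose (adjugate3 A)"
  by (simp add: adjugate3_def transpose_def vec_eq_iff forall_3 algebra_simps)

lemma adjugate3_right:
  assumes "det A = 0"
  shows "A *v column k (adjugate3 A) = 0"
  using assms exhaust_3[of k]
  by (auto simp: vec_eq_iff forall_3 matrix_vector_mult_def sum_3 column_def adjugate3_def det_3
      algebra_simps)

lemma adjugate3_left:
  assumes "det A = 0"
  shows "row k (adjugate3 A) v* A = 0"
proof -
  have "transpose A *v column k (adjugate3 (transpose A)) = 0"
    by (rule adjugate3_right) (simp add: assms)
  thus ?thesis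
    by (simp add: adjugate3_transpose)
qed

text \<open>Cramer's rule for each pair of the three equations, with one unknown kept as a
  parameter; the factors on the left are the diagonal cofactors.\<close>

lemma cramer3:
  fixes x y z :: complex
  assumes "a * x + b * y + c * z = 0" "d * x + e * y + f * z = 0" "g * x + h * y + i * z = 0"
  shows "(e * i - f * h) * y = x * (f * g - d * i)" "(e * i - f * h) * z = x * (d * h - e * g)"
    "(a * i - c * g) * x = y * (c * h - b * i)" "(a * i - c * g) * z = y * (b * g - a * h)"
    "(a * e - b * d) * x = z * (b * f - c * e)" "(a * e - b * d) * y = z * (c * d - a * f)"
  using assms by algebra+

text \<open>A nonzero diagonal cofactor forces rank at least two, so the kernel is at most a line.
  For invertible \<open>A\<close> both sides are zero.\<close>

lemma kernel_eq_column_adjugate3: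
  assumes "A *v v = 0" "adjugate3 A $ k $ k \<noteq> 0"
  shows "v = (v $ k / adjugate3 A $ k $ k) *s column k (adjugate3 A)"
proof -
  have eq: "A$1$1 * v$1 + A$1$2 * v$2 + A$1$3 * v$3 = 0" "A$2$1 * v$1 + A$2$2 * v$2 + A$2$3 * v$3 = 0"
     "A$3$1 * v$1 + A$3$2 * v$2 + A$3$3 * v$3 = 0"
    using assms(1) by (simp_all add: vec_eq_iff forall_3 matrix_vector_mult_def sum_3)
  have *: "\<forall>k i. adjugate3 A $ k $ k * v $ i = v $ k * adjugate3 A $ i $ k"
    unfolding forall_3 adjugate3_def vector_3 using cramer3[OF eq] by simp
  have **: "v $ i = v $ k / adjugate3 A $ k $ k * adjugate3 A $ i $ k" for i
    using *[rule_format, of k i] assms(2) by (simp add: field_simps)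
  show ?thesis
    unfolding vec_eq_iff column_def vector_smult_component vec_lambda_beta by (intro allI **)
qed

lemma left_kernel_eq_row_adjugate3:
  assumes "v v* A = 0" "adjugate3 A $ k $ k \<noteq> 0"
  shows "v = (v $ k / adjugate3 A $ k $ k) *s row k (adjugate3 A)"
  using kernel_eq_column_adjugate3[of "transpose A" v k] assms
  by (simp add: adjugate3_transpose) (simp add: transpose_def)

section \<open>Matrices with the prescribed diagonal and spectrum\<close>

locale PVI_parameters =
  fixes \<theta> :: "complex^3" and \<theta>inf :: complex
  assumes \<theta>inf_nz: "\<theta>inf \<noteq> 0"
    and mu_plus_nz: "mu_plus \<theta> \<theta>inf \<noteq> 0" and mu_minus_nz: "mu_minus \<theta> \<theta>inf \<noteq> 0"
begin

abbreviation "\<mu>p \<equiv> mu_plus \<theta> \<theta>inf"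
abbreviation "\<mu>m \<equiv> mu_minus \<theta> \<theta>inf"

lemma mu_diff: "\<mu>p - \<mu>m = \<theta>inf"
  by (simp add: mu_plus_def mu_minus_def field_simps)

lemma mu_distinct: "\<mu>p \<noteq> \<mu>m"
  using mu_diff \<theta>inf_nz by auto

lemma mu_sum: "\<mu>p + \<mu>m = - \<theta>$1 - \<theta>$2 - \<theta>$3"
  by (simp add: mu_plus_def mu_minus_def field_simps)

lemma det_minus_mat_diag:
  assumes "\<forall>i. A$i$i = - \<theta>$i"
  shows "det (A - mat c) = - (c^3) + (\<mu>p + \<mu>m) * c^2 - minor_sum A * c + det A"
  using assms unfolding det_minus_mat mu_sum by simp

text \<open>The diagonal fixes the trace, which is \<open>\<mu>p + \<mu>m\<close>. The two remaining
  coefficients follow from the roots \<open>0\<close> and \<open>\<mu>p\<close>, and the root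
  \<open>\<mu>m\<close> then comes for free. In this form the spectral condition is polynomial in
  the entries, as analytic continuation requires.\<close>

lemma constraints_iff:
  "constraints \<theta> \<theta>inf A \<longleftrightarrow> (\<forall>i. A$i$i = - \<theta>$i) \<and> det A = 0 \<and> minor_sum A = \<mu>p * \<mu>m"
proof (cases "\<forall>i. A$i$i = - \<theta>$i")
  case True
  note d = det_minus_mat_diag[OF True]
  have "eigenvalues A = {0, \<mu>p, \<mu>m} \<longleftrightarrow> det A = 0 \<and> minor_sum A = \<mu>p * \<mu>m"
  proof
    assume "eigenvalues A = {0, \<mu>p, \<mu>m}"
    hence e: "det (A - mat 0) = 0" "det (A - mat \<mu>p) = 0"
      unfolding mem_eigenvalues_iff[symmetric] by simp_all
    from e(1) have 0: "det A = 0" unfolding d by simp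
    from e(2) 0 have "\<mu>p * (\<mu>p * \<mu>m - minor_sum A) = 0" unfolding d by algebra
    with 0 mu_plus_nz show "det A = 0 \<and> minor_sum A = \<mu>p * \<mu>m" by simp
  next
    assume *: "det A = 0 \<and> minor_sum A = \<mu>p * \<mu>m"
    have "det (A - mat c) = - c * (c - \<mu>p) * (c - \<mu>m)" for c
      using * unfolding d by algebra
    thus "eigenvalues A = {0, \<mu>p, \<mu>m}" using * by (auto simp: mem_eigenvalues_iff)
  qed
  thus ?thesis using True by (simp add: constraints_def)
qed (auto simp: constraints_def)

text \<open>The trace is \<open>\<mu>p + \<mu>m\<close>, so the distinct eigenvalues
  \<open>\<mu>p\<close> and \<open>\<mu>m\<close> leave only \<open>0\<close> for the third. A left
  eigenvector is as good as a right one, because transposition preserves the determinant.\<close>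

lemma constraintsI:
  assumes diag: "\<And>i. A$i$i = - \<theta>$i"
    and "r \<noteq> 0" "A *v r = \<mu>m *s r" "l \<noteq> 0" "l v* A = \<mu>p *s l"
  shows "constraints \<theta> \<theta>inf A"
proof -
  have "\<mu>m \<in> eigenvalues A" using assms(2,3) by (auto simp: eigenvalues_def)
  hence m: "det (A - mat \<mu>m) = 0" by (simp add: mem_eigenvalues_iff)
  have "\<mu>p \<in> eigenvalues (transpose A)" using assms(4,5) by (auto simp: eigenvalues_def)
  hence "det (transpose A - mat \<mu>p) = 0" by (simp add: mem_eigenvalues_iff)
  moreover have "transpose A - mat \<mu>p = transpose (A - mat \<mu>p)"
    by (simp add: transpose_def mat_def vec_eq_iff)
  ultimately have p: "det (A - mat \<mu>p) = 0" by (metis det_transpose)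
  have d: "\<forall>i. A$i$i = - \<theta>$i" using diag by simp
  note e = det_minus_mat_diag[OF d]
  have "(\<mu>p - \<mu>m) * (\<mu>p * \<mu>m - minor_sum A) = 0" using m p unfolding e by algebra
  hence 1: "minor_sum A = \<mu>p * \<mu>m" using mu_distinct by simp
  have "det A = 0" using m unfolding e 1 by algebra
  with 1 d show ?thesis by (simp add: constraints_iff)
qed

abbreviation "adj_plus A \<equiv> adjugate3 (A - mat \<mu>p)"
abbreviation "adj_minus A \<equiv> adjugate3 (A - mat \<mu>m)"

text \<open>The second symmetric function of the shifted eigenvalues \<open>- c\<close>,
  \<open>\<mu>p - c\<close>, \<open>\<mu>m - c\<close>. At an eigenvalue it is the product of the
  differences to the other two, so simplicity makes some diagonal cofactor nonzero; which one
  depends on \<open>A\<close>.\<close>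

lemma trace_adjugate3:
  assumes "constraints \<theta> \<theta>inf A"
  shows "(\<Sum>k\<in>UNIV. adjugate3 (A - mat c) $ k $ k) = \<mu>p * \<mu>m - 2 * c * (\<mu>p + \<mu>m) + 3 * c^2"
proof -
  have d: "A$1$1 = - \<theta>$1" "A$2$2 = - \<theta>$2" "A$3$3 = - \<theta>$3"
    and e: "\<mu>p * \<mu>m = minor_sum A"
    using assms unfolding constraints_iff by auto
  show ?thesis unfolding mu_sum e minor_sum_def
    by (simp add: sum_3 adjugate3_def mat_def d power2_eq_square algebra_simps)
qed

lemma adj_plus_diag_nz:
  assumes "constraints \<theta> \<theta>inf A"
  obtains k where "adj_plus A $ k $ k \<noteq> 0"
proof -
  have "(\<Sum>k\<in>UNIV. adj_plus A $ k $ k) = \<mu>p * (\<mu>p - \<mu>m)"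
    unfolding trace_adjugate3[OF assms] by algebra
  also have "\<dots> \<noteq> 0" using mu_plus_nz mu_distinct by simp
  finally show ?thesis using that by (metis (mono_tags, lifting) sum.neutral)
qed

lemma adj_minus_diag_nz:
  assumes "constraints \<theta> \<theta>inf A"
  obtains k where "adj_minus A $ k $ k \<noteq> 0"
proof -
  have "(\<Sum>k\<in>UNIV. adj_minus A $ k $ k) = \<mu>m * (\<mu>m - \<mu>p)"
    unfolding trace_adjugate3[OF assms] by algebra
  also have "\<dots> \<noteq> 0" using mu_minus_nz mu_distinct by simp
  finally show ?thesis using that by (metis (mono_tags, lifting) sum.neutral)
qed

lemma constraints_det_minus_mat:
  assumes "constraints \<theta> \<theta>inf A" 
  shows "det (A - mat \<mu>p) = 0" "det (A - mat \<mu>m) = 0"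
  using assms by (simp_all add: constraints_def flip: mem_eigenvalues_iff)

lemma column_adj_minus:
  assumes "constraints \<theta> \<theta>inf A"
  shows "A *v column k (adj_minus A) = \<mu>m *s column k (adj_minus A)"
  unfolding eigen_right_iff by (intro adjugate3_right constraints_det_minus_mat assms)

lemma row_adj_plus:
  assumes "constraints \<theta> \<theta>inf A"
  shows "row k (adj_plus A) v* A = \<mu>p *s row k (adj_plus A)"
  unfolding eigen_left_iff by (intro adjugate3_left constraints_det_minus_mat assms)

lemma right_eigenvector_unique:
  assumes "constraints \<theta> \<theta>inf A" "A *v r = \<mu>m *s r" "A *v v = \<mu>m *s v" "r \<noteq> 0"
  obtains s where "v = s *s r"
proof -
  obtain k where k: "adj_minus A $ k $ k \<noteq> 0" using adj_minus_diag_nz[OF assms(1)] .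
  let ?c = "column k (adj_minus A)"
  have r: "r = (r $ k / adj_minus A $ k $ k) *s ?c"
    using assms(2) k by (intro kernel_eq_column_adjugate3) (simp_all add: eigen_right_iff)
  have v: "v = (v $ k / adj_minus A $ k $ k) *s ?c"
    using assms(3) k by (intro kernel_eq_column_adjugate3) (simp_all add: eigen_right_iff)
  have "r $ k \<noteq> 0" using r assms(4) by (metis div_0 vec.scale_zero_left)
  hence "(v $ k / r $ k) *s r = v" by (subst r, subst (2) v) (simp add: vec.scale_scale)
  thus ?thesis using that by metis
qed

lemma left_eigenvector_unique:
  assumes "constraints \<theta> \<theta>inf A" "l v* A = \<mu>p *s l" "v v* A = \<mu>p *s v" "l \<noteq> 0"
  obtains s where "v = s *s l"
proof -
  obtain k where k: "adj_plus A $ k $ k \<noteq> 0" using adj_plus_diag_nz[OF assms(1)] .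
  let ?c = "row k (adj_plus A)"
  have l: "l = (l $ k / adj_plus A $ k $ k) *s ?c"
    using assms(2) k by (intro left_kernel_eq_row_adjugate3) (simp_all add: eigen_left_iff)
  have v: "v = (v $ k / adj_plus A $ k $ k) *s ?c"
    using assms(3) k by (intro left_kernel_eq_row_adjugate3) (simp_all add: eigen_left_iff)
  have "l $ k \<noteq> 0" using l assms(4) by (metis div_0 vec.scale_zero_left)
  hence "(v $ k / l $ k) *s l = v" by (subst l, subst (2) v) (simp add: vec.scale_scale)
  thus ?thesis using that by metis
qed

text \<open>Evaluating \<open>l A r\<close> in two ways multiplies the pairing of \<open>l\<close>
  and \<open>r\<close> once by \<open>\<mu>p\<close> and once by \<open>\<mu>m\<close>.\<close>

lemma left_right_orthogonal:
  fixes A :: "complex^3^3"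
  assumes "A *v r = \<mu>m *s r" "l v* A = \<mu>p *s l"
  shows "l$1 * r$1 + l$2 * r$2 + l$3 * r$3 = 0"
proof -
  have "\<mu>p * (l$1 * r$1 + l$2 * r$2 + l$3 * r$3) = \<mu>m * (l$1 * r$1 + l$2 * r$2 + l$3 * r$3)"
    using assms unfolding vec_eq_iff forall_3 matrix_vector_mult_def vector_matrix_mult_def sum_3
    by simp algebra
  thus ?thesis using mu_distinct by simp
qed

end

section \<open>The explicit formulae\<close>

text \<open>After multiplication by this factor \<open>p\<close> occurs only in the combination
  \<open>x * (x - 1) * p\<close>, which is also the only way it enters \<open>formula_S\<close>. The
  remaining denominators are \<open>y\<close>, \<open>y - 1\<close> and
  \<open>y - x\<close>.\<close>

lemma PVI_cleared:
  fixes x y p a t1 t2 t3 :: complex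
  assumes "x \<noteq> 0" "x \<noteq> 1" "y \<noteq> 0" "y \<noteq> 1" "y \<noteq> x"
  shows "2 * x^2 * (x - 1)^2 * PVI_rhs (a^2 / 2) (- (t1^2) / 2) (t3^2 / 2) ((1 - t2^2) / 2) x y p
    = (x * (x - 1) * p)^2 * (1 / y + 1 / (y - 1) + 1 / (y - x))
      - 2 * (x * (x - 1) * p) * ((x - 1) + x + x * (x - 1) / (y - x))
      + a^2 * y * (y - 1) * (y - x) - t1^2 * x * (y - 1) * (y - x) / y
      + t3^2 * (x - 1) * y * (y - x) / (y - 1) + (1 - t2^2) * x * (x - 1) * y * (y - 1) / (y - x)"
proof -
  have nz: "x \<noteq> 0" "x - 1 \<noteq> 0" "y \<noteq> 0" "y - 1 \<noteq> 0" "y - x \<noteq> 0" using assms by auto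
  have 1: "2 * x^2 * (x - 1)^2 * (y * (y - 1) * (y - x) / (x^2 * (x - 1)^2) * E)
     = 2 * y * (y - 1) * (y - x) * E" for E
    using nz by simp
  have 2: "2 * x^2 * (x - 1)^2 * ((1/x + 1/(x - 1) + 1/(y - x)) * p) =
     2 * (x * (x - 1) * p) * ((x - 1) + x + x * (x - 1) / (y - x))"
    using nz(1,2,5) by (simp add: divide_simps) algebra
  have 3: "2 * y * (y - 1) * (y - x) * (a^2 / 2 + - (t1^2) / 2 * x / y^2 +
      t3^2 / 2 * (x - 1) / (y - 1)^2 + (1 - t2^2) / 2 * x * (x - 1) / (y - x)^2) =
     a^2 * y * (y - 1) * (y - x) - t1^2 * x * (y - 1) * (y - x) / y
      + t3^2 * (x - 1) * y * (y - x) / (y - 1) + (1 - t2^2) * x * (x - 1) * y * (y - 1) / (y - x)"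
    using nz(3-5) by (simp add: divide_simps) algebra
  have 4: "2 * x^2 * (x - 1)^2 * ((1/2) * (1/y + 1/(y - 1) + 1/(y - x)) * p^2) =
     (x * (x - 1) * p)^2 * (1 / y + 1 / (y - 1) + 1 / (y - x))"
    by (simp add: power2_eq_square)
  have 5: "c * (A - B + C) = c * A - c * B + c * C" for A B C c :: complex
    by (simp add: algebra_simps)
  show ?thesis unfolding PVI_rhs_def 5 1 2 3 4 by (simp add: algebra_simps)
qed

text \<open>The algebraic core of the equivalence. With \<open>P = x * (x - 1) * p\<close>, the left
  side is the (1,2) entry of the differential equation after clearing denominators and removing the
  term with the second derivative; the right side is minus the expression of
  \<open>PVI_cleared\<close>.\<close>

lemma PVI_poly:
  fixes x y P t1 t2 t3 ti :: complex
  assumes "y \<noteq> 0" "y \<noteq> 1" "y \<noteq> x"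
  defines "S \<equiv> P + (ti - 1) * y^2 + (1 - ti * x) * y"
  defines "e \<equiv> t1 * (x - y) + t2 * y * (1 - x)"
   and "g \<equiv> t1 * x * (1 - y) + t3 * y * (x - 1)" and "h \<equiv> t2 * x * (y - 1) + t3 * (x - y)"
  shows "2 * P * (2 * x - 1 + 2 * (ti - 1) * y + 1 - ti * x + t2 * (1 - x) - t1)
    + 2 * x * (x - 1) * (t1 - t2 * y - ti * y)
    + (S + e) * ((S + e) / y - (x - 1) * (S - e) / (x - y) + x * (S + ti * (x - y) + h) / (x - y))
    - 2 * (S + e) * (P / y + x) - 2 * (x - 1) * (t1 - t2) * (S + e)
    + (S + ti * (x - 1) * y + g) * (S + ti * (x - y) - h) / (1 - y) =
   - (P^2 * (1 / y + 1 / (y - 1) + 1 / (y - x))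
      - 2 * P * ((x - 1) + x + x * (x - 1) / (y - x))
      + (ti - 1)^2 * y * (y - 1) * (y - x) - t1^2 * x * (y - 1) * (y - x) / y
      + t3^2 * (x - 1) * y * (y - x) / (y - 1) + (1 - t2^2) * x * (x - 1) * y * (y - 1) / (y - x))"
  (is "?L = ?R")
proof -
  have nz: "y \<noteq> 0" "y - 1 \<noteq> 0" "y - x \<noteq> 0" "x - y \<noteq> 0" "1 - y \<noteq> 0" using assms by auto
  have m: "1 / (x - y) = - (1 / (y - x))" "1 / (1 - y) = - (1 / (y - 1))" 
    using nz by (simp_all add: divide_simps)
  \<comment> \<open>The reciprocals become independent unknowns subject to the relations
    \<open>r\<close>, so that what remains is a polynomial ideal membership.\<close>
  define u v w where "u = 1 / y" and "v = 1 / (y - 1)" and "w = 1 / (y - x)"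
  have d: "a / y = a * u" "a / (y - 1) = a * v" "a / (y - x) = a * w" "a / (x - y) = - a * w" "a / (1 - y) = - a * v" for a
    using m unfolding u_def v_def w_def by (metis (no_types, opaque_lifting) divide_inverse mult_1_left mult_minus_right mult_minus_left)+
  have r: "y * u = 1" "(y - 1) * v = 1" "(y - x) * w = 1"
    using nz unfolding u_def v_def w_def by auto
  have "?L - ?R = 0" 
    unfolding d S_def e_def g_def h_def using r by algebra
  thus ?thesis by simp
qed

definition formula_S :: "complex \<Rightarrow> complex \<Rightarrow> complex \<Rightarrow> complex \<Rightarrow> complex" where
  "formula_S \<theta>inf x y p = x * (x - 1) * p + (\<theta>inf - 1) * y^2 + (1 - \<theta>inf * x) * y"

text \<open>The part of the numerators that changes sign between the entries (1,2) and (2,1).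
  \<open>formula_g\<close> and \<open>formula_h\<close> play the same role for the pairs (1,3),
  (3,1) and (2,3), (3,2).\<close>

definition formula_e :: "complex^3 \<Rightarrow> complex \<Rightarrow> complex \<Rightarrow> complex" where
  "formula_e \<theta> x y = \<theta>$1 * (x - y) + \<theta>$2 * y * (1 - x)"

definition formula_g :: "complex^3 \<Rightarrow> complex \<Rightarrow> complex \<Rightarrow> complex" where
  "formula_g \<theta> x y = \<theta>$1 * x * (1 - y) + \<theta>$3 * y * (x - 1)"

definition formula_h :: "complex^3 \<Rightarrow> complex \<Rightarrow> complex \<Rightarrow> complex" where
  "formula_h \<theta> x y = \<theta>$2 * x * (y - 1) + \<theta>$3 * (x - y)"

text \<open>The matrix of the explicit formulae for \<open>k\<^sub>1 = k\<^sub>2 = 1\<close>, as a function of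
  \<open>S = formula_S\<close>: all six numerators are \<open>S\<close> up to terms that do not involve \<open>y'\<close>.\<close>

definition gauged_formula :: "complex^3 \<Rightarrow> complex \<Rightarrow> complex \<Rightarrow> complex \<Rightarrow> complex \<Rightarrow> complex^3^3" where
  "gauged_formula \<theta> \<theta>inf x y S = vector
    [vector [- \<theta>$1, (S + formula_e \<theta> x y) / (2 * (x - 1) * y),
             - (S + \<theta>inf * (x - 1) * y + formula_g \<theta> x y) / (2 * (x - 1) * y)],
     vector [(S - formula_e \<theta> x y) / (2 * (x - y)), - \<theta>$2,
             - (S + \<theta>inf * (x - y) + formula_h \<theta> x y) / (2 * (x - y))],
     vector [- (S + \<theta>inf * (x - 1) * y - formula_g \<theta> x y) / (2 * x * (y - 1)),
             - (S + \<theta>inf * (x - y) - formula_h \<theta> x y) / (2 * x * (1 - y)), - \<theta>$3]]"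

text \<open>The functions \<open>k1\<close>, \<open>k2\<close> enter only as conjugation by
  \<open>diag(k1, k2, 1)\<close>, so every algebraic identity can be checked for
  \<open>k1 = k2 = 1\<close>.\<close>

lemma Omega_formula_eq_gauged:
  assumes "k1 \<noteq> 0" "k2 \<noteq> 0"
  defines "\<kappa> \<equiv> vector [k1, k2, 1] :: complex^3"
  shows "Omega_formula \<theta> \<theta>inf x y p k1 k2 $ i $ j =
    \<kappa> $ i / \<kappa> $ j * gauged_formula \<theta> \<theta>inf x y (formula_S \<theta>inf x y p) $ i $ j"
proof -
  have a: "(x^2 - x) * p + (\<theta>inf - 1) * y^2 + (\<theta>$2 - \<theta>$1 + 1 - (\<theta>inf + \<theta>$2) * x) * y + \<theta>$1 * x
     = formula_S \<theta>inf x y p + formula_e \<theta> x y"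
    "(x^2 - x) * p + (\<theta>inf - 1) * y^2 + (\<theta>$1 - \<theta>$2 + 1 - (\<theta>inf - \<theta>$2) * x) * y - \<theta>$1 * x
     = formula_S \<theta>inf x y p - formula_e \<theta> x y"
    "(x - x^2) * p + (1 - \<theta>inf) * y^2 + ((\<theta>$1 - \<theta>$3) * x + \<theta>inf + \<theta>$3 - 1) * y - \<theta>$1 * x
     = - (formula_S \<theta>inf x y p + \<theta>inf * (x - 1) * y + formula_g \<theta> x y)"
    "(x - x^2) * p + (1 - \<theta>inf) * y^2 + ((\<theta>$3 - \<theta>$1) * x + \<theta>inf - \<theta>$3 - 1) * y + \<theta>$1 * x
     = - (formula_S \<theta>inf x y p + \<theta>inf * (x - 1) * y - formula_g \<theta> x y)"
    "(x - x^2) * p + (1 - \<theta>inf) * y^2 + ((\<theta>inf - \<theta>$2) * x + \<theta>inf + \<theta>$3 - 1) * y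
       - x * (\<theta>inf - \<theta>$2 + \<theta>$3)
     = - (formula_S \<theta>inf x y p + \<theta>inf * (x - y) + formula_h \<theta> x y)"
    "(x - x^2) * p + (1 - \<theta>inf) * y^2 + ((\<theta>inf + \<theta>$2) * x + \<theta>inf - \<theta>$3 - 1) * y
       - x * (\<theta>inf + \<theta>$2 - \<theta>$3)
     = - (formula_S \<theta>inf x y p + \<theta>inf * (x - y) - formula_h \<theta> x y)"
    unfolding formula_S_def formula_e_def formula_g_def formula_h_def
    by (simp_all add: power2_eq_square algebra_simps)
  have "\<forall>i j. Omega_formula \<theta> \<theta>inf x y p k1 k2 $ i $ j =
    \<kappa> $ i / \<kappa> $ j * gauged_formula \<theta> \<theta>inf x y (formula_S \<theta>inf x y p) $ i $ j"
    using assms(1,2) unfolding Omega_formula_def Let_def a \<kappa>_def gauged_formula_def forall_3 vector_3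
    by simp
  thus ?thesis by blast
qed

text \<open>The residues at \<open>s = 0, x, 1\<close> of
  \<open>(y - s) / (s * (s - x) * (s - 1))\<close>: the products \<open>l_i r_i\<close>, normalised,
  of the matrix whose associated zero is \<open>y\<close>.\<close>

definition left_weights :: "complex \<Rightarrow> complex \<Rightarrow> complex^3" where
  "left_weights x y = vector [y / x, (y - x) / (x * (x - 1)), (1 - y) / (x - 1)]"

lemma left_weights_sum:
  assumes "x \<noteq> 0" "x \<noteq> 1"
  shows "left_weights x y $ 1 + left_weights x y $ 2 + left_weights x y $ 3 = 0"
    "x * left_weights x y $ 2 + left_weights x y $ 3 = - 1"
  using assms by (simp_all add: left_weights_def divide_simps) (simp_all add: algebra_simps)

lemma left_weights_nz:
  assumes "x \<noteq> 0" "x \<noteq> 1" "y \<noteq> 0" "y \<noteq> 1" "y \<noteq> x"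
  shows "left_weights x y $ i \<noteq> 0"
proof -
  have "\<forall>i. left_weights x y $ i \<noteq> 0"
    using assms by (simp add: left_weights_def forall_3)
  thus ?thesis by blast
qed

text \<open>\<open>S\<close> cancels in each row sum, and likewise in the weighted column sums
  treated next. It is therefore a free coordinate on the matrices with these two
  eigenvectors.\<close>

lemma gauged_formula_rows:
  fixes \<theta> :: "complex^3" and \<theta>inf x y S :: complex
  assumes "x \<noteq> 0" "x \<noteq> 1" "y \<noteq> 0" "y \<noteq> 1" "y \<noteq> x"
  defines "M \<equiv> gauged_formula \<theta> \<theta>inf x y S"
  shows "M $ i $ 1 + M $ i $ 2 + M $ i $ 3 = mu_minus \<theta> \<theta>inf"
proof -
  have nz: "x - 1 \<noteq> 0" "y - 1 \<noteq> 0" "x - y \<noteq> 0" "1 - y \<noteq> 0" using assms by auto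
  have 1: "- t1 + (S + (t1 * (x - y) + t2 * y * (1 - x))) / (2 * (x - 1) * y)
        + - (S + ti * (x - 1) * y + (t1 * x * (1 - y) + t3 * y * (x - 1))) / (2 * (x - 1) * y)
      = (- ti - t1 - t2 - t3) / 2" for t1 t2 t3 ti
    using nz assms(3) by (simp add: divide_simps) algebra
  have 2: "(S - (t1 * (x - y) + t2 * y * (1 - x))) / (2 * (x - y)) + - t2
        + - (S + ti * (x - y) + (t2 * x * (y - 1) + t3 * (x - y))) / (2 * (x - y))
      = (- ti - t1 - t2 - t3) / 2" for t1 t2 t3 ti
    using nz by (simp add: divide_simps) algebra
  have 3: "- (S + ti * (x - 1) * y - (t1 * x * (1 - y) + t3 * y * (x - 1))) / (2 * x * (y - 1))
        + - (S + ti * (x - y) - (t2 * x * (y - 1) + t3 * (x - y))) / (2 * x * (1 - y)) + - t3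
      = (- ti - t1 - t2 - t3) / 2" for t1 t2 t3 ti
    using nz assms(1) by (simp add: divide_simps) algebra
  have "\<forall>i. M $ i $ 1 + M $ i $ 2 + M $ i $ 3 = mu_minus \<theta> \<theta>inf"
    unfolding M_def gauged_formula_def forall_3 vector_3 mu_minus_def
      formula_e_def formula_g_def formula_h_def by (intro conjI 1 2 3)
  thus ?thesis by blast
qed

lemma gauged_formula_columns:
  fixes \<theta> :: "complex^3" and \<theta>inf x y S :: complex
  assumes "x \<noteq> 0" "x \<noteq> 1" "y \<noteq> 0" "y \<noteq> 1" "y \<noteq> x"
  defines "M \<equiv> gauged_formula \<theta> \<theta>inf x y S" and "w \<equiv> left_weights x y"
  shows "w $ 1 * M $ 1 $ j + w $ 2 * M $ 2 $ j + w $ 3 * M $ 3 $ j = mu_plus \<theta> \<theta>inf * w $ j"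
proof -
  have nz: "x - 1 \<noteq> 0" "y - 1 \<noteq> 0" "x - y \<noteq> 0" "1 - y \<noteq> 0" using assms by auto
  have 1: "y / x * - t1 + (y - x) / (x * (x - 1)) * ((S - (t1 * (x - y) + t2 * y * (1 - x))) / (2 * (x - y)))
      + (1 - y) / (x - 1) * (- (S + ti * (x - 1) * y - (t1 * x * (1 - y) + t3 * y * (x - 1))) / (2 * x * (y - 1)))
     = (ti - t1 - t2 - t3) / 2 * (y / x)" for t1 t2 t3 ti
    using nz assms(1) by (simp add: divide_simps) algebra
  have 2: "y / x * ((S + (t1 * (x - y) + t2 * y * (1 - x))) / (2 * (x - 1) * y))
      + (y - x) / (x * (x - 1)) * - t2
      + (1 - y) / (x - 1) * (- (S + ti * (x - y) - (t2 * x * (y - 1) + t3 * (x - y))) / (2 * x * (1 - y)))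
     = (ti - t1 - t2 - t3) / 2 * ((y - x) / (x * (x - 1)))" for t1 t2 t3 ti
    using nz assms(1,3) by (simp add: divide_simps) algebra
  have 3: "y / x * (- (S + ti * (x - 1) * y + (t1 * x * (1 - y) + t3 * y * (x - 1))) / (2 * (x - 1) * y))
      + (y - x) / (x * (x - 1)) * (- (S + ti * (x - y) + (t2 * x * (y - 1) + t3 * (x - y))) / (2 * (x - y)))
      + (1 - y) / (x - 1) * - t3
     = (ti - t1 - t2 - t3) / 2 * ((1 - y) / (x - 1))" for t1 t2 t3 ti
    using nz assms(1,3) by (simp add: divide_simps) algebra
  have "\<forall>j. w $ 1 * M $ 1 $ j + w $ 2 * M $ 2 $ j + w $ 3 * M $ 3 $ j = mu_plus \<theta> \<theta>inf * w $ j"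
    unfolding M_def w_def left_weights_def gauged_formula_def forall_3 vector_3 mu_plus_def
      formula_e_def formula_g_def formula_h_def by (intro conjI 1 2 3)
  thus ?thesis by blast
qed

text \<open>This explains \<open>l1_formula\<close>: in \<open>r' = - H r + a r\<close> the constant
  third component of \<open>r = (k1, k2, 1)\<close> gives \<open>a = M $ 3 $ 2 / (1 - x)\<close>,
  and the first component then gives \<open>k1' / k1\<close>. The second component yields
  \<open>l2_formula\<close> in the same way.\<close>

lemma l1_formula_gauged:
  fixes \<theta> :: "complex^3" and \<theta>inf x y p :: complex
  assumes "x \<noteq> 0" "x \<noteq> 1" "y \<noteq> 0" "y \<noteq> 1"
  defines "M \<equiv> gauged_formula \<theta> \<theta>inf x y (formula_S \<theta>inf x y p)"
  shows "l1_formula \<theta> x y p = M $ 3 $ 2 / (1 - x) + M $ 1 $ 2 / x"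
proof -
  have nz: "x - 1 \<noteq> 0" "1 - x \<noteq> 0" "y - 1 \<noteq> 0" "1 - y \<noteq> 0" using assms by auto
  show ?thesis using nz assms(1,3)
    unfolding l1_formula_def Let_def M_def gauged_formula_def vector_3 formula_S_def formula_e_def formula_h_def
    by (simp add: divide_simps) algebra
qed

lemma l2_formula_gauged:
  fixes \<theta> :: "complex^3" and \<theta>inf x y p :: complex
  assumes "x \<noteq> 0" "x \<noteq> 1" "y \<noteq> 1" "y \<noteq> x"
  defines "M \<equiv> gauged_formula \<theta> \<theta>inf x y (formula_S \<theta>inf x y p)"
  shows "l2_formula \<theta> x y p = M $ 3 $ 2 / (1 - x) + M $ 2 $ 1 / x - M $ 2 $ 3 / (1 - x)"
proof -
  have nz: "1 - x \<noteq> 0" "1 - y \<noteq> 0" "x - y \<noteq> 0" using assms by auto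
  show ?thesis using nz assms(1)
    unfolding l2_formula_def Let_def M_def gauged_formula_def vector_3 formula_S_def formula_e_def formula_h_def
    by (simp add: divide_simps) algebra
qed

text \<open>The flow determines the derivative of the left eigenvector \<open>w\<close> up to a multiple of \<open>w\<close>, which is
  eliminated here between the first and the third component; what remains says \<open>y' = p\<close>.\<close>

lemma left_weights_flow:
  fixes \<theta> :: "complex^3" and \<theta>inf x y p :: complex
  assumes "x \<noteq> 0" "x \<noteq> 1" "y \<noteq> 0" "y \<noteq> 1" "y \<noteq> x"
  defines "M \<equiv> gauged_formula \<theta> \<theta>inf x y (formula_S \<theta>inf x y p)" and "w \<equiv> left_weights x y"
  shows "w $ 3 * (y' / x - y / x^2 - w $ 1 * (M $ 3 $ 2 / (1 - x) + M $ 1 $ 2 / x) + w $ 2 * M $ 2 $ 1 / x)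
     - w $ 1 * (- y' / (x - 1) - (1 - y) / (x - 1)^2 - w $ 2 * M $ 2 $ 3 / (1 - x))
    = (y' - p) / (x * (x - 1))"
proof -
  have nz: "x - 1 \<noteq> 0" "1 - x \<noteq> 0" "y - 1 \<noteq> 0" "1 - y \<noteq> 0" "x - y \<noteq> 0" using assms by auto
  show ?thesis using nz assms(1,3)
    unfolding w_def M_def left_weights_def gauged_formula_def vector_3 formula_S_def formula_e_def formula_h_def
    by (simp add: divide_simps) algebra
qed

text \<open>The (1,2) entry of the differential equation for the gauged matrix \<open>M\<close>: the first two terms
  are the derivative of \<open>M\<^sub>1\<^sub>2\<close> along \<open>x' = 1\<close>, \<open>y' = p\<close>, \<open>p' = q\<close>.\<close>

lemma gauged_formula_PVI:
  fixes \<theta> :: "complex^3" and \<theta>inf x y p q :: complex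
  assumes "x \<noteq> 0" "x \<noteq> 1" "y \<noteq> 0" "y \<noteq> 1" "y \<noteq> x"
  defines "S \<equiv> formula_S \<theta>inf x y p"
  defines "M \<equiv> gauged_formula \<theta> \<theta>inf x y S"
    and "S' \<equiv> (2 * x - 1) * p + x * (x - 1) * q + 2 * (\<theta>inf - 1) * y * p - \<theta>inf * y + (1 - \<theta>inf * x) * p"
    and "e' \<equiv> \<theta>$1 * (1 - p) + \<theta>$2 * (p * (1 - x) - y)"
  shows "(S' + e') / (2 * (x - 1) * y)
      - (S + formula_e \<theta> x y) * (y + (x - 1) * p) / (2 * (x - 1)^2 * y^2)
      + (M$1$2 / x - M$2$1 / x + M$2$3 / (1 - x)) * M$1$2
      - (\<theta>$1 - \<theta>$2) * M$1$2 / x - M$1$3 * M$3$2 / (1 - x)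
    = x / (2 * y) * (q - PVI_rhs ((\<theta>inf - 1)^2 / 2) (- ((\<theta>$1)^2) / 2) ((\<theta>$3)^2 / 2)
        ((1 - (\<theta>$2)^2) / 2) x y p)"
proof -
  have nz: "x \<noteq> 0" "y \<noteq> 0" "x - 1 \<noteq> 0" "1 - x \<noteq> 0" "y - 1 \<noteq> 0" "1 - y \<noteq> 0" "x - y \<noteq> 0" "y - x \<noteq> 0"
    using assms by auto
  define P where "P = x * (x - 1) * p"
  define e where "e = formula_e \<theta> x y"
  define g where "g = formula_g \<theta> x y"
  define h where "h = formula_h \<theta> x y"
  \<comment> \<open>Chosen so that \<open>c * (x / (2 * y))\<close> is
    \<open>2 * x^2 * (x - 1)^2\<close>, the factor in \<open>PVI_cleared\<close>.\<close>
  define c where "c = 4 * x * (x - 1)^2 * y"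
  have c: "c \<noteq> 0" using nz by (simp add: c_def)
  have M: "M$1$2 = (S + e) / (2 * (x - 1) * y)" "M$2$1 = (S - e) / (2 * (x - y))"
    "M$2$3 = - (S + \<theta>inf * (x - y) + h) / (2 * (x - y))"
    "M$1$3 = - (S + \<theta>inf * (x - 1) * y + g) / (2 * (x - 1) * y)"
    "M$3$2 = - (S + \<theta>inf * (x - y) - h) / (2 * x * (1 - y))"
    by (simp_all add: M_def gauged_formula_def e_def g_def h_def)
  have 1: "c * ((S' + e') / (2 * (x - 1) * y)) = 2 * x * (x - 1) * (S' + e')"
    unfolding c_def using nz by (simp add: divide_simps power2_eq_square)
  have 2: "c * ((S + e) * (y + (x - 1) * p) / (2 * (x - 1)^2 * y^2)) = 2 * (S + e) * (P / y + x)"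
    unfolding c_def P_def using nz by (simp add: divide_simps power2_eq_square) algebra
  have 3: "c * ((M$1$2 / x - M$2$1 / x + M$2$3 / (1 - x)) * M$1$2)
     = (S + e) * ((S + e) / y - (x - 1) * (S - e) / (x - y) + x * (S + \<theta>inf * (x - y) + h) / (x - y))"
    unfolding c_def M using nz by (simp add: divide_simps) algebra
  have 4: "c * ((\<theta>$1 - \<theta>$2) * M$1$2 / x) = 2 * (x - 1) * (\<theta>$1 - \<theta>$2) * (S + e)"
    unfolding c_def M using nz by (simp add: divide_simps) algebra
  have 5: "c * (M$1$3 * M$3$2 / (1 - x)) 
      = - ((S + \<theta>inf * (x - 1) * y + g) * (S + \<theta>inf * (x - y) - h) / (1 - y))"
    unfolding c_def M using nz by (simp add: divide_simps) algebra
  have 6: "2 * x * (x - 1) * (S' + e') = 2 * x^2 * (x - 1)^2 * q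
      + 2 * P * (2 * x - 1 + 2 * (\<theta>inf - 1) * y + 1 - \<theta>inf * x + \<theta>$2 * (1 - x) - \<theta>$1)
      + 2 * x * (x - 1) * (\<theta>$1 - \<theta>$2 * y - \<theta>inf * y)"
    unfolding S'_def e'_def P_def by (simp add: power2_eq_square algebra_simps)
  have S: "S = P + (\<theta>inf - 1) * y^2 + (1 - \<theta>inf * x) * y"
    by (simp add: S_def formula_S_def P_def)
  let ?pvi = "PVI_rhs ((\<theta>inf - 1)^2 / 2) (- ((\<theta>$1)^2) / 2) ((\<theta>$3)^2 / 2) ((1 - (\<theta>$2)^2) / 2) x y p"
  note poly = PVI_poly[OF assms(3-5), where P = P and ti = \<theta>inf and ?t1.0 = "\<theta>$1" and ?t2.0 = "\<theta>$2" and ?t3.0 = "\<theta>$3", folded S,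
      folded formula_e_def formula_g_def formula_h_def, folded e_def g_def h_def,
      folded PVI_cleared[OF assms(1-5), where a = "\<theta>inf - 1" and ?t1.0 = "\<theta>$1" and ?t3.0 = "\<theta>$3" and ?t2.0 = "\<theta>$2" and p = p, folded P_def]]
  have 7: "c * (x / (2 * y) * (q - ?pvi)) = 2 * x^2 * (x - 1)^2 * q - 2 * x^2 * (x - 1)^2 * ?pvi"
    unfolding c_def using nz(2) by (simp add: divide_simps power2_eq_square algebra_simps)
  have d: "c * (A - B + C - D - E) = c * A - c * B + c * C - c * D - c * E" for A B C D E
    by (simp add: algebra_simps)
  have "c * ((S' + e') / (2 * (x - 1) * y)
      - (S + e) * (y + (x - 1) * p) / (2 * (x - 1)^2 * y^2)
      + (M$1$2 / x - M$2$1 / x + M$2$3 / (1 - x)) * M$1$2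
      - (\<theta>$1 - \<theta>$2) * M$1$2 / x - M$1$3 * M$3$2 / (1 - x)) = c * (x / (2 * y) * (q - ?pvi))"
    unfolding 7 d 1 2 3 4 5 6 using poly by (simp add: algebra_simps)
  with c show ?thesis unfolding e_def by (meson mult_left_cancel)
qed

text \<open>Matrices with prescribed diagonal and prescribed left and right eigenvectors without
  vanishing entries form an affine line, on which the (1,2) entry is a coordinate.\<close>

lemma zero_matrix_3I:
  fixes N :: "complex^3^3"
  assumes "\<And>i. N $ i $ i = 0" "N *v r = 0" "l v* N = 0" "N $ 1 $ 2 = 0"
    and "\<And>i. r $ i \<noteq> 0" "\<And>i. l $ i \<noteq> 0"
  shows "N = 0"
proof -
  have r: "N$1$1 * r$1 + N$1$2 * r$2 + N$1$3 * r$3 = 0" "N$2$1 * r$1 + N$2$2 * r$2 + N$2$3 * r$3 = 0"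
     "N$3$1 * r$1 + N$3$2 * r$2 + N$3$3 * r$3 = 0"
    using assms(2) by (simp_all add: vec_eq_iff forall_3 matrix_vector_mult_def sum_3)
  have l: "l$1 * N$1$1 + l$2 * N$2$1 + l$3 * N$3$1 = 0" "l$1 * N$1$2 + l$2 * N$2$2 + l$3 * N$3$2 = 0"
     "l$1 * N$1$3 + l$2 * N$2$3 + l$3 * N$3$3 = 0"
    using assms(3) by (simp_all add: vec_eq_iff forall_3 vector_matrix_mult_def sum_3)
  \<comment> \<open>Rows and columns are taken in an order in which each relation contains only one
    entry not yet known to vanish.\<close>
  have 13: "N$1$3 = 0" using r(1) assms(1)[of 1] assms(4) assms(5)[of 3] by simp
  have 32: "N$3$2 = 0" using l(2) assms(1)[of 2] assms(4) assms(6)[of 3] by simp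
  have 31: "N$3$1 = 0" using r(3) assms(1)[of 3] 32 assms(5)[of 1] by simp
  have 21: "N$2$1 = 0" using l(1) assms(1)[of 1] 31 assms(6)[of 2] by simp
  have 23: "N$2$3 = 0" using l(3) assms(1)[of 3] 13 assms(6)[of 2] by simp
  show ?thesis using assms(1,4) 13 32 31 21 23 by (simp add: vec_eq_iff forall_3)
qed

text \<open>Differentiation of \<open>W r = \<mu> r\<close>, where \<open>R\<close> measures the
  failure of \<open>W' = [W, H]\<close>. It is used in two directions: if \<open>R = 0\<close>, then
  \<open>r' + H r\<close> is again an eigenvector; if \<open>r' + H r\<close> is a multiple of
  \<open>r\<close>, then \<open>R\<close> annihilates \<open>r\<close>.\<close>

lemma matrix_vector_deriv:
  fixes W :: "complex \<Rightarrow> complex^'n^'n"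
  assumes "\<And>i j. ((\<lambda>t. W t $ i $ j) has_field_derivative (commutator (W x) H + R) $ i $ j) (at x)"
    and "\<And>i. ((\<lambda>t. r t $ i) has_field_derivative r' $ i) (at x)"
    and "\<forall>\<^sub>F t in nhds x. W t *v r t = \<mu> *s r t"
  shows "R *v r x + W x *v (r' + H *v r x) = \<mu> *s (r' + H *v r x)"
proof -
  let ?W' = "commutator (W x) H + R"
  have x: "W x *v r x = \<mu> *s r x" using assms(3) eventually_nhds_x_imp_x by blast
  have "?W' *v r x + W x *v r' = \<mu> *s r'"
  proof (subst vec_eq_iff, rule allI)
    fix i
    have "((\<lambda>t. (W t *v r t) $ i) has_field_derivative (?W' *v r x + W x *v r') $ i) (at x)"
      unfolding matrix_vector_mult_def vector_add_component vec_lambda_beta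
      by (rule DERIV_cong, rule DERIV_sum, rule DERIV_mult[OF assms(1,2)])
        (simp add: sum.distrib mult.commute)
    moreover have "((\<lambda>t. (W t *v r t) $ i) has_field_derivative (\<mu> *s r') $ i) (at x)
       \<longleftrightarrow> ((\<lambda>t. (\<mu> *s r t) $ i) has_field_derivative (\<mu> *s r') $ i) (at x)"
      by (rule DERIV_cong_ev) (use assms(3) in \<open>auto elim!: eventually_mono\<close>)
    moreover have "((\<lambda>t. (\<mu> *s r t) $ i) has_field_derivative (\<mu> *s r') $ i) (at x)"
      using DERIV_cmult[OF assms(2)[of i]] by simp
    ultimately show "(?W' *v r x + W x *v r') $ i = (\<mu> *s r') $ i"
      using DERIV_unique by blast
  qed
  moreover have "commutator (W x) H *v r x = W x *v (H *v r x) - \<mu> *s (H *v r x)"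
    using x unfolding commutator_def matrix_vector_mult_diff_rdistrib matrix_vector_mul_assoc[symmetric]
    by (simp add: vec.scale)
  ultimately show ?thesis
    by (simp add: matrix_vector_mult_add_rdistrib vec.add vec.scale_right_distrib algebra_simps)
qed

text \<open>Transposition turns the flow with \<open>H\<close> into the flow with
  \<open>- transpose H\<close>, so that facts about left eigenvectors reduce to those about right
  ones.\<close>

lemma transpose_commutator:
  fixes A B :: "complex^'n^'n"
  shows "transpose (commutator A B) = commutator (transpose A) (- transpose B)"
proof -
  have "X ** (- Y) = - (X ** Y)" "(- Y) ** X = - (Y ** X)" for X Y :: "complex^'n^'n"
    by (simp_all add: matrix_matrix_mult_def vec_eq_iff sum_negf)
  moreover have "transpose (X - Y) = transpose X - transpose Y" for X Y :: "complex^'n^'n"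
    by (simp add: transpose_def vec_eq_iff)
  ultimately show ?thesis by (simp add: commutator_def matrix_transpose_mul)
qed

lemma vector_matrix_deriv:
  fixes W :: "complex \<Rightarrow> complex^'n^'n"
  assumes "\<And>i j. ((\<lambda>t. W t $ i $ j) has_field_derivative (commutator (W x) H + R) $ i $ j) (at x)"
    and "\<And>i. ((\<lambda>t. l t $ i) has_field_derivative l' $ i) (at x)"
    and "\<forall>\<^sub>F t in nhds x. l t v* W t = \<mu> *s l t"
  shows "l x v* R + (l' - l x v* H) v* W x = \<mu> *s (l' - l x v* H)"
proof -
  have "transpose R *v l x + transpose (W x) *v (l' + (- transpose H) *v l x)
      = \<mu> *s (l' + (- transpose H) *v l x)"
  proof (rule matrix_vector_deriv)
    fix i j
    have "commutator (transpose (W x)) (- transpose H) + transpose R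
        = transpose (commutator (W x) H + R)"
      unfolding transpose_commutator[symmetric] by (simp add: transpose_def vec_eq_iff)
    thus "((\<lambda>t. transpose (W t) $ i $ j) has_field_derivative
        (commutator (transpose (W x)) (- transpose H) + transpose R) $ i $ j) (at x)"
      using assms(1)[of j i] by (simp add: transpose_def)
  qed (use assms in simp_all)
  moreover have "(- transpose H) *v v = - (v v* H)" for v
    by (simp add: matrix_vector_mult_def vector_matrix_mult_def transpose_def vec_eq_iff sum_negf mult.commute)
  ultimately show ?thesis by simp
qed

section \<open>Eigenvectors of the explicit formulae\<close>

context PVI_parameters
begin

lemma Omega_formula_diag: "Omega_formula \<theta> \<theta>inf x y p k1 k2 $ i $ i = - \<theta> $ i"
proof -
  have "\<forall>i. Omega_formula \<theta> \<theta>inf x y p k1 k2 $ i $ i = - \<theta> $ i"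
    unfolding forall_3 by (simp add: Omega_formula_def Let_def)
  thus ?thesis by blast
qed

definition right_vec :: "complex \<Rightarrow> complex \<Rightarrow> complex^3" where
  "right_vec k1 k2 = vector [k1, k2, 1]"

text \<open>Normalised so that the products with the entries of \<open>right_vec\<close> are
  \<open>left_weights x y\<close>, free of \<open>k1\<close> and \<open>k2\<close>.\<close>

definition left_vec :: "complex \<Rightarrow> complex \<Rightarrow> complex \<Rightarrow> complex \<Rightarrow> complex^3" where
  "left_vec x y k1 k2 = (\<chi> i. left_weights x y $ i / right_vec k1 k2 $ i)"

lemma right_vec_nz: "k1 \<noteq> 0 \<Longrightarrow> k2 \<noteq> 0 \<Longrightarrow> right_vec k1 k2 $ i \<noteq> 0"
  using exhaust_3[of i] by (auto simp: right_vec_def)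

lemma Omega_formula_right:
  assumes "x \<noteq> 0" "x \<noteq> 1" "y \<noteq> 0" "y \<noteq> 1" "y \<noteq> x" "k1 \<noteq> 0" "k2 \<noteq> 0"
  shows "Omega_formula \<theta> \<theta>inf x y p k1 k2 *v right_vec k1 k2 = \<mu>m *s right_vec k1 k2"
proof -
  let ?M = "gauged_formula \<theta> \<theta>inf x y (formula_S \<theta>inf x y p)" and ?k = "right_vec k1 k2"
  have "(Omega_formula \<theta> \<theta>inf x y p k1 k2 *v ?k) $ i
      = ?k $ i * (?M $ i $ 1 + ?M $ i $ 2 + ?M $ i $ 3)" for i
    using right_vec_nz[OF assms(6,7)]
    by (simp add: matrix_vector_mult_def sum_3 Omega_formula_eq_gauged[OF assms(6,7)]
        ring_distribs flip: right_vec_def)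
  thus ?thesis by (simp add: vec_eq_iff gauged_formula_rows[OF assms(1-5)])
qed

lemma Omega_formula_left:
  assumes "x \<noteq> 0" "x \<noteq> 1" "y \<noteq> 0" "y \<noteq> 1" "y \<noteq> x" "k1 \<noteq> 0" "k2 \<noteq> 0"
  shows "left_vec x y k1 k2 v* Omega_formula \<theta> \<theta>inf x y p k1 k2 = \<mu>p *s left_vec x y k1 k2"
proof -
  let ?M = "gauged_formula \<theta> \<theta>inf x y (formula_S \<theta>inf x y p)" and ?k = "right_vec k1 k2"
  let ?w = "left_weights x y"
  have "(left_vec x y k1 k2 v* Omega_formula \<theta> \<theta>inf x y p k1 k2) $ j
      = (?w $ 1 * ?M $ 1 $ j + ?w $ 2 * ?M $ 2 $ j + ?w $ 3 * ?M $ 3 $ j) / ?k $ j" for j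
    using right_vec_nz[OF assms(6,7)]
    by (simp add: vector_matrix_mult_def sum_3 Omega_formula_eq_gauged[OF assms(6,7)]
        left_vec_def add_divide_distrib flip: right_vec_def)
  thus ?thesis by (simp add: vec_eq_iff gauged_formula_columns[OF assms(1-5)] left_vec_def)
qed

lemma left_vec_nz:
  assumes "x \<noteq> 0" "x \<noteq> 1" "y \<noteq> 0" "y \<noteq> 1" "y \<noteq> x" "k1 \<noteq> 0" "k2 \<noteq> 0"
  shows "left_vec x y k1 k2 $ i \<noteq> 0"
  using left_weights_nz[OF assms(1-5)] right_vec_nz[OF assms(6,7)] by (simp add: left_vec_def)

lemma vec_nzI: "v $ i \<noteq> 0 \<Longrightarrow> v \<noteq> 0"
  by auto

lemma Omega_formula_constraints:
  assumes "x \<noteq> 0" "x \<noteq> 1" "y \<noteq> 0" "y \<noteq> 1" "y \<noteq> x" "k1 \<noteq> 0" "k2 \<noteq> 0"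
  shows "constraints \<theta> \<theta>inf (Omega_formula \<theta> \<theta>inf x y p k1 k2)"
  using Omega_formula_diag vec_nzI[OF right_vec_nz[OF assms(6,7)]] Omega_formula_right[OF assms]
    vec_nzI[OF left_vec_nz[OF assms]] Omega_formula_left[OF assms] by (rule constraintsI)

lemma Omega_formula_defined:
  assumes "x \<noteq> 0" "x \<noteq> 1" "y \<noteq> 0" "y \<noteq> 1" "y \<noteq> x" "k1 \<noteq> 0" "k2 \<noteq> 0"
  shows "formulae_defined \<theta> \<theta>inf (vector [0, x, 1]) (Omega_formula \<theta> \<theta>inf x y p k1 k2)"
  unfolding formulae_defined_def
proof (intro exI conjI allI)
  show "left_vec x y k1 k2 v* Omega_formula \<theta> \<theta>inf x y p k1 k2 = \<mu>p *s left_vec x y k1 k2"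
    by (rule Omega_formula_left[OF assms])
  show "Omega_formula \<theta> \<theta>inf x y p k1 k2 *v right_vec k1 k2 = \<mu>m *s right_vec k1 k2"
    by (rule Omega_formula_right[OF assms])
  show "left_vec x y k1 k2 $ i * right_vec k1 k2 $ i \<noteq> 0" for i
    using left_vec_nz[OF assms] right_vec_nz[OF assms(6,7)] by simp
  show "(\<Sum>i\<in>UNIV. vector [0, x, 1] $ i * (left_vec x y k1 k2 $ i * right_vec k1 k2 $ i)) \<noteq> 0"
    using left_weights_sum(2)[OF assms(1,2), of y] right_vec_nz[OF assms(6,7)]
    by (simp add: sum_3 left_vec_def)
qed

lemma Omega_formula_unique:
  assumes nz: "x \<noteq> 0" "x \<noteq> 1" "y \<noteq> 0" "y \<noteq> 1" "y \<noteq> x" "k1 \<noteq> 0" "k2 \<noteq> 0"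
    and A: "\<And>i. A $ i $ i = - \<theta> $ i" "A *v right_vec k1 k2 = \<mu>m *s right_vec k1 k2"
      "left_vec x y k1 k2 v* A = \<mu>p *s left_vec x y k1 k2"
  obtains p where "A = Omega_formula \<theta> \<theta>inf x y p k1 k2"
proof -
  \<comment> \<open>The (1,2) entry of the formula is solved for \<open>S\<close>, and
    \<open>formula_S\<close> is then solved for \<open>p\<close>.\<close>
  define S where "S = 2 * (x - 1) * y * (k2 / k1 * A $ 1 $ 2) - formula_e \<theta> x y"
  define p where "p = (S - (\<theta>inf - 1) * y^2 - (1 - \<theta>inf * x) * y) / (x * (x - 1))"
  let ?F = "Omega_formula \<theta> \<theta>inf x y p k1 k2"
  have nz': "x - 1 \<noteq> 0" using nz by simp
  have S: "formula_S \<theta>inf x y p = S"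
    using nz nz' by (simp add: formula_S_def p_def)
  have "A - ?F = 0"
  proof (rule zero_matrix_3I[OF _ _ _ _ right_vec_nz[OF nz(6,7)] left_vec_nz[OF nz]])
    show "(A - ?F) $ i $ i = 0" for i by (simp add: A(1) Omega_formula_diag)
    show "(A - ?F) *v right_vec k1 k2 = 0"
      by (simp add: matrix_vector_mult_diff_rdistrib A(2) Omega_formula_right[OF nz])
    have "v v* (X - Y) = v v* X - v v* Y" for v and X Y :: "complex^3^3"
      by (simp add: vec_eq_iff vector_matrix_mult_def sum_subtractf algebra_simps)
    thus "left_vec x y k1 k2 v* (A - ?F) = 0"
      by (simp add: A(3) Omega_formula_left[OF nz])
    show "(A - ?F) $ 1 $ 2 = 0"
      using nz nz' by (simp add: Omega_formula_eq_gauged S gauged_formula_def) (simp add: S_def)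
  qed
  thus ?thesis using that by simp
qed

text \<open>Since \<open>l \<cdot> r = 0\<close>, the products \<open>l\<^sub>i r\<^sub>i\<close> are determined up to a factor by the zero \<open>y\<close>
  of \<open>\<Sum>\<^sub>i l\<^sub>i r\<^sub>i / (s - u\<^sub>i)\<close>.\<close>

lemma Omega_formula_exists:
  assumes x: "x \<noteq> 0" "x \<noteq> 1"
    and A: "\<And>i. A $ i $ i = - \<theta> $ i" "A *v r = \<mu>m *s r" "l v* A = \<mu>p *s l"
    and nz: "\<And>i. l $ i * r $ i \<noteq> 0" and T: "x * (l$2 * r$2) + l$3 * r$3 \<noteq> 0"
  defines "y \<equiv> - x * (l$1 * r$1) / (x * (l$2 * r$2) + l$3 * r$3)"
  obtains p where "y \<noteq> 0" "y \<noteq> 1" "y \<noteq> x" "A = Omega_formula \<theta> \<theta>inf x y p (r$1 / r$3) (r$2 / r$3)"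
proof -
  define T where "T = x * (l$2 * r$2) + l$3 * r$3"
  have T: "T \<noteq> 0" using T by (simp add: T_def)
  have y: "y = - x * (l$1 * r$1) / T" by (simp add: y_def T_def)
  have x': "x - 1 \<noteq> 0" using x by simp
  have r: "r $ i \<noteq> 0" and l: "l $ i \<noteq> 0" for i using nz[of i] by auto
  have o: "l$1 * r$1 + l$2 * r$2 + l$3 * r$3 = 0"
    by (rule left_right_orthogonal[OF A(2,3)])
  \<comment> \<open>Division by \<open>- T\<close> turns the products \<open>l $ i * r $ i\<close>
    into \<open>left_weights x y\<close>; in particular none of the values \<open>0\<close>,
    \<open>x\<close>, \<open>1\<close> is taken by \<open>y\<close>.\<close>
  have w1: "left_weights x y $ 1 = - (l$1 * r$1) / T"
    using x T by (simp add: left_weights_def y)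
  have yx: "y - x = - (x * (x - 1)) * (l$2 * r$2) / T"
    using T o by (simp add: y divide_simps T_def) algebra
  hence w2: "left_weights x y $ 2 = - (l$2 * r$2) / T"
    using x x' T by (simp add: left_weights_def)
  have y1: "1 - y = - (x - 1) * (l$3 * r$3) / T"
    using T o by (simp add: y divide_simps T_def) algebra
  hence w3: "left_weights x y $ 3 = - (l$3 * r$3) / T"
    using x' T by (simp add: left_weights_def divide_simps) (simp add: algebra_simps)
  have nzs: "y \<noteq> 0" "1 - y \<noteq> 0" "y - x \<noteq> 0" "r$1 / r$3 \<noteq> 0" "r$2 / r$3 \<noteq> 0"
    using y yx y1 T x x' r l by simp_all
  hence nz': "y \<noteq> 0" "y \<noteq> 1" "y \<noteq> x" "r$1 / r$3 \<noteq> 0" "r$2 / r$3 \<noteq> 0" by auto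
  have rv: "right_vec (r$1 / r$3) (r$2 / r$3) = (1 / r$3) *s r"
    using r by (simp add: right_vec_def vec_eq_iff forall_3)
  have lv: "left_vec x y (r$1 / r$3) (r$2 / r$3) = (- r$3 / T) *s l"
    using r T unfolding left_vec_def rv by (simp add: vec_eq_iff forall_3 w1 w2 w3)
  have "A *v right_vec (r$1 / r$3) (r$2 / r$3) = \<mu>m *s right_vec (r$1 / r$3) (r$2 / r$3)"
    unfolding rv by (simp add: vec.scale A(2) vec.scale_left_commute)
  moreover have sc: "(c *s l) v* A = c *s (l v* A)" for c
    by (simp add: vec_eq_iff vector_matrix_mult_def sum_distrib_left mult.assoc)
  have "left_vec x y (r$1 / r$3) (r$2 / r$3) v* A = \<mu>p *s left_vec x y (r$1 / r$3) (r$2 / r$3)"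
    unfolding lv sc A(3) by (rule vec.scale_left_commute)
  ultimately show ?thesis
    using Omega_formula_unique[OF x nz' A(1)] that nz'(1-3) by metis
qed

text \<open>The matrix determines its eigenvectors up to scalars, and the normalisations fix these
  scalars: the last entry of the right vector is \<open>1\<close>, and the weights satisfy
  \<open>x * w $ 2 + w $ 3 = - 1\<close>.\<close>

lemma Omega_formula_inj:
  assumes x: "x \<noteq> 0" "x \<noteq> 1" and y: "y \<noteq> 0" "y \<noteq> 1" "y \<noteq> x" and k: "k1 \<noteq> 0" "k2 \<noteq> 0"
    and Y: "Y \<noteq> 0" "Y \<noteq> 1" "Y \<noteq> x" and K: "K1 \<noteq> 0" "K2 \<noteq> 0"
    and eq: "Omega_formula \<theta> \<theta>inf x y p k1 k2 = Omega_formula \<theta> \<theta>inf x Y P K1 K2"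
  shows "y = Y" "k1 = K1" "k2 = K2"
proof -
  let ?A = "Omega_formula \<theta> \<theta>inf x y p k1 k2"
  note a = Omega_formula_constraints[OF x y k, of p]
  obtain s where s: "right_vec K1 K2 = s *s right_vec k1 k2"
    using right_eigenvector_unique[OF a Omega_formula_right[OF x y k, of p], of "right_vec K1 K2"]
      Omega_formula_right[OF x Y K, of P] vec_nzI[OF right_vec_nz[OF k]] eq by metis
  hence "s = 1" by (simp add: right_vec_def vec_eq_iff forall_3)
  with s show k': "k1 = K1" "k2 = K2" by (simp_all add: right_vec_def vec_eq_iff forall_3)
  obtain s where s: "left_vec x Y k1 k2 = s *s left_vec x y k1 k2"
    using left_eigenvector_unique[OF a Omega_formula_left[OF x y k, of p], of "left_vec x Y k1 k2"]
      Omega_formula_left[OF x Y K, of P] vec_nzI[OF left_vec_nz[OF x y k]] eq unfolding k' by metis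
  hence w: "left_weights x Y $ i = s * left_weights x y $ i" for i
    using right_vec_nz[OF k] by (simp add: left_vec_def vec_eq_iff)
  have "s = 1" using left_weights_sum(2)[OF x, of y] left_weights_sum(2)[OF x, of Y]
    unfolding w by algebra
  hence "left_weights x Y $ 1 = left_weights x y $ 1" using w by simp
  thus "y = Y" using x by (simp add: left_weights_def)
qed

end

section \<open>The differential equations\<close>

lemma Omega_hat_nth:
  "Omega_hat x A $ 1 $ 1 = 0" "Omega_hat x A $ 1 $ 2 = - A$1$2 / x" "Omega_hat x A $ 1 $ 3 = 0"
  "Omega_hat x A $ 2 $ 1 = - A$2$1 / x" "Omega_hat x A $ 2 $ 2 = 0" "Omega_hat x A $ 2 $ 3 = A$2$3 / (1 - x)"
  "Omega_hat x A $ 3 $ 1 = 0" "Omega_hat x A $ 3 $ 2 = A$3$2 / (1 - x)" "Omega_hat x A $ 3 $ 3 = 0"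
  by (simp_all add: Omega_hat_def)

lemma commutator_nth_3:
  "commutator A B $ i $ j = A$i$1 * B$1$j + A$i$2 * B$2$j + A$i$3 * B$3$j
     - (B$i$1 * A$1$j + B$i$2 * A$2$j + B$i$3 * A$3$j)" for A :: "complex^3^3"
  by (simp add: commutator_def matrix_matrix_mult_def sum_3)

text \<open>Each entry (i,j) of \<open>Omega_hat x A\<close> is \<open>A $ i $ j\<close> times a
  coefficient symmetric in i and j, so the terms of the commutator cancel on the diagonal. The flow
  thus preserves the prescribed diagonal.\<close>

lemma commutator_Omega_hat_diag: "commutator A (Omega_hat x A) $ i $ i = 0"
proof -
  have "\<forall>i. commutator A (Omega_hat x A) $ i $ i = 0"
    unfolding forall_3 commutator_nth_3 Omega_hat_nth by (simp add: algebra_simps)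
  thus ?thesis by blast
qed

context PVI_parameters
begin

lemma right_vec_deriv:
  assumes "(k1 has_field_derivative k1') (at x)" "(k2 has_field_derivative k2') (at x)"
  shows "((\<lambda>t. right_vec (k1 t) (k2 t) $ i) has_field_derivative vector [k1', k2', 0] $ i) (at x)"
proof -
  have "\<forall>i. ((\<lambda>t. right_vec (k1 t) (k2 t) $ i) has_field_derivative vector [k1', k2', 0] $ i) (at x)"
    unfolding forall_3 right_vec_def vector_3 using assms by simp
  thus ?thesis by blast
qed

definition left_weights_d :: "complex \<Rightarrow> complex \<Rightarrow> complex \<Rightarrow> complex^3" where
  "left_weights_d x y y' = vector [y' / x - y / x^2,
     (1 - y) / (x - 1)^2 + y' / (x - 1) - (y' / x - y / x^2), - y' / (x - 1) - (1 - y) / (x - 1)^2]"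

lemma left_weights_deriv:
  assumes "(y has_field_derivative y') (at x)" "x \<noteq> 0" "x \<noteq> 1"
  shows "((\<lambda>t. left_weights t (y t) $ i) has_field_derivative left_weights_d x (y x) y' $ i) (at x)"
proof -
  \<comment> \<open>The weights sum to zero, so the second one is differentiated as minus the sum of
    the others.\<close>
  have 2: "\<forall>\<^sub>F t in nhds x. left_weights t (y t) $ 2 = - ((1 - y t) / (t - 1)) - y t / t"
  proof -
    have "\<forall>\<^sub>F t in nhds x. t \<noteq> 0 \<and> t \<noteq> 1"
      using assms(2,3) by (intro eventually_conj t1_space_nhds)
    thus ?thesis by eventually_elim (simp add: left_weights_def divide_simps, simp add: algebra_simps)
  qed
  have d1: "((\<lambda>t. y t / t) has_field_derivative y' / x - y x / x^2) (at x)"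
    using assms(1,2) by (auto intro!: derivative_eq_intros simp: divide_simps power2_eq_square)
  have d3: "((\<lambda>t. (1 - y t) / (t - 1)) has_field_derivative - y' / (x - 1) - (1 - y x) / (x - 1)^2) (at x)"
    using assms(1,3) by (auto intro!: derivative_eq_intros simp: divide_simps power2_eq_square)
  have d2: "((\<lambda>t. - ((1 - y t) / (t - 1)) - y t / t) has_field_derivative
      (1 - y x) / (x - 1)^2 + y' / (x - 1) - (y' / x - y x / x^2)) (at x)"
    by (rule DERIV_cong[OF DERIV_diff[OF DERIV_minus[OF d3] d1]]) simp
  have "\<forall>i. ((\<lambda>t. left_weights t (y t) $ i) has_field_derivative left_weights_d x (y x) y' $ i) (at x)"
    unfolding forall_3 DERIV_cong_ev[OF refl 2 refl] left_weights_d_def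
    using d1 d2 d3 by (simp add: left_weights_def)
  thus ?thesis by blast
qed

definition left_vec_d :: "complex \<Rightarrow> complex \<Rightarrow> complex \<Rightarrow> complex \<Rightarrow> complex \<Rightarrow> complex \<Rightarrow> complex \<Rightarrow> complex^3" where
  "left_vec_d x y k1 k2 y' k1' k2' = (\<chi> i. (left_weights_d x y y' $ i
     - left_weights x y $ i * (vector [k1', k2', 0] :: complex^3) $ i / right_vec k1 k2 $ i) / right_vec k1 k2 $ i)"

lemma left_vec_deriv:
  assumes "(y has_field_derivative y') (at x)" "(k1 has_field_derivative k1') (at x)"
    "(k2 has_field_derivative k2') (at x)" "x \<noteq> 0" "x \<noteq> 1" "k1 x \<noteq> 0" "k2 x \<noteq> 0"
  shows "((\<lambda>t. left_vec t (y t) (k1 t) (k2 t) $ i) has_field_derivative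
     left_vec_d x (y x) (k1 x) (k2 x) y' k1' k2' $ i) (at x)"
  unfolding left_vec_def left_vec_d_def vec_lambda_beta
  by (rule DERIV_cong[OF DERIV_divide[OF left_weights_deriv[OF assms(1,4,5)] right_vec_deriv[OF assms(2,3)]]])
    (use right_vec_nz[OF assms(6,7)] in \<open>simp_all add: field_simps\<close>)

lemma right_vec_flow:
  fixes x y p k1 k2 :: complex
  assumes nz: "x \<noteq> 0" "x \<noteq> 1" "y \<noteq> 0" "y \<noteq> 1" "y \<noteq> x" "k1 \<noteq> 0" "k2 \<noteq> 0"
  defines "H \<equiv> Omega_hat x (Omega_formula \<theta> \<theta>inf x y p k1 k2)"
  shows "(\<exists>a. vector [k1', k2', 0] + H *v right_vec k1 k2 = a *s right_vec k1 k2) \<longleftrightarrow>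
     k1' = l1_formula \<theta> x y p * k1 \<and> k2' = l2_formula \<theta> x y p * k2"
proof -
  define M where "M = gauged_formula \<theta> \<theta>inf x y (formula_S \<theta>inf x y p)"
  have l: "l1_formula \<theta> x y p = M $ 3 $ 2 / (1 - x) + M $ 1 $ 2 / x"
    "l2_formula \<theta> x y p = M $ 3 $ 2 / (1 - x) + M $ 2 $ 1 / x - M $ 2 $ 3 / (1 - x)"
    unfolding M_def by (rule l1_formula_gauged[OF nz(1-4)] l2_formula_gauged[OF nz(1,2,4,5)])+
  have "H *v right_vec k1 k2 = vector [- k1 * (M$1$2 / x), k2 * (M$2$3 / (1 - x) - M$2$1 / x), M$3$2 / (1 - x)]"
    using nz unfolding H_def M_def
    by (simp add: vec_eq_iff forall_3 matrix_vector_mult_def sum_3 Omega_hat_nth right_vec_def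
        Omega_formula_eq_gauged right_diff_distrib[where b = "_ / _"])
  hence "(\<exists>a. vector [k1', k2', 0] + H *v right_vec k1 k2 = a *s right_vec k1 k2) \<longleftrightarrow>
    (\<exists>a. k1' - k1 * (M$1$2 / x) = a * k1 \<and> k2' + k2 * (M$2$3 / (1 - x) - M$2$1 / x) = a * k2 \<and> M$3$2 / (1 - x) = a)"
    by (simp add: vec_eq_iff forall_3 right_vec_def)
  also have "\<dots> \<longleftrightarrow> k1' = l1_formula \<theta> x y p * k1 \<and> k2' = l2_formula \<theta> x y p * k2"
    unfolding l by (auto simp: algebra_simps)
  finally show ?thesis .
qed

text \<open>With the factors \<open>1 / k_i\<close> removed, the components \<open>B1\<close>,
  \<open>B2\<close>, \<open>B3\<close> of \<open>l' - l H\<close> sum to zero, and so do the weights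
  \<open>w\<close>. Proportionality of the two vectors is therefore a single equation between first
  and third components, and \<open>left_weights_flow\<close> evaluates it to
  \<open>y' = p\<close>.\<close>

lemma left_vec_flow:
  fixes x y p k1 k2 :: complex
  assumes nz: "x \<noteq> 0" "x \<noteq> 1" "y \<noteq> 0" "y \<noteq> 1" "y \<noteq> x" "k1 \<noteq> 0" "k2 \<noteq> 0"
    and k': "k1' = l1_formula \<theta> x y p * k1" "k2' = l2_formula \<theta> x y p * k2"
  defines "H \<equiv> Omega_hat x (Omega_formula \<theta> \<theta>inf x y p k1 k2)"
  shows "(\<exists>b. left_vec_d x y k1 k2 y' k1' k2' - left_vec x y k1 k2 v* H = b *s left_vec x y k1 k2)
    \<longleftrightarrow> y' = p"
proof -
  define M where "M = gauged_formula \<theta> \<theta>inf x y (formula_S \<theta>inf x y p)"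
  define w where "w = left_weights x y"
  define w' where "w' = left_weights_d x y y'"
  define l1 where "l1 = M $ 3 $ 2 / (1 - x) + M $ 1 $ 2 / x"
  define l2 where "l2 = M $ 3 $ 2 / (1 - x) + M $ 2 $ 1 / x - M $ 2 $ 3 / (1 - x)"
  have l: "l1_formula \<theta> x y p = l1" "l2_formula \<theta> x y p = l2"
    unfolding M_def l1_def l2_def by (rule l1_formula_gauged[OF nz(1-4)] l2_formula_gauged[OF nz(1,2,4,5)])+
  define B1 where "B1 = w'$1 - w$1 * l1 + w$2 * M$2$1 / x"
  define B2 where "B2 = w'$2 - w$2 * l2 + w$1 * M$1$2 / x - w$3 * M$3$2 / (1 - x)"
  define B3 where "B3 = w'$3 - w$2 * M$2$3 / (1 - x)"
  have B: "left_vec_d x y k1 k2 y' k1' k2' - left_vec x y k1 k2 v* H = vector [B1 / k1, B2 / k2, B3]"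
    using nz unfolding H_def M_def w_def w'_def B1_def B2_def B3_def k' l
    by (simp add: vec_eq_iff forall_3 vector_matrix_mult_def sum_3 Omega_hat_nth right_vec_def left_vec_def
        left_vec_d_def Omega_formula_eq_gauged divide_simps) (simp add: algebra_simps)
  have w: "w$1 + w$2 + w$3 = 0" "w$3 \<noteq> 0"
    unfolding w_def using left_weights_sum(1) left_weights_nz nz by blast+
  have w2: "w$2 = - w$1 - w$3" using w(1) by algebra
  have "w'$1 + w'$2 + w'$3 = 0" by (simp add: w'_def left_weights_d_def)
  hence w'2: "w'$2 = - w'$1 - w'$3" by algebra
  have B2: "B2 = - B1 - B3"
    unfolding B1_def B2_def B3_def w'2 l1_def l2_def w2
    by (simp add: algebra_simps add_divide_distrib diff_divide_distrib)
  have fl: "w$3 * B1 - w$1 * B3 = (y' - p) / (x * (x - 1))"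
    using left_weights_flow[OF nz(1-5), of y' \<theta> \<theta>inf p]
    unfolding B1_def B3_def w_def M_def l1_def by (simp add: w'_def left_weights_d_def)
  have "(\<exists>b. left_vec_d x y k1 k2 y' k1' k2' - left_vec x y k1 k2 v* H = b *s left_vec x y k1 k2)
    \<longleftrightarrow> (\<exists>b. B1 = b * w$1 \<and> B2 = b * w$2 \<and> B3 = b * w$3)"
    using nz(6,7) unfolding B by (simp add: vec_eq_iff forall_3 left_vec_def right_vec_def w_def)
  also have "\<dots> \<longleftrightarrow> y' = p"
  proof
    assume "\<exists>b. B1 = b * w$1 \<and> B2 = b * w$2 \<and> B3 = b * w$3"
    hence "w$3 * B1 - w$1 * B3 = 0" by (auto simp: algebra_simps)
    thus "y' = p" using fl nz by simp
  next
    assume "y' = p"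
    hence *: "w$3 * B1 = w$1 * B3" using fl by simp
    hence "B1 = B3 / w$3 * w$1" using w(2) by (simp add: field_simps)
    moreover from this have "B2 = B3 / w$3 * w$2" unfolding B2 w2 using w(2) by (simp add: field_simps)
    ultimately show "\<exists>b. B1 = b * w$1 \<and> B2 = b * w$2 \<and> B3 = b * w$3"
      using w(2) by (intro exI[of _ "B3 / w$3"]) simp
  qed
  finally show ?thesis .
qed

end

lemma scale_vector_matrix: "(c *s v) v* A = c *s (v v* A)"
  for v :: "complex^'n" and A :: "complex^'m^'n"
  by (simp add: vec_eq_iff vector_matrix_mult_def sum_distrib_left mult.assoc)

context PVI_parameters
begin

text \<open>Nothing is assumed about the regularity of \<open>p\<close>, which is only a value
  attached to each point. This is the situation when a given solution has been put into the form of
  the formulae pointwise.\<close>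

lemma Omega_formula_flow:
  fixes y p k1 k2 :: "complex \<Rightarrow> complex"
  defines "F \<equiv> \<lambda>t. Omega_formula \<theta> \<theta>inf t (y t) (p t) (k1 t) (k2 t)"
  assumes ev: "\<forall>\<^sub>F t in nhds x. t \<noteq> 0 \<and> t \<noteq> 1 \<and> y t \<noteq> 0 \<and> y t \<noteq> 1 \<and> y t \<noteq> t \<and> k1 t \<noteq> 0 \<and> k2 t \<noteq> 0"
    and d: "(y has_field_derivative y') (at x)" "(k1 has_field_derivative k1') (at x)"
      "(k2 has_field_derivative k2') (at x)"
    and F: "\<And>i j. ((\<lambda>t. F t $ i $ j) has_field_derivative commutator (F x) (Omega_hat x (F x)) $ i $ j) (at x)"
  shows "y' = p x" "k1' = l1_formula \<theta> x (y x) (p x) * k1 x" "k2' = l2_formula \<theta> x (y x) (p x) * k2 x"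
proof -
  have nz: "x \<noteq> 0" "x \<noteq> 1" "y x \<noteq> 0" "y x \<noteq> 1" "y x \<noteq> x" "k1 x \<noteq> 0" "k2 x \<noteq> 0"
    using eventually_nhds_x_imp_x[OF ev] by auto
  define H where "H = Omega_hat x (F x)"
  have F0: "((\<lambda>t. F t $ i $ j) has_field_derivative (commutator (F x) H + 0) $ i $ j) (at x)" for i j
    using F[of i j] by (simp add: H_def)
  have cons: "constraints \<theta> \<theta>inf (F x)" unfolding F_def by (rule Omega_formula_constraints[OF nz])
  have evr: "\<forall>\<^sub>F t in nhds x. F t *v right_vec (k1 t) (k2 t) = \<mu>m *s right_vec (k1 t) (k2 t)"
    using ev by eventually_elim (auto simp: F_def intro!: Omega_formula_right)
  have evl: "\<forall>\<^sub>F t in nhds x. left_vec t (y t) (k1 t) (k2 t) v* F t = \<mu>p *s left_vec t (y t) (k1 t) (k2 t)"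
    using ev by eventually_elim (auto simp: F_def intro!: Omega_formula_left)
  have "F x *v (vector [k1', k2', 0] + H *v right_vec (k1 x) (k2 x))
     = \<mu>m *s (vector [k1', k2', 0] + H *v right_vec (k1 x) (k2 x))"
    using matrix_vector_deriv[OF F0 right_vec_deriv[OF d(2,3)] evr] by simp
  then obtain a where "vector [k1', k2', 0] + H *v right_vec (k1 x) (k2 x) = a *s right_vec (k1 x) (k2 x)"
    using right_eigenvector_unique[OF cons eventually_nhds_x_imp_x[OF evr] _ vec_nzI[OF right_vec_nz[OF nz(6,7)]]]
    by metis
  thus k: "k1' = l1_formula \<theta> x (y x) (p x) * k1 x" "k2' = l2_formula \<theta> x (y x) (p x) * k2 x"
    using right_vec_flow[OF nz, of k1' k2' "p x"] unfolding H_def F_def by blast+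
  let ?l' = "left_vec_d x (y x) (k1 x) (k2 x) y' k1' k2'" and ?l = "left_vec x (y x) (k1 x) (k2 x)"
  have "(?l' - ?l v* H) v* F x = \<mu>p *s (?l' - ?l v* H)"
    using vector_matrix_deriv[OF F0 left_vec_deriv[OF d nz(1,2,6,7)] evl]
    by (simp add: vector_matrix_mult_def zero_vec_def[symmetric])
  then obtain b where "?l' - ?l v* H = b *s ?l"
    using left_eigenvector_unique[OF cons eventually_nhds_x_imp_x[OF evl] _ vec_nzI[OF left_vec_nz[OF nz]]]
    by metis
  thus "y' = p x" using left_vec_flow[OF nz k, of y'] unfolding H_def F_def by blast
qed

lemma gauged_12_deriv:
  fixes y p :: "complex \<Rightarrow> complex"
  assumes d: "(y has_field_derivative p x) (at x)" "(p has_field_derivative q) (at x)"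
    and nz: "x \<noteq> 1" "y x \<noteq> 0"
  defines "S' \<equiv> (2 * x - 1) * p x + x * (x - 1) * q + 2 * (\<theta>inf - 1) * y x * p x - \<theta>inf * y x + (1 - \<theta>inf * x) * p x"
    and "e' \<equiv> \<theta>$1 * (1 - p x) + \<theta>$2 * (p x * (1 - x) - y x)"
  shows "((\<lambda>t. gauged_formula \<theta> \<theta>inf t (y t) (formula_S \<theta>inf t (y t) (p t)) $ 1 $ 2) has_field_derivative
     (S' + e') / (2 * (x - 1) * y x)
      - (formula_S \<theta>inf x (y x) (p x) + formula_e \<theta> x (y x)) * (y x + (x - 1) * p x) / (2 * (x - 1)^2 * y x^2)) (at x)"
proof -
  have S: "((\<lambda>t. formula_S \<theta>inf t (y t) (p t)) has_field_derivative S') (at x)"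
    unfolding formula_S_def S'_def
    by (rule derivative_eq_intros d refl | simp add: algebra_simps)+
  have e: "((\<lambda>t. formula_e \<theta> t (y t)) has_field_derivative e') (at x)"
    unfolding formula_e_def e'_def
    by (rule derivative_eq_intros d refl | simp add: algebra_simps)+
  have y: "((\<lambda>t. 2 * (t - 1) * y t) has_field_derivative 2 * (y x + (x - 1) * p x)) (at x)"
    by (rule derivative_eq_intros d refl | simp add: algebra_simps)+
  have "x - 1 \<noteq> 0" using nz by simp
  thus ?thesis unfolding gauged_formula_def vector_3
    by (intro DERIV_cong[OF DERIV_divide[OF DERIV_add[OF S e] y]])
      (use nz in \<open>simp_all add: divide_simps\<close>, algebra?)
qed

lemma Omega_formula_12_deriv:
  fixes y p k1 k2 :: "complex \<Rightarrow> complex"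
  defines "F \<equiv> \<lambda>t. Omega_formula \<theta> \<theta>inf t (y t) (p t) (k1 t) (k2 t)"
  assumes ev: "\<forall>\<^sub>F t in nhds x. t \<noteq> 0 \<and> t \<noteq> 1 \<and> y t \<noteq> 0 \<and> y t \<noteq> 1 \<and> y t \<noteq> t \<and> k1 t \<noteq> 0 \<and> k2 t \<noteq> 0"
    and d: "(y has_field_derivative p x) (at x)" "(p has_field_derivative q) (at x)"
      "(k1 has_field_derivative l1_formula \<theta> x (y x) (p x) * k1 x) (at x)"
      "(k2 has_field_derivative l2_formula \<theta> x (y x) (p x) * k2 x) (at x)"
  shows "((\<lambda>t. F t $ 1 $ 2) has_field_derivative commutator (F x) (Omega_hat x (F x)) $ 1 $ 2
    + k1 x / k2 x * (x / (2 * y x) * (q - PVI_rhs ((\<theta>inf - 1)^2 / 2) (- ((\<theta>$1)^2) / 2) ((\<theta>$3)^2 / 2)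
        ((1 - (\<theta>$2)^2) / 2) x (y x) (p x)))) (at x)"
proof -
  have nz: "x \<noteq> 0" "x \<noteq> 1" "y x \<noteq> 0" "y x \<noteq> 1" "y x \<noteq> x" "k1 x \<noteq> 0" "k2 x \<noteq> 0"
    using eventually_nhds_x_imp_x[OF ev] by auto
  let ?M = "\<lambda>t. gauged_formula \<theta> \<theta>inf t (y t) (formula_S \<theta>inf t (y t) (p t))"
  define M where "M = ?M x"
  note l = l1_formula_gauged[OF nz(1-4), where \<theta> = \<theta> and p = "p x" and \<theta>inf = \<theta>inf, folded M_def]
    l2_formula_gauged[OF nz(1,2,4,5), where \<theta> = \<theta> and p = "p x" and \<theta>inf = \<theta>inf, folded M_def]
  note pvi = gauged_formula_PVI[OF nz(1-5), where \<theta> = \<theta> and p = "p x" and \<theta>inf = \<theta>inf and q = q, folded M_def, symmetric]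
  have F: "\<forall>\<^sub>F t in nhds x. F t $ 1 $ 2 = k1 t / k2 t * ?M t $ 1 $ 2"
    using ev by eventually_elim (simp add: F_def Omega_formula_eq_gauged)
  have c: "commutator (F x) (Omega_hat x (F x)) $ 1 $ 2 
      = k1 x / k2 x * ((\<theta>$1 - \<theta>$2) * M$1$2 / x + M$1$3 * M$3$2 / (1 - x))"
  proof -
    have "F x $ 1 $ 2 = k1 x / k2 x * M $ 1 $ 2" "F x $ 1 $ 3 = k1 x * M $ 1 $ 3" "F x $ 3 $ 2 = M $ 3 $ 2 / k2 x"
      using nz by (simp_all add: F_def Omega_formula_eq_gauged M_def)
    moreover have "F x $ 1 $ 1 = - \<theta> $ 1" "F x $ 2 $ 2 = - \<theta> $ 2"
      by (simp_all add: F_def Omega_formula_diag)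
    ultimately show ?thesis
      unfolding commutator_nth_3 Omega_hat_nth by (simp add: ring_distribs diff_divide_distrib mult_ac)
  qed
  have kk: "((\<lambda>t. k1 t / k2 t) has_field_derivative k1 x / k2 x * (M$1$2 / x - M$2$1 / x + M$2$3 / (1 - x))) (at x)"
  proof -
    have "l1_formula \<theta> x (y x) (p x) - l2_formula \<theta> x (y x) (p x) = M$1$2 / x - M$2$1 / x + M$2$3 / (1 - x)"
      unfolding l by simp
    moreover have "(a * k1 x * k2 x - k1 x * (b * k2 x)) / (k2 x * k2 x) = k1 x / k2 x * (a - b)" for a b
      using nz by (simp add: divide_simps) (simp add: algebra_simps)
    ultimately show ?thesis using DERIV_divide[OF d(3,4) nz(7)] by simp
  qed
  \<comment> \<open>\<open>K\<close> is the factor \<open>k1 x / k2 x\<close>, and the last bracket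
    is the left side of \<open>gauged_formula_PVI\<close>.\<close>
  have arrange: "K * L * m + (X - Y) * K = K * (u + v) + K * (X - Y + L * m - u - v)"
    for K L m X Y u v :: complex
    by (simp add: algebra_simps)
  show ?thesis
    unfolding DERIV_cong_ev[OF refl F refl] c pvi
    by (rule DERIV_cong[OF DERIV_mult[OF kk gauged_12_deriv[OF d(1,2) nz(2,3)]]])
      (unfold M_def[symmetric], rule arrange)
qed

lemma Omega_formula_differentiable:
  fixes y p k1 k2 :: "complex \<Rightarrow> complex"
  assumes nz: "x \<noteq> 0" "x \<noteq> 1" "y x \<noteq> 0" "y x \<noteq> 1" "y x \<noteq> x" "k1 x \<noteq> 0" "k2 x \<noteq> 0"
    and d: "y field_differentiable (at x)" "p field_differentiable (at x)"
      "k1 field_differentiable (at x)" "k2 field_differentiable (at x)"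
  shows "(\<lambda>t. Omega_formula \<theta> \<theta>inf t (y t) (p t) (k1 t) (k2 t) $ i $ j) field_differentiable (at x)"
proof -
  have nz': "1 - y x \<noteq> 0" "y x - 1 \<noteq> 0" "x - y x \<noteq> 0" "x - 1 \<noteq> 0" using nz by auto
  have "\<forall>i j. (\<lambda>t. Omega_formula \<theta> \<theta>inf t (y t) (p t) (k1 t) (k2 t) $ i $ j) field_differentiable (at x)"
    unfolding forall_3 Omega_formula_def Let_def vector_3
    by (intro conjI derivative_intros field_differentiable_power field_differentiable_ident d) (use nz nz' in auto)
  thus ?thesis by blast
qed

lemma Omega_formula_flow_iff_PVI:
  fixes y p k1 k2 :: "complex \<Rightarrow> complex"
  defines "F \<equiv> \<lambda>t. Omega_formula \<theta> \<theta>inf t (y t) (p t) (k1 t) (k2 t)"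
  assumes ev: "\<forall>\<^sub>F t in nhds x. t \<noteq> 0 \<and> t \<noteq> 1 \<and> y t \<noteq> 0 \<and> y t \<noteq> 1 \<and> y t \<noteq> t \<and> k1 t \<noteq> 0 \<and> k2 t \<noteq> 0"
    and d: "(y has_field_derivative p x) (at x)" "(p has_field_derivative q) (at x)"
      "(k1 has_field_derivative l1_formula \<theta> x (y x) (p x) * k1 x) (at x)"
      "(k2 has_field_derivative l2_formula \<theta> x (y x) (p x) * k2 x) (at x)"
  shows "(\<forall>i j. ((\<lambda>t. F t $ i $ j) has_field_derivative commutator (F x) (Omega_hat x (F x)) $ i $ j) (at x))
    \<longleftrightarrow> q = PVI_rhs ((\<theta>inf - 1)^2 / 2) (- ((\<theta>$1)^2) / 2) ((\<theta>$3)^2 / 2) ((1 - (\<theta>$2)^2) / 2) x (y x) (p x)"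
    (is "?ode \<longleftrightarrow> q = ?pvi")
proof -
  have nz: "x \<noteq> 0" "x \<noteq> 1" "y x \<noteq> 0" "y x \<noteq> 1" "y x \<noteq> x" "k1 x \<noteq> 0" "k2 x \<noteq> 0"
    using eventually_nhds_x_imp_x[OF ev] by auto
  define H where "H = Omega_hat x (F x)"
  \<comment> \<open>The derivative exists because the formulae are rational in differentiable
    functions; \<open>R\<close> is its deviation from the differential equation.\<close>
  define R where "R = (\<chi> i j. deriv (\<lambda>t. F t $ i $ j) x) - commutator (F x) H"
  have "(\<lambda>t. F t $ i $ j) field_differentiable (at x)" for i j
    unfolding F_def using d
    by (intro Omega_formula_differentiable[where y = y and p = p and ?k1.0 = k1 and ?k2.0 = k2])
      (use nz in \<open>auto simp: field_differentiable_def\<close>)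
  hence FR: "((\<lambda>t. F t $ i $ j) has_field_derivative (commutator (F x) H + R) $ i $ j) (at x)" for i j
    by (simp add: R_def field_differentiable_derivI)
  have evr: "\<forall>\<^sub>F t in nhds x. F t *v right_vec (k1 t) (k2 t) = \<mu>m *s right_vec (k1 t) (k2 t)"
    using ev by eventually_elim (auto simp: F_def intro!: Omega_formula_right)
  have evl: "\<forall>\<^sub>F t in nhds x. left_vec t (y t) (k1 t) (k2 t) v* F t = \<mu>p *s left_vec t (y t) (k1 t) (k2 t)"
    using ev by eventually_elim (auto simp: F_def intro!: Omega_formula_left)
  let ?r = "right_vec (k1 x) (k2 x)" and ?l = "left_vec x (y x) (k1 x) (k2 x)"
  \<comment> \<open>With these values of \<open>k1'\<close>, \<open>k2'\<close> and
    \<open>y' = p\<close> the flow relations for both eigenvectors are algebraic identities,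
    available before any equation for \<open>F\<close> is known.\<close>
  obtain a where a: "vector [l1_formula \<theta> x (y x) (p x) * k1 x, l2_formula \<theta> x (y x) (p x) * k2 x, 0]
      + H *v ?r = a *s ?r"
    using right_vec_flow[OF nz, of _ _ "p x"] unfolding H_def F_def by blast
  have Rr: "R *v ?r = 0"
    using matrix_vector_deriv[OF FR right_vec_deriv[OF d(3,4)] evr] eventually_nhds_x_imp_x[OF evr]
    unfolding a by (simp add: vec.scale mult.commute)
  obtain b where b: "left_vec_d x (y x) (k1 x) (k2 x) (p x) (l1_formula \<theta> x (y x) (p x) * k1 x)
      (l2_formula \<theta> x (y x) (p x) * k2 x) - ?l v* H = b *s ?l"
    using left_vec_flow[OF nz refl refl, of "p x"] unfolding H_def F_def by blast
  have lR: "?l v* R = 0"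
    using vector_matrix_deriv[OF FR left_vec_deriv[OF d(1,3,4) nz(1,2,6,7)] evl] eventually_nhds_x_imp_x[OF evl]
    unfolding b by (simp add: scale_vector_matrix mult.commute)
  have R0: "R $ i $ i = 0" for i
  proof -
    have "((\<lambda>t. F t $ i $ i) has_field_derivative 0) (at x)"
      unfolding F_def Omega_formula_diag by simp
    thus ?thesis using DERIV_unique[OF FR[of i i]] by (simp add: H_def commutator_Omega_hat_diag)
  qed
  have "R $ 1 $ 2 = k1 x / k2 x * (x / (2 * y x) * (q - ?pvi))"
    using DERIV_unique[OF FR[of 1 2, unfolded F_def H_def] Omega_formula_12_deriv[OF ev d]]
    by (simp add: F_def H_def)
  hence R12: "R $ 1 $ 2 = 0 \<longleftrightarrow> q = ?pvi" using nz by simp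
  have "?ode \<longleftrightarrow> R = 0"
  proof
    assume ?ode
    hence "(commutator (F x) H + R) $ i $ j = commutator (F x) H $ i $ j" for i j
      using DERIV_unique[OF FR] unfolding H_def by blast
    thus "R = 0" by (simp add: vec_eq_iff)
  next
    assume "R = 0"
    thus ?ode using FR by (simp add: H_def)
  qed
  also have "\<dots> \<longleftrightarrow> R $ 1 $ 2 = 0"
    using zero_matrix_3I[OF R0 Rr lR _ right_vec_nz[OF nz(6,7)] left_vec_nz[OF nz]] by auto
  finally show ?thesis using R12 by simp
qed

end

section \<open>Diagonal conjugation and exponentials of primitives\<close>

lemma diagonal_mult_nth: "(diagonal_matrix d ** A) $ i $ j = d $ i * A $ i $ j"
proof -
  have "(diagonal_matrix d ** A) $ i $ j = (\<Sum>k\<in>UNIV. if k = i then d $ i * A $ i $ j else 0)"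
    unfolding matrix_matrix_mult_def diagonal_matrix_def vec_lambda_beta by (rule sum.cong) auto
  thus ?thesis by simp
qed

lemma mult_diagonal_nth: "(A ** diagonal_matrix d) $ i $ j = A $ i $ j * d $ j"
proof -
  have "(A ** diagonal_matrix d) $ i $ j = (\<Sum>k\<in>UNIV. if k = j then A $ i $ j * d $ j else 0)"
    unfolding matrix_matrix_mult_def diagonal_matrix_def vec_lambda_beta by (rule sum.cong) auto
  thus ?thesis by simp
qed

lemma diagonal_conj_nth:
  "(diagonal_matrix d ** A ** diagonal_matrix e) $ i $ j = d $ i * A $ i $ j * e $ j"
  by (simp add: diagonal_mult_nth mult_diagonal_nth)

lemma matrix_inv_diagonal:
  assumes "\<And>i. d $ i \<noteq> 0"
  shows "matrix_inv (diagonal_matrix d) = diagonal_matrix (\<chi> i. inverse (d $ i))"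
proof -
  let ?A = "diagonal_matrix d" and ?B = "diagonal_matrix (\<chi> i. inverse (d $ i))"
  have 1: "?A ** ?B = mat 1" "?B ** ?A = mat 1"
    using assms by (simp_all add: vec_eq_iff diagonal_mult_nth) (simp_all add: diagonal_matrix_def mat_def)
  hence "?A ** matrix_inv ?A = mat 1"
    unfolding matrix_inv_def by (metis (mono_tags, lifting) someI_ex)
  hence "?B ** (?A ** matrix_inv ?A) = ?B" by simp
  thus ?thesis unfolding matrix_mul_assoc 1 by simp
qed

lemma conj_class_eq:
  fixes W :: "'a \<Rightarrow> complex^3^3"
  shows "conj_class S W = {restrict (\<lambda>s. \<chi> i j. vector [c1, c2, 1] $ i * W s $ i $ j / vector [c1, c2, 1] $ j) S
     | c1 c2. c1 \<noteq> 0 \<and> c2 \<noteq> 0}"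
proof -
  have nz: "(vector [c1, c2, 1] :: complex^3) $ i \<noteq> 0" if "c1 \<noteq> 0" "c2 \<noteq> 0" for c1 c2 :: complex and i
    using exhaust_3[of i] that by auto
  have eq: "diagonal_matrix (vector [c1, c2, 1]) ** A ** matrix_inv (diagonal_matrix (vector [c1, c2, 1]))
     = (\<chi> i j. vector [c1, c2, 1] $ i * A $ i $ j / vector [c1, c2, 1] $ j)"
    if "c1 \<noteq> 0" "c2 \<noteq> 0" for c1 c2 :: complex and A :: "complex^3^3"
    by (simp add: vec_eq_iff matrix_inv_diagonal[OF nz[OF that]] diagonal_conj_nth divide_inverse)
  have *: "restrict (\<lambda>s. diagonal_matrix (vector [c1, c2, 1]) ** W s **
      matrix_inv (diagonal_matrix (vector [c1, c2, 1]))) S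
     = restrict (\<lambda>s. \<chi> i j. vector [c1, c2, 1] $ i * W s $ i $ j / vector [c1, c2, 1] $ j) S"
    if "c1 \<noteq> 0" "c2 \<noteq> 0" for c1 c2 :: complex
    by (simp only: eq[OF that])
  have cong: "(V = A \<and> P \<and> Q) = (V = B \<and> P \<and> Q)" if "P \<Longrightarrow> Q \<Longrightarrow> A = B"
    for V A B :: "'a \<Rightarrow> complex^3^3" and P Q
    using that by auto
  show ?thesis unfolding conj_class_def by (intro Collect_cong ex_cong1 cong) (rule *)
qed

text \<open>Replaces integrals by the linear equation \<open>k' = l k\<close>. In the converse
  direction simple connectedness supplies a holomorphic logarithm of the nowhere vanishing
  \<open>k\<close>, and this logarithm is a primitive of \<open>l\<close>.\<close>

lemma exp_integrals_iff:
  assumes "open X" "simply_connected X"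
  shows "k \<in> exp_integrals X l \<longleftrightarrow> (\<forall>x\<in>X. (k has_field_derivative l x * k x) (at x) \<and> k x \<noteq> 0)"
proof
  assume "k \<in> exp_integrals X l"
  then obtain k0 P where P: "k0 \<noteq> 0" "\<And>x. x \<in> X \<Longrightarrow> (P has_field_derivative l x) (at x)"
    "\<And>x. x \<in> X \<Longrightarrow> k x = k0 * exp (P x)" by (auto simp: exp_integrals_def)
  show "\<forall>x\<in>X. (k has_field_derivative l x * k x) (at x) \<and> k x \<noteq> 0"
  proof (intro ballI conjI)
    fix x assume x: "x \<in> X"
    have "((\<lambda>x. k0 * exp (P x)) has_field_derivative l x * k x) (at x)"
      using P(2,3)[OF x] by (auto intro!: derivative_eq_intros)
    thus "(k has_field_derivative l x * k x) (at x)"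
      by (rule has_field_derivative_transform_within_open) (use assms x P in auto)
    show "k x \<noteq> 0" using P x by simp
  qed
next
  assume k: "\<forall>x\<in>X. (k has_field_derivative l x * k x) (at x) \<and> k x \<noteq> 0"
  hence "k holomorphic_on X" using assms(1) by (auto simp: holomorphic_on_open)
  with k obtain g where g: "g holomorphic_on X" "\<And>z. z \<in> X \<Longrightarrow> k z = exp (g z)"
    using simply_connected_eq_holomorphic_log[OF assms(1)] assms(2) by metis
  have "(g has_field_derivative l x) (at x)" if x: "x \<in> X" for x
  proof -
    have d: "(g has_field_derivative deriv g x) (at x)"
      using g(1) assms(1) x by (rule holomorphic_derivI)
    hence "((\<lambda>z. exp (g z)) has_field_derivative deriv g x * k x) (at x)"
      using g(2)[OF x] by (auto intro!: derivative_eq_intros)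
    hence "(k has_field_derivative deriv g x * k x) (at x)"
      by (rule has_field_derivative_transform_within_open) (use assms x g in auto)
    hence "deriv g x * k x = l x * k x" using k x DERIV_unique by blast
    thus ?thesis using d k x by simp
  qed
  thus "k \<in> exp_integrals X l" unfolding exp_integrals_def using g(2)
    by (intro CollectI exI[of _ 1] exI[of _ g]) auto
qed

lemma exp_integrals_nonempty:
  assumes "open X" "simply_connected X" "l holomorphic_on X"
  obtains k where "k \<in> exp_integrals X l"
proof -
  obtain P where "\<And>z. z \<in> X \<Longrightarrow> (P has_field_derivative l z) (at z)"
    using simply_connected_eq_global_primitive[OF assms(1)] assms(2,3) by metis
  hence "(\<lambda>x. 1 * exp (P x)) \<in> exp_integrals X l" unfolding exp_integrals_def
    by (intro CollectI exI[of _ 1] exI[of _ P]) auto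
  thus ?thesis using that by blast
qed

lemma exp_integrals_cmult: "k \<in> exp_integrals X l \<Longrightarrow> c \<noteq> 0 \<Longrightarrow> (\<lambda>x. c * k x) \<in> exp_integrals X l"
  unfolding exp_integrals_def by clarsimp (metis mult.assoc mult_eq_0_iff)

lemma exp_integrals_unique:
  assumes "open X" "simply_connected X" "X \<noteq> {}" "k \<in> exp_integrals X l" "K \<in> exp_integrals X l"
  obtains c where "c \<noteq> 0" "\<And>x. x \<in> X \<Longrightarrow> K x = c * k x"
proof -
  note k = assms(4)[unfolded exp_integrals_iff[OF assms(1,2)]]
  note K = assms(5)[unfolded exp_integrals_iff[OF assms(1,2)]]
  have "((\<lambda>x. K x / k x) has_field_derivative 0) (at x)" if "x \<in> X" for x
    using DERIV_divide[of K _ x UNIV k] k K that by fastforce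
  moreover have "connected X" using assms(2) by (rule simply_connected_imp_connected)
  ultimately have "(\<lambda>x. K x / k x) constant_on X"
    using assms(1) by (intro has_field_derivative_0_imp_constant_on)
  then obtain c where c: "\<And>x. x \<in> X \<Longrightarrow> K x / k x = c"
    unfolding constant_on_def by blast
  hence "K x = c * k x" if "x \<in> X" for x using k that by (metis nonzero_divide_eq_eq)
  moreover from this have "c \<noteq> 0" using K assms(3) by fastforce
  ultimately show ?thesis using that by blast
qed

section \<open>From solutions of PVI to classes of solutions in \<open>x\<close>\<close>

locale reduced_system = PVI_parameters +
  fixes X :: "complex set"
  assumes open_X: "open X" and sc_X: "simply_connected X" and X_ne: "X \<noteq> {}"
    and X_01: "0 \<notin> X" "1 \<notin> X"
begin

lemma X_nz: "x \<in> X \<Longrightarrow> x \<noteq> 0" "x \<in> X \<Longrightarrow> x \<noteq> 1"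
  using X_01 by auto

lemma ev_X: "x \<in> X \<Longrightarrow> \<forall>\<^sub>F t in nhds x. t \<in> X"
  using open_X by (rule eventually_nhds_in_open)

lemma restrict_deriv_iff:
  assumes "x \<in> X"
  shows "((\<lambda>t. restrict G X t $ i $ j) has_field_derivative d) (at x) \<longleftrightarrow>
    ((\<lambda>t. G t $ i $ j) has_field_derivative d) (at x)"
  by (rule DERIV_cong_ev) (use ev_X[OF assms] in \<open>auto elim!: eventually_mono\<close>)

lemma Omega_familyE:
  assumes "y \<in> PVI_domain X" "W \<in> Omega_family \<theta> \<theta>inf X y"
  obtains k1 k2 where "W = restrict (\<lambda>x. Omega_formula \<theta> \<theta>inf x (y x) (deriv y x) (k1 x) (k2 x)) X"
    "k1 \<in> exp_integrals X (\<lambda>x. l1_formula \<theta> x (y x) (deriv y x))"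
    "k2 \<in> exp_integrals X (\<lambda>x. l2_formula \<theta> x (y x) (deriv y x))"
  using assms by (auto simp: Omega_family_def)

lemma exp_integralsD:
  assumes "k \<in> exp_integrals X l" "x \<in> X"
  shows "(k has_field_derivative l x * k x) (at x)" "k x \<noteq> 0"
  using assms exp_integrals_iff[OF open_X sc_X] by blast+

lemma PVI_domainD:
  assumes "y \<in> PVI_domain X" "x \<in> X"
  shows "y x \<noteq> 0" "y x \<noteq> 1" "y x \<noteq> x"
  using assms by (auto simp: PVI_domain_def)

lemma Omega_family_solution_iff:
  assumes y: "y \<in> PVI_domain X" and W: "W \<in> Omega_family \<theta> \<theta>inf X y"
  shows "W \<in> Omega_solutions \<theta> \<theta>inf X \<longleftrightarrow> y \<in> PVI_solutions \<theta> \<theta>inf X"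
proof -
  obtain k1 k2 where Wk: "W = restrict (\<lambda>x. Omega_formula \<theta> \<theta>inf x (y x) (deriv y x) (k1 x) (k2 x)) X"
    and k: "k1 \<in> exp_integrals X (\<lambda>x. l1_formula \<theta> x (y x) (deriv y x))"
    "k2 \<in> exp_integrals X (\<lambda>x. l2_formula \<theta> x (y x) (deriv y x))"
    using Omega_familyE[OF y W] .
  note nz = X_nz PVI_domainD[OF y] exp_integralsD(2)[OF k(1)] exp_integralsD(2)[OF k(2)]
  have hol: "y holomorphic_on X" using y by (simp add: PVI_domain_def)
  have "(\<forall>i j. ((\<lambda>t. W t $ i $ j) has_field_derivative commutator (W x) (Omega_hat x (W x)) $ i $ j) (at x))
     \<longleftrightarrow> deriv (deriv y) x = PVI_rhs ((\<theta>inf - 1)^2 / 2) (- ((\<theta>$1)^2) / 2) ((\<theta>$3)^2 / 2) ((1 - (\<theta>$2)^2) / 2)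
          x (y x) (deriv y x)" if x: "x \<in> X" for x
  proof -
    have "\<forall>\<^sub>F t in nhds x. t \<noteq> 0 \<and> t \<noteq> 1 \<and> y t \<noteq> 0 \<and> y t \<noteq> 1 \<and> y t \<noteq> t \<and> k1 t \<noteq> 0 \<and> k2 t \<noteq> 0"
      using ev_X[OF x] by eventually_elim (use nz in blast)
    from Omega_formula_flow_iff_PVI[where p = "deriv y", OF this holomorphic_derivI[OF hol open_X x]
      holomorphic_derivI[OF holomorphic_deriv[OF hol open_X] open_X x] exp_integralsD(1)[OF k(1) x] exp_integralsD(1)[OF k(2) x]]
    show ?thesis unfolding Wk restrict_deriv_iff[OF x] using x by simp
  qed
  moreover have "constraints \<theta> \<theta>inf (W x)" if "x \<in> X" for x
    using that nz[OF that] by (simp add: Wk Omega_formula_constraints)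
  moreover have "W \<in> extensional X" by (simp add: Wk)
  ultimately show ?thesis using y unfolding Omega_solutions_def PVI_solutions_def by blast
qed

lemma Omega_family_defined:
  assumes y: "y \<in> PVI_domain X" and W: "W \<in> Omega_family \<theta> \<theta>inf X y" and x: "x \<in> X"
  shows "formulae_defined \<theta> \<theta>inf (vector [0, x, 1]) (W x)"
proof -
  obtain k1 k2 where Wk: "W = restrict (\<lambda>x. Omega_formula \<theta> \<theta>inf x (y x) (deriv y x) (k1 x) (k2 x)) X"
    and k: "k1 \<in> exp_integrals X (\<lambda>x. l1_formula \<theta> x (y x) (deriv y x))"
    "k2 \<in> exp_integrals X (\<lambda>x. l2_formula \<theta> x (y x) (deriv y x))"
    using Omega_familyE[OF y W] .
  show ?thesis using x X_nz[OF x] PVI_domainD[OF y x] exp_integralsD(2)[OF k(1) x] exp_integralsD(2)[OF k(2) x]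
    by (simp add: Wk Omega_formula_defined)
qed

lemma Omega_family_nonempty:
  assumes y: "y \<in> PVI_domain X"
  shows "Omega_family \<theta> \<theta>inf X y \<noteq> {}"
proof -
  have hol: "y holomorphic_on X" using y by (simp add: PVI_domain_def)
  note hol' = holomorphic_deriv[OF hol open_X]
  note nz = X_nz PVI_domainD[OF y]
  have "(\<lambda>x. l1_formula \<theta> x (y x) (deriv y x)) holomorphic_on X"
    unfolding l1_formula_def Let_def by (intro holomorphic_intros hol hol') (use nz in auto)
  then obtain k1 where k1: "k1 \<in> exp_integrals X (\<lambda>x. l1_formula \<theta> x (y x) (deriv y x))"
    using exp_integrals_nonempty[OF open_X sc_X] by blast
  have "2 * x * (1 - x) * (1 - y x) * (x - y x) \<noteq> 0" if "x \<in> X" for x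
    using nz[OF that] by simp
  hence "(\<lambda>x. l2_formula \<theta> x (y x) (deriv y x)) holomorphic_on X"
    unfolding l2_formula_def Let_def by (intro holomorphic_intros hol hol')
  then obtain k2 where k2: "k2 \<in> exp_integrals X (\<lambda>x. l2_formula \<theta> x (y x) (deriv y x))"
    using exp_integrals_nonempty[OF open_X sc_X] by blast
  from k1 k2 show ?thesis unfolding Omega_family_def by blast
qed

lemma Omega_formula_conj:
  assumes "k1 \<noteq> 0" "k2 \<noteq> 0" "c1 \<noteq> 0" "c2 \<noteq> 0"
  shows "Omega_formula \<theta> \<theta>inf x y p (c1 * k1) (c2 * k2) =
    (\<chi> i j. vector [c1, c2, 1] $ i * Omega_formula \<theta> \<theta>inf x y p k1 k2 $ i $ j / vector [c1, c2, 1] $ j)"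
proof -
  have "(vector [c1 * k1, c2 * k2, 1] :: complex^3) $ i = vector [c1, c2, 1] $ i * vector [k1, k2, 1] $ i" for i
    using exhaust_3[of i] by auto
  moreover have "(vector [c1, c2, 1] :: complex^3) $ i \<noteq> 0" for i
    using exhaust_3[of i] assms by auto
  ultimately show ?thesis using assms by (simp add: vec_eq_iff Omega_formula_eq_gauged mult_ac)
qed

text \<open>Two choices of \<open>k1\<close>, or of \<open>k2\<close>, differ by a nonzero constant
  factor, and such factors act as conjugation by \<open>diag(c1, c2, 1)\<close>.\<close>

lemma Omega_family_eq_conj_class:
  assumes y: "y \<in> PVI_domain X" and W: "W \<in> Omega_family \<theta> \<theta>inf X y"
  shows "Omega_family \<theta> \<theta>inf X y = conj_class X W"
proof -
  obtain k1 k2 where Wk: "W = restrict (\<lambda>x. Omega_formula \<theta> \<theta>inf x (y x) (deriv y x) (k1 x) (k2 x)) X"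
    and k: "k1 \<in> exp_integrals X (\<lambda>x. l1_formula \<theta> x (y x) (deriv y x))"
    "k2 \<in> exp_integrals X (\<lambda>x. l2_formula \<theta> x (y x) (deriv y x))"
    using Omega_familyE[OF y W] .
  note knz = exp_integralsD(2)[OF k(1)] exp_integralsD(2)[OF k(2)]
  have conj: "restrict (\<lambda>s. \<chi> i j. vector [c1, c2, 1] $ i * W s $ i $ j / vector [c1, c2, 1] $ j) X
     = restrict (\<lambda>x. Omega_formula \<theta> \<theta>inf x (y x) (deriv y x) (c1 * k1 x) (c2 * k2 x)) X"
    if "c1 \<noteq> 0" "c2 \<noteq> 0" for c1 c2
    by (rule restrict_ext) (simp add: Wk Omega_formula_conj[OF knz that])
  show ?thesis
  proof (intro equalityI subsetI)
    fix V assume "V \<in> Omega_family \<theta> \<theta>inf X y"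
    then obtain K1 K2 where V: "V = restrict (\<lambda>x. Omega_formula \<theta> \<theta>inf x (y x) (deriv y x) (K1 x) (K2 x)) X"
      and K: "K1 \<in> exp_integrals X (\<lambda>x. l1_formula \<theta> x (y x) (deriv y x))"
      "K2 \<in> exp_integrals X (\<lambda>x. l2_formula \<theta> x (y x) (deriv y x))"
      using Omega_familyE[OF y] by blast
    obtain c1 where c1: "c1 \<noteq> 0" "\<And>x. x \<in> X \<Longrightarrow> K1 x = c1 * k1 x"
      using exp_integrals_unique[OF open_X sc_X X_ne k(1) K(1)] by blast
    obtain c2 where c2: "c2 \<noteq> 0" "\<And>x. x \<in> X \<Longrightarrow> K2 x = c2 * k2 x"
      using exp_integrals_unique[OF open_X sc_X X_ne k(2) K(2)] by blast
    have V': "V = restrict (\<lambda>x. Omega_formula \<theta> \<theta>inf x (y x) (deriv y x) (c1 * k1 x) (c2 * k2 x)) X"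
      unfolding V by (rule restrict_ext) (simp add: c1 c2)
    show "V \<in> conj_class X W" unfolding conj_class_eq
      by (intro CollectI exI[of _ c1] exI[of _ c2] conjI c1(1) c2(1) trans[OF V' conj[OF c1(1) c2(1), symmetric]])
  next
    fix V assume "V \<in> conj_class X W"
    then obtain c1 c2 where c: "c1 \<noteq> 0" "c2 \<noteq> 0"
      and V: "V = restrict (\<lambda>s. \<chi> i j. vector [c1, c2, 1] $ i * W s $ i $ j / vector [c1, c2, 1] $ j) X"
      unfolding conj_class_eq by auto
    show "V \<in> Omega_family \<theta> \<theta>inf X y"
      unfolding V conj[OF c] Omega_family_def
      by (intro CollectI exI[of _ "\<lambda>x. c1 * k1 x"] exI[of _ "\<lambda>x. c2 * k2 x"] conjI refl exp_integrals_cmult k c)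
  qed
qed

lemma Omega_family_inj:
  assumes y: "y \<in> PVI_domain X" and Y: "Y \<in> PVI_domain X"
    and W: "W \<in> Omega_family \<theta> \<theta>inf X y" "W \<in> Omega_family \<theta> \<theta>inf X Y"
  shows "y = Y"
proof (rule extensionalityI[of _ X])
  obtain k1 k2 where Wk: "W = restrict (\<lambda>x. Omega_formula \<theta> \<theta>inf x (y x) (deriv y x) (k1 x) (k2 x)) X"
    and k: "k1 \<in> exp_integrals X (\<lambda>x. l1_formula \<theta> x (y x) (deriv y x))"
    "k2 \<in> exp_integrals X (\<lambda>x. l2_formula \<theta> x (y x) (deriv y x))"
    using Omega_familyE[OF y W(1)] .
  obtain K1 K2 where WK: "W = restrict (\<lambda>x. Omega_formula \<theta> \<theta>inf x (Y x) (deriv Y x) (K1 x) (K2 x)) X"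
    and K: "K1 \<in> exp_integrals X (\<lambda>x. l1_formula \<theta> x (Y x) (deriv Y x))"
    "K2 \<in> exp_integrals X (\<lambda>x. l2_formula \<theta> x (Y x) (deriv Y x))"
    using Omega_familyE[OF Y W(2)] .
  fix x assume x: "x \<in> X"
  have "Omega_formula \<theta> \<theta>inf x (y x) (deriv y x) (k1 x) (k2 x) = Omega_formula \<theta> \<theta>inf x (Y x) (deriv Y x) (K1 x) (K2 x)"
    using fun_cong[OF trans[OF Wk[symmetric] WK], of x] x by simp
  thus "y x = Y x"
    by (rule Omega_formula_inj(1)[OF X_nz[OF x] PVI_domainD[OF y x] exp_integralsD(2)[OF k(1) x] exp_integralsD(2)[OF k(2) x]
      PVI_domainD[OF Y x] exp_integralsD(2)[OF K(1) x] exp_integralsD(2)[OF K(2) x]])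
qed (use y Y in \<open>simp_all add: PVI_domain_def\<close>)

end

section \<open>From solutions in \<open>x\<close> back to solutions of PVI\<close>

lemma adjugate3_holomorphic:
  assumes "\<And>i j. (\<lambda>t. A t $ i $ j) holomorphic_on S"
  shows "(\<lambda>t. adjugate3 (A t) $ i $ j) holomorphic_on S"
proof -
  have "\<forall>i j. (\<lambda>t. adjugate3 (A t) $ i $ j) holomorphic_on S"
    unfolding forall_3 adjugate3_def vector_3 by (intro conjI holomorphic_intros assms)
  thus ?thesis by blast
qed

lemma minus_mat_holomorphic:
  assumes "\<And>i j. (\<lambda>t. A t $ i $ j) holomorphic_on S"
  shows "(\<lambda>t. (A t - mat c) $ i $ j) holomorphic_on S"
  unfolding vector_minus_component by (intro holomorphic_intros assms)

lemma formulae_defined_normalized: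
  "formulae_defined \<theta> \<theta>inf (vector [0, x, 1]) A \<longleftrightarrow>
   (\<exists>l r. l v* A = mu_plus \<theta> \<theta>inf *s l \<and> A *v r = mu_minus \<theta> \<theta>inf *s r \<and>
        (\<forall>i. l $ i * r $ i \<noteq> 0) \<and> x * (l$2 * r$2) + l$3 * r$3 \<noteq> 0)"
  unfolding formulae_defined_def by (simp add: sum_3)

context reduced_system
begin

lemma Omega_solutionsD:
  assumes "W \<in> Omega_solutions \<theta> \<theta>inf X" 
  shows "W \<in> extensional X"
    "x \<in> X \<Longrightarrow> ((\<lambda>t. W t $ i $ j) has_field_derivative commutator (W x) (Omega_hat x (W x)) $ i $ j) (at x)"
    "x \<in> X \<Longrightarrow> constraints \<theta> \<theta>inf (W x)"
    "(\<lambda>t. W t $ i $ j) holomorphic_on X"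
  using assms open_X by (auto simp: Omega_solutions_def holomorphic_on_open)

lemma column_adj_minus_holomorphic:
  assumes "W \<in> Omega_solutions \<theta> \<theta>inf X" 
  shows "(\<lambda>t. column k (adj_minus (W t)) $ i) holomorphic_on X"
  unfolding column_def vec_lambda_beta
  by (intro adjugate3_holomorphic minus_mat_holomorphic Omega_solutionsD(4)[OF assms])

lemma row_adj_plus_holomorphic:
  assumes "W \<in> Omega_solutions \<theta> \<theta>inf X" 
  shows "(\<lambda>t. row k (adj_plus (W t)) $ i) holomorphic_on X"
  unfolding row_def vec_lambda_beta
  by (intro adjugate3_holomorphic minus_mat_holomorphic Omega_solutionsD(4)[OF assms])

text \<open>The choices \<open>l t\<close>, \<open>r t\<close> are arbitrary at every point and may
  be discontinuous. The ratios are invariant under scaling, so near \<open>x\<close> they agree with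
  the same ratios of a row and a column of adjugates that do not vanish there, and these are
  holomorphic.\<close>

lemma eigenvector_ratios_differentiable:
  assumes W: "W \<in> Omega_solutions \<theta> \<theta>inf X" and x: "x \<in> X"
    and l: "\<And>t. t \<in> X \<Longrightarrow> l t v* W t = \<mu>p *s l t" and r: "\<And>t. t \<in> X \<Longrightarrow> W t *v r t = \<mu>m *s r t"
    and nz: "\<And>t i. t \<in> X \<Longrightarrow> l t $ i * r t $ i \<noteq> 0"
    and T: "\<And>t. t \<in> X \<Longrightarrow> t * (l t $ 2 * r t $ 2) + l t $ 3 * r t $ 3 \<noteq> 0"
  shows "(\<lambda>t. r t $ i / r t $ 3) field_differentiable (at x)"
    "(\<lambda>t. - t * (l t $ 1 * r t $ 1) / (t * (l t $ 2 * r t $ 2) + l t $ 3 * r t $ 3)) field_differentiable (at x)"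
proof -
  note cons = Omega_solutionsD(3)[OF W]
  obtain a where a: "adj_minus (W x) $ a $ a \<noteq> 0" using adj_minus_diag_nz[OF cons[OF x]] .
  obtain b where b: "adj_plus (W x) $ b $ b \<noteq> 0" using adj_plus_diag_nz[OF cons[OF x]] .
  define R where "R = (\<lambda>t. column a (adj_minus (W t)))"
  define Q where "Q = (\<lambda>t. row b (adj_plus (W t)))"
  have R: "(\<lambda>t. R t $ i) field_differentiable (at x)" for i
    using column_adj_minus_holomorphic[OF W] open_X x
    unfolding R_def by (meson holomorphic_on_imp_differentiable_at)
  have Q: "(\<lambda>t. Q t $ i) field_differentiable (at x)" for i
    using row_adj_plus_holomorphic[OF W] open_X x
    unfolding Q_def by (meson holomorphic_on_imp_differentiable_at)
  have "isCont (\<lambda>t. R t $ a) x" "isCont (\<lambda>t. Q t $ b) x"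
    using R Q field_differentiable_imp_continuous_at by blast+
  moreover have "R x $ a \<noteq> 0" "Q x $ b \<noteq> 0" using a b by (simp_all add: R_def Q_def column_def row_def)
  moreover have "\<forall>\<^sub>F t in nhds x. f t \<noteq> 0" if "isCont f x" "f x \<noteq> 0" for f :: "complex \<Rightarrow> complex"
    using tendsto_imp_eventually_ne that unfolding isCont_def tendsto_at_iff_tendsto_nhds by blast
  ultimately have ev: "\<forall>\<^sub>F t in nhds x. t \<in> X \<and> R t $ a \<noteq> 0 \<and> Q t $ b \<noteq> 0"
    using ev_X[OF x] by (intro eventually_conj)
  have scale: "\<exists>s c. s \<noteq> 0 \<and> c \<noteq> 0 \<and> r t = s *s R t \<and> l t = c *s Q t" if t: "t \<in> X" "R t $ a \<noteq> 0" "Q t $ b \<noteq> 0" for t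
  proof -
    have r0: "r t \<noteq> 0" "l t \<noteq> 0" using nz[OF t(1), of 1] by auto
    obtain s where s: "r t = s *s R t"
      using right_eigenvector_unique[OF cons[OF t(1)] column_adj_minus[OF cons[OF t(1)]] r[OF t(1)], of a]
        vec_nzI[OF t(2)] unfolding R_def by blast
    obtain c where c: "l t = c *s Q t"
      using left_eigenvector_unique[OF cons[OF t(1)] row_adj_plus[OF cons[OF t(1)]] l[OF t(1)], of b]
        vec_nzI[OF t(3)] unfolding Q_def by blast
    have "s \<noteq> 0" "c \<noteq> 0" using s c r0 by auto
    with s c show ?thesis by blast
  qed
  have ev1: "\<forall>\<^sub>F t in nhds x. r t $ i / r t $ 3 = R t $ i / R t $ 3"
    using ev by eventually_elim (use scale in fastforce)
  have ev2: "\<forall>\<^sub>F t in nhds x. - t * (l t $ 1 * r t $ 1) / (t * (l t $ 2 * r t $ 2) + l t $ 3 * r t $ 3)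
     = - t * (Q t $ 1 * R t $ 1) / (t * (Q t $ 2 * R t $ 2) + Q t $ 3 * R t $ 3)"
  proof (use ev in eventually_elim)
    case (elim t)
    then obtain s c where sc: "s \<noteq> 0" "c \<noteq> 0" "r t = s *s R t" "l t = c *s Q t" using scale by blast
    have n: "- t * (l t $ 1 * r t $ 1) = (c * s) * (- t * (Q t $ 1 * R t $ 1))"
      "t * (l t $ 2 * r t $ 2) + l t $ 3 * r t $ 3 = (c * s) * (t * (Q t $ 2 * R t $ 2) + Q t $ 3 * R t $ 3)"
      by (simp_all add: sc algebra_simps)
    show ?case unfolding n using sc(1,2) by simp
  qed
  obtain s c where sc: "s \<noteq> 0" "c \<noteq> 0" "r x = s *s R x" "l x = c *s Q x"
    using eventually_nhds_x_imp_x[OF ev] scale by blast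
  have "R x $ 3 \<noteq> 0" using nz[OF x, of 3] by (auto simp: sc)
  thus "(\<lambda>t. r t $ i / r t $ 3) field_differentiable (at x)"
    unfolding field_differentiable_def DERIV_cong_ev[OF refl ev1 refl]
    using field_differentiable_divide[OF R[of i] R[of 3]] unfolding field_differentiable_def by blast
  have "t * (l t $ 2 * r t $ 2) + l t $ 3 * r t $ 3 = (c * s) * (t * (Q t $ 2 * R t $ 2) + Q t $ 3 * R t $ 3)"
    if "t = x" for t by (simp add: that sc algebra_simps)
  from this[of x] T[OF x] have "x * (Q x $ 2 * R x $ 2) + Q x $ 3 * R x $ 3 \<noteq> 0" by auto
  hence "(\<lambda>t. - t * (Q t $ 1 * R t $ 1) / (t * (Q t $ 2 * R t $ 2) + Q t $ 3 * R t $ 3)) field_differentiable (at x)"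
    by (intro derivative_intros Q R field_differentiable_ident)
  thus "(\<lambda>t. - t * (l t $ 1 * r t $ 1) / (t * (l t $ 2 * r t $ 2) + l t $ 3 * r t $ 3)) field_differentiable (at x)"
    unfolding field_differentiable_def DERIV_cong_ev[OF refl ev2 refl] .
qed

lemma Omega_family_surj:
  assumes W: "W \<in> Omega_solutions_def_on \<theta> \<theta>inf X"
  obtains y where "y \<in> PVI_solutions \<theta> \<theta>inf X" "W \<in> Omega_family \<theta> \<theta>inf X y"
proof -
  have Ws: "W \<in> Omega_solutions \<theta> \<theta>inf X" using W by (simp add: Omega_solutions_def_on_def)
  have "\<forall>x\<in>X. \<exists>l r. l v* W x = \<mu>p *s l \<and> W x *v r = \<mu>m *s r \<and>
        (\<forall>i. l $ i * r $ i \<noteq> 0) \<and> x * (l$2 * r$2) + l$3 * r$3 \<noteq> 0"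
    using W by (simp add: Omega_solutions_def_on_def formulae_defined_normalized)
  then obtain l r where lr: "\<And>t. t \<in> X \<Longrightarrow> l t v* W t = \<mu>p *s l t" "\<And>t. t \<in> X \<Longrightarrow> W t *v r t = \<mu>m *s r t"
    "\<And>t i. t \<in> X \<Longrightarrow> l t $ i * r t $ i \<noteq> 0"
    "\<And>t. t \<in> X \<Longrightarrow> t * (l t $ 2 * r t $ 2) + l t $ 3 * r t $ 3 \<noteq> 0"
    unfolding bchoice_iff by blast
  define Y where "Y = (\<lambda>t. - t * (l t $ 1 * r t $ 1) / (t * (l t $ 2 * r t $ 2) + l t $ 3 * r t $ 3))"
  define k1 where "k1 = (\<lambda>t. r t $ 1 / r t $ 3)"
  define k2 where "k2 = (\<lambda>t. r t $ 2 / r t $ 3)"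
  have k: "k1 t \<noteq> 0" "k2 t \<noteq> 0" if "t \<in> X" for t
    using lr(3)[OF that, of 1] lr(3)[OF that, of 2] lr(3)[OF that, of 3] by (auto simp: k1_def k2_def)
  have "\<exists>p. Y t \<noteq> 0 \<and> Y t \<noteq> 1 \<and> Y t \<noteq> t \<and> W t = Omega_formula \<theta> \<theta>inf t (Y t) p (k1 t) (k2 t)"
    if t: "t \<in> X" for t
  proof -
    have "W t $ i $ i = - \<theta> $ i" for i
      using Omega_solutionsD(3)[OF Ws t] by (simp add: constraints_def)
    thus ?thesis
      using Omega_formula_exists[OF X_nz[OF t] _ lr(2)[OF t] lr(1)[OF t] lr(3)[OF t] lr(4)[OF t]]
      unfolding Y_def k1_def k2_def by metis
  qed
  \<comment> \<open>\<open>p\<close> is obtained point by point; that it is the derivative of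
    \<open>Y\<close> is a consequence of the flow below.\<close>
  then obtain p where p: "\<And>t. t \<in> X \<Longrightarrow> Y t \<noteq> 0 \<and> Y t \<noteq> 1 \<and> Y t \<noteq> t"
    "\<And>t. t \<in> X \<Longrightarrow> W t = Omega_formula \<theta> \<theta>inf t (Y t) (p t) (k1 t) (k2 t)" by metis
  note dif = eigenvector_ratios_differentiable[OF Ws _ lr]
  have dY: "(Y has_field_derivative deriv Y x) (at x)" and dk: "(k1 has_field_derivative deriv k1 x) (at x)"
    "(k2 has_field_derivative deriv k2 x) (at x)" if x: "x \<in> X" for x
    using dif(1)[OF x, of 1] dif(1)[OF x, of 2] dif(2)[OF x] unfolding Y_def k1_def k2_def
    by (simp_all add: field_differentiable_derivI)
  have flow: "deriv Y x = p x" "deriv k1 x = l1_formula \<theta> x (Y x) (p x) * k1 x"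
    "deriv k2 x = l2_formula \<theta> x (Y x) (p x) * k2 x" if x: "x \<in> X" for x
  proof -
    have ev: "\<forall>\<^sub>F t in nhds x. t \<noteq> 0 \<and> t \<noteq> 1 \<and> Y t \<noteq> 0 \<and> Y t \<noteq> 1 \<and> Y t \<noteq> t \<and> k1 t \<noteq> 0 \<and> k2 t \<noteq> 0"
      using ev_X[OF x] by eventually_elim (use X_nz p k in blast)
    have evW: "\<forall>\<^sub>F t in nhds x. Omega_formula \<theta> \<theta>inf t (Y t) (p t) (k1 t) (k2 t) $ i $ j = W t $ i $ j" for i j
      using ev_X[OF x] by eventually_elim (use p in simp)
    have ode: "((\<lambda>t. Omega_formula \<theta> \<theta>inf t (Y t) (p t) (k1 t) (k2 t) $ i $ j) has_field_derivative 
      commutator (Omega_formula \<theta> \<theta>inf x (Y x) (p x) (k1 x) (k2 x))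
       (Omega_hat x (Omega_formula \<theta> \<theta>inf x (Y x) (p x) (k1 x) (k2 x))) $ i $ j) (at x)" for i j
      unfolding DERIV_cong_ev[OF refl evW refl] p(2)[OF x, symmetric]
      by (rule Omega_solutionsD(2)[OF Ws x])
    note * = Omega_formula_flow[OF ev dY[OF x] dk[OF x] ode]
    show "deriv Y x = p x" "deriv k1 x = l1_formula \<theta> x (Y x) (p x) * k1 x"
    "deriv k2 x = l2_formula \<theta> x (Y x) (p x) * k2 x" by (fact *)+
  qed
  define y where "y = restrict Y X"
  have yv: "y x = Y x" if "x \<in> X" for x using that by (simp add: y_def)
  have yY: "deriv y x = deriv Y x" if "x \<in> X" for x
    by (rule deriv_cong_ev[OF _ refl]) (use ev_X[OF that] in \<open>auto simp: y_def elim!: eventually_mono\<close>)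
  have "y holomorphic_on X"
    by (rule holomorphic_transform[of Y]) (use dY open_X in \<open>auto simp: y_def holomorphic_on_open\<close>)
  hence yd: "y \<in> PVI_domain X" using p(1) by (auto simp: PVI_domain_def y_def)
  have "W = restrict (\<lambda>x. Omega_formula \<theta> \<theta>inf x (y x) (deriv y x) (k1 x) (k2 x)) X"
    by (rule extensionalityI[OF Omega_solutionsD(1)[OF Ws]]) (simp_all add: yY flow p(2), simp add: y_def)
  moreover have "k1 \<in> exp_integrals X (\<lambda>x. l1_formula \<theta> x (y x) (deriv y x))"
    "k2 \<in> exp_integrals X (\<lambda>x. l2_formula \<theta> x (y x) (deriv y x))"
    unfolding exp_integrals_iff[OF open_X sc_X] using dk k by (auto simp: yY flow yv)
  ultimately have "W \<in> Omega_family \<theta> \<theta>inf X y" unfolding Omega_family_def by blast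
  moreover from this have "y \<in> PVI_solutions \<theta> \<theta>inf X"
    using Omega_family_solution_iff[OF yd] Ws by blast
  ultimately show ?thesis using that by blast
qed

lemma PVI_solutions_domain: "y \<in> PVI_solutions \<theta> \<theta>inf X \<Longrightarrow> y \<in> PVI_domain X"
  by (simp add: PVI_solutions_def)

lemma Omega_family_subset:
  assumes "y \<in> PVI_solutions \<theta> \<theta>inf X"
  shows "Omega_family \<theta> \<theta>inf X y \<subseteq> Omega_solutions_def_on \<theta> \<theta>inf X"
  using Omega_family_solution_iff Omega_family_defined PVI_solutions_domain assms
  unfolding Omega_solutions_def_on_def by blast

theorem Omega_family_bij:
  "bij_betw (Omega_family \<theta> \<theta>inf X) (PVI_solutions \<theta> \<theta>inf X) (conj_class X ` Omega_solutions_def_on \<theta> \<theta>inf X)"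
proof (rule bij_betw_imageI)
  show "inj_on (Omega_family \<theta> \<theta>inf X) (PVI_solutions \<theta> \<theta>inf X)"
    by (rule inj_onI) (metis Omega_family_inj Omega_family_nonempty PVI_solutions_domain ex_in_conv)
  show "Omega_family \<theta> \<theta>inf X ` PVI_solutions \<theta> \<theta>inf X = conj_class X ` Omega_solutions_def_on \<theta> \<theta>inf X"
  proof (intro equalityI image_subsetI)
    fix y assume y: "y \<in> PVI_solutions \<theta> \<theta>inf X"
    then obtain W where "W \<in> Omega_family \<theta> \<theta>inf X y"
      using Omega_family_nonempty PVI_solutions_domain by blast
    thus "Omega_family \<theta> \<theta>inf X y \<in> conj_class X ` Omega_solutions_def_on \<theta> \<theta>inf X"
      using Omega_family_eq_conj_class PVI_solutions_domain[OF y] Omega_family_subset[OF y] by blast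
  next
    fix W assume "W \<in> Omega_solutions_def_on \<theta> \<theta>inf X"
    then obtain y where "y \<in> PVI_solutions \<theta> \<theta>inf X" "W \<in> Omega_family \<theta> \<theta>inf X y"
      using Omega_family_surj by blast
    thus "conj_class X W \<in> Omega_family \<theta> \<theta>inf X ` PVI_solutions \<theta> \<theta>inf X"
      using Omega_family_eq_conj_class PVI_solutions_domain by blast
  qed
qed

end

section \<open>Points at which the formulae are not defined\<close>

lemma holomorphic_mult_eq_0:
  assumes "f holomorphic_on U" "g holomorphic_on U" "open U" "connected U"
    and "\<And>x. x \<in> U \<Longrightarrow> f x * g x = 0"
  shows "(\<forall>x\<in>U. f x = 0) \<or> (\<forall>x\<in>U. g x = 0)"
proof (cases "\<forall>x\<in>U. f x = 0")
  case False
  then obtain x0 where x0: "x0 \<in> U" "f x0 \<noteq> 0" by blast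
  let ?V = "U \<inter> f -` (- {0})"
  have "open ?V"
    using assms(1,3) by (intro continuous_open_preimage holomorphic_on_imp_continuous_on) auto
  moreover have "g x = 0" if "x \<in> ?V" for x using assms(5)[of x] that by simp
  ultimately have "\<forall>x\<in>U. g x = 0"
    using analytic_continuation_open[of ?V U g "\<lambda>_. 0"] assms x0 by (auto intro: holomorphic_intros)
  thus ?thesis ..
qed simp

lemma zeros_sparse_in:
  assumes "f holomorphic_on S" "open S" "connected S" "z \<in> S" "f z \<noteq> 0"
  shows "{x\<in>S. f x = 0} sparse_in S"
  unfolding sparse_in_open[OF assms(2)]
proof (intro ballI notI)
  fix y assume "y \<in> S" "y islimpt {x \<in> S. f x = 0}"
  hence "f z = 0" using analytic_continuation[OF assms(1-3), of "{x\<in>S. f x = 0}" y z] assms(4) by blast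
  thus False using assms(5) by simp
qed

lemma sparse_in_mono: "B sparse_in S \<Longrightarrow> A \<subseteq> B \<Longrightarrow> A sparse_in S"
  unfolding sparse_in_def by (meson islimpt_subset)

lemma eigenvalues_transpose: "eigenvalues (transpose A) = eigenvalues A"
proof -
  have "transpose A - mat c = transpose (A - mat c)" for c
    by (simp add: transpose_def mat_def vec_eq_iff)
  thus ?thesis unfolding set_eq_iff mem_eigenvalues_iff by (metis det_transpose)
qed

lemma eigenvalue_of_column:
  assumes "\<And>i. i \<noteq> j \<Longrightarrow> A $ i $ j = 0"
  shows "A $ j $ j \<in> eigenvalues A"
proof -
  have "A *v axis j 1 = A $ j $ j *s axis j 1"
    using assms by (auto simp: vec_eq_iff matrix_vector_mul_component inner_axis_axis axis_def matrix_vector_mult_def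
        if_distrib if_distribR cong: if_cong)
  moreover have "axis j (1::complex) \<noteq> 0" by (simp add: axis_eq_0_iff)
  ultimately show ?thesis unfolding eigenvalues_def by blast
qed

lemma eigenvalue_of_row:
  assumes "\<And>j. j \<noteq> i \<Longrightarrow> A $ i $ j = 0"
  shows "A $ i $ i \<in> eigenvalues A"
  using eigenvalue_of_column[of i "transpose A"] assms by (simp add: eigenvalues_transpose) (simp add: transpose_def)

lemma Omega_hat_transpose: "Omega_hat x (transpose A) = transpose (Omega_hat x A)"
  by (simp add: vec_eq_iff forall_3 transpose_def Omega_hat_nth)

text \<open>If a component \<open>r $ i\<close> vanishes identically along a solution, the flow
  makes the i-th entry of \<open>Omega_hat x A *v r\<close> vanish too. With row i of the
  eigenvector equation this annihilates all products \<open>A $ i $ j * r $ j\<close>; the other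
  entries of \<open>r\<close> being nonzero, row i is diagonal and \<open>A $ i $ i\<close> is an
  eigenvalue.\<close>

lemma eigenvector_component_nz:
  assumes "\<And>j. A $ j $ j \<notin> eigenvalues A" and "A *v r = c *s r" "r \<noteq> 0" and x: "x \<noteq> 0" "x \<noteq> 1"
    and H: "(Omega_hat x A *v r) $ i = 0"
  shows "r $ i \<noteq> 0"
proof
  assume i: "r $ i = 0"
  have ev: "A$k$1 * r$1 + A$k$2 * r$2 + A$k$3 * r$3 = c * r$k" for k
    using assms(2) by (simp add: vec_eq_iff matrix_vector_mult_def sum_3)
  have H': "Omega_hat x A$k$1 * r$1 + Omega_hat x A$k$2 * r$2 + Omega_hat x A$k$3 * r$3 = (Omega_hat x A *v r) $ k" for k
    by (simp add: matrix_vector_mult_def sum_3)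
  \<comment> \<open>If \<open>r\<close> were a multiple of a basis vector, column j would be
    diagonal and \<open>A $ j $ j\<close> an eigenvalue.\<close>
  have two: "\<not> (\<forall>k. k \<noteq> j \<longrightarrow> r $ k = 0)" for j
  proof
    assume k: "\<forall>k. k \<noteq> j \<longrightarrow> r $ k = 0"
    hence "r $ j \<noteq> 0" using assms(3) by (auto simp: vec_eq_iff)
    moreover have "A $ l $ j * r $ j = c * r $ l" for l
      using ev[of l] k exhaust_3[of j] by auto
    ultimately have "A $ l $ j = 0" if "l \<noteq> j" for l using k that by (metis mult_eq_0_iff)
    thus False using eigenvalue_of_column[of j A] assms(1) by blast
  qed
  have nz: "r $ j \<noteq> 0" if "j \<noteq> i" for j
  proof
    assume j: "r $ j = 0"
    thus False using two[of 1] two[of 2] two[of 3] i that exhaust_3[of i] exhaust_3[of j]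
      by (auto simp: forall_3)
  qed
  \<comment> \<open>In row 2 there are two linear equations for the two products, with determinant
    \<open>1 / (x * (1 - x))\<close>. In rows 1 and 3 \<open>Omega_hat\<close> has a single entry,
    which isolates one product.\<close>
  have "A $ i $ j * r $ j = 0" for j
  proof (cases "i = 2")
    case True
    have "A$2$1 * r$1 + A$2$3 * r$3 = 0" "- (A$2$1 * r$1) / x + A$2$3 * r$3 / (1 - x) = 0"
      using ev[of 2] H'[of 2] H i True by (simp_all add: Omega_hat_nth)
    moreover have "u = 0 \<and> v = 0" if "u + v = 0" "- u / x + v / (1 - x) = 0" for u v
    proof -
      have "v = - u" using that(1) by algebra
      with that(2) x show ?thesis by (simp add: divide_simps split: if_splits) (simp add: algebra_simps)
    qed
    ultimately have "A$2$3 * r$3 = 0" "A$2$1 * r$1 = 0" by blast+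
    thus ?thesis using exhaust_3[of j] i True by auto
  next
    case False
    hence i': "i = 1 \<or> i = 3" using exhaust_3[of i] by auto
    hence "A $ i $ 2 * r $ 2 = 0"
      using H'[of i] H i x by (auto simp: Omega_hat_nth)
    thus ?thesis using ev[of i] i i' exhaust_3[of j] by auto
  qed
  hence "A $ i $ j = 0" if "j \<noteq> i" for j using nz[OF that] by (metis mult_eq_0_iff)
  thus False using eigenvalue_of_row[of i A] assms(1) by blast
qed

context reduced_system
begin

text \<open>The product of the quantities that \<open>formulae_defined\<close> requires to be
  nonzero, evaluated on adjugate eigenvectors so as to be holomorphic in \<open>t\<close>. All
  indices \<open>a\<close>, \<open>b\<close> are needed because a particular row or column may
  vanish at some points.\<close>

definition defect :: "(complex \<Rightarrow> complex^3^3) \<Rightarrow> 3 \<Rightarrow> 3 \<Rightarrow> complex \<Rightarrow> complex" where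
  "defect W a b t = (let l = row a (adj_plus (W t)); r = column b (adj_minus (W t)) in
     (l$1 * r$1) * ((l$2 * r$2) * ((l$3 * r$3) * (t * (l$2 * r$2) + l$3 * r$3))))"

lemma formulae_defined_iff_defect:
  assumes W: "W \<in> Omega_solutions \<theta> \<theta>inf X" and x: "x \<in> X"
  shows "formulae_defined \<theta> \<theta>inf (vector [0, x, 1]) (W x) \<longleftrightarrow> (\<exists>a b. defect W a b x \<noteq> 0)"
proof
  note c = Omega_solutionsD(3)[OF W x]
  assume "formulae_defined \<theta> \<theta>inf (vector [0, x, 1]) (W x)"
  then obtain l r where l: "l v* W x = \<mu>p *s l" and r: "W x *v r = \<mu>m *s r"
    and nz: "\<And>i. l $ i * r $ i \<noteq> 0" and T: "x * (l$2 * r$2) + l$3 * r$3 \<noteq> 0"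
    unfolding formulae_defined_normalized by blast
  obtain a where a: "adj_plus (W x) $ a $ a \<noteq> 0" using adj_plus_diag_nz[OF c] .
  obtain b where b: "adj_minus (W x) $ b $ b \<noteq> 0" using adj_minus_diag_nz[OF c] .
  have "row a (adj_plus (W x)) $ a \<noteq> 0" using a by (simp add: row_def)
  from left_eigenvector_unique[OF c row_adj_plus[OF c] l vec_nzI[OF this]]
  obtain s where s: "l = s *s row a (adj_plus (W x))" .
  have "column b (adj_minus (W x)) $ b \<noteq> 0" using b by (simp add: column_def)
  from right_eigenvector_unique[OF c column_adj_minus[OF c] r vec_nzI[OF this]]
  obtain s' where s': "r = s' *s column b (adj_minus (W x))" .
  have "x * (l$2 * r$2) + l$3 * r$3 = (s * s') * (x * (row a (adj_plus (W x)) $ 2 * column b (adj_minus (W x)) $ 2)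
     + row a (adj_plus (W x)) $ 3 * column b (adj_minus (W x)) $ 3)"
    by (simp add: s s' algebra_simps)
  hence "defect W a b x \<noteq> 0"
    using nz[of 1] nz[of 2] nz[of 3] T by (auto simp: defect_def Let_def s s')
  thus "\<exists>a b. defect W a b x \<noteq> 0" by blast
next
  note c = Omega_solutionsD(3)[OF W x]
  assume "\<exists>a b. defect W a b x \<noteq> 0"
  then obtain a b where "defect W a b x \<noteq> 0" by blast
  thus "formulae_defined \<theta> \<theta>inf (vector [0, x, 1]) (W x)"
    unfolding formulae_defined_normalized
    by (intro exI[of _ "row a (adj_plus (W x))"] exI[of _ "column b (adj_minus (W x))"] conjI
        row_adj_plus[OF c] column_adj_minus[OF c]) (simp_all add: defect_def Let_def forall_3)
qed

lemma defect_holomorphic: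
  assumes "W \<in> Omega_solutions \<theta> \<theta>inf X"
  shows "defect W a b holomorphic_on X"
  unfolding defect_def Let_def
  by (intro holomorphic_intros row_adj_plus_holomorphic column_adj_minus_holomorphic assms)

lemma right_eigenvector_flow:
  assumes W: "W \<in> Omega_solutions \<theta> \<theta>inf X" and x: "x \<in> X"
    and r: "\<And>i. ((\<lambda>t. r t $ i) has_field_derivative r' $ i) (at x)"
      "\<forall>\<^sub>F t in nhds x. W t *v r t = \<mu>m *s r t" "r x \<noteq> 0"
  obtains a where "r' + Omega_hat x (W x) *v r x = a *s r x"
proof -
  have "((\<lambda>t. W t $ i $ j) has_field_derivative (commutator (W x) (Omega_hat x (W x)) + 0) $ i $ j) (at x)" for i j
    using Omega_solutionsD(2)[OF W x] by simp
  from matrix_vector_deriv[OF this r(1,2)]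
  have "W x *v (r' + Omega_hat x (W x) *v r x) = \<mu>m *s (r' + Omega_hat x (W x) *v r x)" by simp
  from right_eigenvector_unique[OF Omega_solutionsD(3)[OF W x] eventually_nhds_x_imp_x[OF r(2)] this r(3)]
  show ?thesis using that .
qed

lemma left_eigenvector_flow:
  assumes W: "W \<in> Omega_solutions \<theta> \<theta>inf X" and x: "x \<in> X"
    and l: "\<And>i. ((\<lambda>t. l t $ i) has_field_derivative l' $ i) (at x)"
      "\<forall>\<^sub>F t in nhds x. l t v* W t = \<mu>p *s l t" "l x \<noteq> 0"
  obtains b where "l' - l x v* Omega_hat x (W x) = b *s l x"
proof -
  have "((\<lambda>t. W t $ i $ j) has_field_derivative (commutator (W x) (Omega_hat x (W x)) + 0) $ i $ j) (at x)" for i j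
    using Omega_solutionsD(2)[OF W x] by simp
  from vector_matrix_deriv[OF this l(1,2)]
  have "(l' - l x v* Omega_hat x (W x)) v* W x = \<mu>p *s (l' - l x v* Omega_hat x (W x))"
    by (simp add: vector_matrix_mult_def zero_vec_def[symmetric])
  from left_eigenvector_unique[OF Omega_solutionsD(3)[OF W x] eventually_nhds_x_imp_x[OF l(2)] this l(3)]
  show ?thesis using that .
qed

text \<open>A component of an eigenvector that vanishes identically forces a diagonal entry to be an
  eigenvalue; and \<open>T = \<Sum>\<^sub>i u\<^sub>i l\<^sub>i r\<^sub>i\<close> satisfies \<open>T' = (1 - \<theta>\<^sub>\<infinity>) l\<^sub>2 r\<^sub>2 + const T\<close>.\<close>

lemma defect_not_identically_0:
  assumes W: "W \<in> Omega_solutions \<theta> \<theta>inf X"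
    and gen: "\<theta>inf \<noteq> 1" "\<And>i. - \<theta> $ i \<notin> {0, \<mu>p, \<mu>m}"
  obtains a b x where "x \<in> X" "defect W a b x \<noteq> 0"
proof (rule ccontr)
  assume "\<not> thesis"
  with that have "\<forall>a b. \<forall>x\<in>X. defect W a b x = 0" by blast
  hence d0: "defect W a b x = 0" if "x \<in> X" for a b x using that by blast
  note cons = Omega_solutionsD(3)[OF W]
  have diag: "W x $ j $ j \<notin> eigenvalues (W x)" if "x \<in> X" for x j
    using cons[OF that] gen(2)[of j] by (simp add: constraints_def)
  obtain x0 where x0: "x0 \<in> X" using X_ne by blast
  obtain a where a: "adj_plus (W x0) $ a $ a \<noteq> 0" using adj_plus_diag_nz[OF cons[OF x0]] .
  obtain b where b: "adj_minus (W x0) $ b $ b \<noteq> 0" using adj_minus_diag_nz[OF cons[OF x0]] .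
  define l where "l = (\<lambda>t. row a (adj_plus (W t)))"
  define r where "r = (\<lambda>t. column b (adj_minus (W t)))"
  have lh: "(\<lambda>t. l t $ i) holomorphic_on X" and rh: "(\<lambda>t. r t $ i) holomorphic_on X" for i
    unfolding l_def r_def by (intro row_adj_plus_holomorphic[OF W] column_adj_minus_holomorphic[OF W])+
  have l: "l t v* W t = \<mu>p *s l t" and r: "W t *v r t = \<mu>m *s r t" if "t \<in> X" for t
    unfolding l_def r_def by (intro row_adj_plus column_adj_minus cons that)+
  have "(\<lambda>t. l t $ a * r t $ b) holomorphic_on X" by (intro holomorphic_intros lh rh)
  hence "open (X \<inter> (\<lambda>t. l t $ a * r t $ b) -` (- {0}))"
    by (intro continuous_open_preimage holomorphic_on_imp_continuous_on open_X) auto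
  moreover have "x0 \<in> X \<inter> (\<lambda>t. l t $ a * r t $ b) -` (- {0})"
    using x0 a b by (simp add: l_def r_def row_def column_def)
  ultimately obtain e where e: "e > 0" "ball x0 e \<subseteq> X \<inter> (\<lambda>t. l t $ a * r t $ b) -` (- {0})"
    using openE by blast
  \<comment> \<open>On this disc neither of the two adjugate vectors vanishes, so they are genuine
    eigenvectors and the flow relations apply.\<close>
  define U where "U = ball x0 e"
  have U: "open U" "connected U" "U \<subseteq> X" "x0 \<in> U" using e by (auto simp: U_def)
  have nz: "l t \<noteq> 0" "r t \<noteq> 0" if "t \<in> U" for t using e that by (auto simp: U_def)
  note lU = holomorphic_on_subset[OF lh U(3)] and rU = holomorphic_on_subset[OF rh U(3)]
  have dl: "((\<lambda>t. l t $ i) has_field_derivative (\<chi> i. deriv (\<lambda>t. l t $ i) x) $ i) (at x)"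
    and dr: "((\<lambda>t. r t $ i) has_field_derivative (\<chi> i. deriv (\<lambda>t. r t $ i) x) $ i) (at x)" if "x \<in> U" for x i
    using holomorphic_derivI[OF lU U(1) that] holomorphic_derivI[OF rU U(1) that] by simp_all
  have evU: "\<forall>\<^sub>F t in nhds x. t \<in> U" if "x \<in> U" for x using U(1) that by (rule eventually_nhds_in_open)
  have evl: "\<forall>\<^sub>F t in nhds x. l t v* W t = \<mu>p *s l t" if "x \<in> U" for x
    using evU[OF that] by eventually_elim (use l U(3) in auto)
  have evr: "\<forall>\<^sub>F t in nhds x. W t *v r t = \<mu>m *s r t" if "x \<in> U" for x
    using evU[OF that] by eventually_elim (use r U(3) in auto)
  have d_0: "deriv f x = 0" if "x \<in> U" "\<forall>t\<in>U. f t = 0" for f :: "complex \<Rightarrow> complex" and x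
  proof -
    have "deriv f x = deriv (\<lambda>_. 0) x"
      by (rule deriv_cong_ev[OF _ refl]) (use evU[OF that(1)] that(2) in \<open>auto elim!: eventually_mono\<close>)
    thus ?thesis by simp
  qed
  have rflow: "\<exists>c. (\<chi> i. deriv (\<lambda>t. r t $ i) x) + Omega_hat x (W x) *v r x = c *s r x" if "x \<in> U" for x
    using right_eigenvector_flow[OF W _ dr[OF that] evr[OF that] nz(2)[OF that]] U(3) that by blast
  have lflow: "\<exists>c. (\<chi> i. deriv (\<lambda>t. l t $ i) x) - l x v* Omega_hat x (W x) = c *s l x" if "x \<in> U" for x
    using left_eigenvector_flow[OF W _ dl[OF that] evl[OF that] nz(1)[OF that]] U(3) that by blast
  \<comment> \<open>An identically vanishing component has derivative zero, so the flow relation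
    leaves only its \<open>Omega_hat\<close> term.\<close>
  have r_nz: "\<not> (\<forall>t\<in>U. r t $ i = 0)" for i
  proof
    assume 0: "\<forall>t\<in>U. r t $ i = 0"
    obtain c where "(\<chi> i. deriv (\<lambda>t. r t $ i) x0) + Omega_hat x0 (W x0) *v r x0 = c *s r x0"
      using rflow[OF U(4)] by blast
    from arg_cong[OF this, of "\<lambda>v. v $ i"] have "(Omega_hat x0 (W x0) *v r x0) $ i = 0"
      using 0 U(4) by (simp add: d_0)
    thus False
      using eigenvector_component_nz[OF diag[OF x0] r[OF x0] nz(2)[OF U(4)] X_nz[OF x0]] 0 U(4) by blast
  qed
  have l_nz: "\<not> (\<forall>t\<in>U. l t $ i = 0)" for i
  proof
    assume 0: "\<forall>t\<in>U. l t $ i = 0"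
    obtain c where "(\<chi> i. deriv (\<lambda>t. l t $ i) x0) - l x0 v* Omega_hat x0 (W x0) = c *s l x0"
      using lflow[OF U(4)] by blast
    from arg_cong[OF this, of "\<lambda>v. v $ i"] have "(l x0 v* Omega_hat x0 (W x0)) $ i = 0"
      using 0 U(4) by (simp add: d_0)
    hence "(Omega_hat x0 (transpose (W x0)) *v l x0) $ i = 0" by (simp add: Omega_hat_transpose)
    moreover have "transpose (W x0) $ j $ j \<notin> eigenvalues (transpose (W x0))" for j
      using diag[OF x0] unfolding eigenvalues_transpose by (simp add: transpose_def)
    moreover have "transpose (W x0) *v l x0 = \<mu>p *s l x0" using l[OF x0] by simp
    ultimately show False
      using eigenvector_component_nz[OF _ _ nz(1)[OF U(4)] X_nz[OF x0]] 0 U(4) by blast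
  qed
  have lr_nz: "\<not> (\<forall>t\<in>U. l t $ i * r t $ i = 0)" for i
    using holomorphic_mult_eq_0[OF lU rU U(1,2)] l_nz r_nz by blast
  define T where "T = (\<lambda>t. t * (l t $ 2 * r t $ 2) + l t $ 3 * r t $ 3)"
  have Th: "T holomorphic_on U" unfolding T_def by (intro holomorphic_intros lU rU)
  \<comment> \<open>Holomorphic functions on the connected set \<open>U\<close> have no zero
    divisors, so the factors of \<open>defect\<close> are cancelled one after another until only
    \<open>T\<close> is left.\<close>
  have cancel: "\<forall>t\<in>U. g t = 0" if "\<forall>t\<in>U. (l t $ i * r t $ i) * g t = 0" "g holomorphic_on U" for g i
    using holomorphic_mult_eq_0[OF holomorphic_on_mult[OF lU rU] that(2) U(1,2)] that(1) lr_nz by blast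
  have "\<forall>t\<in>U. (l t $ 1 * r t $ 1) * ((l t $ 2 * r t $ 2) * ((l t $ 3 * r t $ 3) * T t)) = 0"
    using d0[of _ a b] U(3) unfolding defect_def T_def l_def r_def Let_def by blast
  hence "\<forall>t\<in>U. (l t $ 2 * r t $ 2) * ((l t $ 3 * r t $ 3) * T t) = 0"
    by (rule cancel) (intro holomorphic_intros lU rU Th)
  hence "\<forall>t\<in>U. (l t $ 3 * r t $ 3) * T t = 0"
    by (rule cancel) (intro holomorphic_intros lU rU Th)
  hence T0: "\<forall>t\<in>U. T t = 0"
    by (rule cancel) (rule Th)
  have "l x $ 2 * r x $ 2 = 0" if x: "x \<in> U" for x
  proof -
    have xX: "x \<in> X" using x U(3) by blast
    define l' where "l' = (\<chi> i. deriv (\<lambda>t. l t $ i) x)"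
    define r' where "r' = (\<chi> i. deriv (\<lambda>t. r t $ i) x)"
    define H where "H = Omega_hat x (W x)"
    obtain c where c: "r' + H *v r x = c *s r x" using rflow[OF x] unfolding r'_def H_def by blast
    obtain d where d: "l' - l x v* H = d *s l x" using lflow[OF x] unfolding l'_def H_def by blast
    have dm: "((\<lambda>t. l t $ i * r t $ i) has_field_derivative l' $ i * r x $ i + l x $ i * r' $ i) (at x)" for i
      using DERIV_mult[OF dl[OF x, of i] dr[OF x, of i]] by (simp add: l'_def r'_def mult.commute)
    have "(T has_field_derivative l x $ 2 * r x $ 2 + x * (l' $ 2 * r x $ 2 + l x $ 2 * r' $ 2)
       + (l' $ 3 * r x $ 3 + l x $ 3 * r' $ 3)) (at x)"
      unfolding T_def
      by (rule DERIV_cong[OF DERIV_add[OF DERIV_mult[OF DERIV_ident dm[of 2]] dm[of 3]]]) simp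
    hence T': "l x $ 2 * r x $ 2 + x * (l' $ 2 * r x $ 2 + l x $ 2 * r' $ 2)
       + (l' $ 3 * r x $ 3 + l x $ 3 * r' $ 3) = 0"
      using d_0[OF x T0] DERIV_imp_deriv by metis
    have r2: "r' $ 2 = c * r x $ 2 + W x $ 2 $ 1 / x * r x $ 1 - W x $ 2 $ 3 / (1 - x) * r x $ 3"
      and r3: "r' $ 3 = c * r x $ 3 - W x $ 3 $ 2 / (1 - x) * r x $ 2"
      using arg_cong[OF c, of "\<lambda>v. v $ 2"] arg_cong[OF c, of "\<lambda>v. v $ 3"]
      by (simp_all add: H_def matrix_vector_mult_def sum_3 Omega_hat_nth eq_diff_eq add_eq_0_iff)
         (simp_all add: algebra_simps eq_diff_eq)
    have l2: "l' $ 2 = d * l x $ 2 - W x $ 1 $ 2 / x * l x $ 1 + W x $ 3 $ 2 / (1 - x) * l x $ 3"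
      and l3: "l' $ 3 = d * l x $ 3 + W x $ 2 $ 3 / (1 - x) * l x $ 2"
      using arg_cong[OF d, of "\<lambda>v. v $ 2"] arg_cong[OF d, of "\<lambda>v. v $ 3"]
      by (simp_all add: H_def vector_matrix_mult_def sum_3 Omega_hat_nth algebra_simps eq_diff_eq diff_eq_eq)
    define i where "i = 1 / x"
    define k where "k = 1 / (1 - x)"
    have ik: "x * i = 1" "(1 - x) * k = 1" using X_nz[OF xX] by (simp_all add: i_def k_def)
    have div: "z / x = z * i" "z / (1 - x) = z * k" for z by (simp_all add: i_def k_def)
    have e2: "W x $ 2 $ 1 * r x $ 1 + W x $ 2 $ 2 * r x $ 2 + W x $ 2 $ 3 * r x $ 3 = \<mu>m * r x $ 2"
      using arg_cong[OF r[OF xX], of "\<lambda>v. v $ 2"] by (simp add: matrix_vector_mult_def sum_3)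
    have f2: "l x $ 1 * W x $ 1 $ 2 + l x $ 2 * W x $ 2 $ 2 + l x $ 3 * W x $ 3 $ 2 = \<mu>p * l x $ 2"
      using arg_cong[OF l[OF xX], of "\<lambda>v. v $ 2"] by (simp add: vector_matrix_mult_def sum_3)
    have "x * (l x $ 2 * r x $ 2) + l x $ 3 * r x $ 3 = 0" using T0 x by (simp add: T_def)
    \<comment> \<open>The scalars \<open>c\<close> and \<open>d\<close> enter only as multiples of
      \<open>T\<close>, which is zero; the second components of the two eigenvector equations turn
      the rest into a multiple of the second product.\<close>
    with T' have "(1 - (\<mu>p - \<mu>m)) * (l x $ 2 * r x $ 2) = 0"
      using e2 f2 ik unfolding r2 r3 l2 l3 div by algebra
    thus ?thesis using gen(1) by (simp add: mu_diff)
  qed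
  thus False using lr_nz[of 2] by blast
qed

text \<open>\<open>B\<close> lies in the zero set of every \<open>defect W a b\<close>. One of these
  functions that is not identically zero makes \<open>B\<close> sparse by isolation of zeros; if all
  vanish identically, then \<open>B = X\<close>.\<close>

theorem undefined_points_sparse:
  assumes W: "W \<in> Omega_solutions \<theta> \<theta>inf X"
  defines "B \<equiv> {x\<in>X. \<not> formulae_defined \<theta> \<theta>inf (vector [0, x, 1]) (W x)}"
  shows "B sparse_in X \<or> B = X"
    and "\<theta>inf \<noteq> 1 \<Longrightarrow> \<forall>i. - \<theta> $ i \<notin> {0, \<mu>p, \<mu>m} \<Longrightarrow> B sparse_in X"
proof -
  have sp: "B sparse_in X" if "z \<in> X" "defect W a b z \<noteq> 0" for a b z
  proof (rule sparse_in_mono)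
    show "{x\<in>X. defect W a b x = 0} sparse_in X"
      using zeros_sparse_in[OF defect_holomorphic[OF W] open_X simply_connected_imp_connected[OF sc_X]] that by blast
    show "B \<subseteq> {x\<in>X. defect W a b x = 0}"
      using formulae_defined_iff_defect[OF W] unfolding B_def by blast
  qed
  show "B sparse_in X \<or> B = X"
  proof (cases "\<exists>a b. \<exists>z\<in>X. defect W a b z \<noteq> 0")
    case True
    thus ?thesis using sp by blast
  next
    case False
    thus ?thesis using formulae_defined_iff_defect[OF W] by (auto simp: B_def)
  qed
  show "B sparse_in X" if "\<theta>inf \<noteq> 1" "\<forall>i. - \<theta> $ i \<notin> {0, \<mu>p, \<mu>m}"
    using defect_not_identically_0[OF W that(1)] that(2) sp by blast
qed

end

section \<open>The system in three variables\<close>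

text \<open>The pointwise condition of \<open>holomorphic3_on\<close> with the derivative made
  explicit, so that directional derivatives can be computed.\<close>

definition cderiv :: "(complex^'n \<Rightarrow> complex) \<Rightarrow> (complex^'n \<Rightarrow> complex) \<Rightarrow> complex^'n \<Rightarrow> bool" where
  "cderiv f f' u \<longleftrightarrow> (f has_derivative f') (at u) \<and> (\<forall>c h. f' (c *s h) = c * f' h)"

lemma holomorphic3_on_iff: "holomorphic3_on f D \<longleftrightarrow> (\<forall>u\<in>D. \<exists>f'. cderiv f f' u)"
  by (simp add: holomorphic3_on_def cderiv_def)

lemma has_derivative_line: "((\<lambda>t. v + t *s h) has_derivative (\<lambda>t. t *s h)) F"
  for h :: "complex^'n"
proof -
  have "linear (\<lambda>t. t *s h)"
    by (rule linearI) (simp_all add: vec_eq_iff algebra_simps)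
  hence "bounded_linear (\<lambda>t. t *s h)" by (rule linear_linear[THEN iffD2])
  from has_derivative_add[OF has_derivative_const bounded_linear_imp_has_derivative[OF this]]
  show ?thesis by simp
qed

lemma convex_line_preimage:
  fixes h :: "complex^'n"
  assumes "convex B"
  shows "convex {z. v + z *s h \<in> B}"
proof (rule convexI)
  fix z z' :: complex and p q :: real
  assume *: "z \<in> {z. v + z *s h \<in> B}" "z' \<in> {z. v + z *s h \<in> B}" "0 \<le> p" "0 \<le> q" "p + q = 1"
  have "p *\<^sub>R v + q *\<^sub>R v = v" using *(5) by (metis scaleR_add_left scaleR_one)
  hence "v + (p *\<^sub>R z + q *\<^sub>R z') *s h = p *\<^sub>R (v + z *s h) + q *\<^sub>R (v + z' *s h)"
    by (simp add: vec_eq_iff algebra_simps)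
  moreover have "p *\<^sub>R (v + z *s h) + q *\<^sub>R (v + z' *s h) \<in> B"
    by (rule convexD[OF assms]) (use * in auto)
  ultimately show "p *\<^sub>R z + q *\<^sub>R z' \<in> {z. v + z *s h \<in> B}" by simp
qed

lemma cderiv_line:
  assumes "cderiv f f' (v + z *s h)"
  shows "((\<lambda>t. f (v + t *s h)) has_field_derivative f' h) (at z)"
proof -
  have "((\<lambda>t. f (v + t *s h)) has_derivative (\<lambda>t. f' (t *s h))) (at z)"
    using has_derivative_compose[OF has_derivative_line] assms unfolding cderiv_def by blast
  moreover have "(\<lambda>t. f' (t *s h)) = (*) (f' h)"
    using assms by (auto simp: cderiv_def mult.commute)
  ultimately show ?thesis by (simp add: has_field_derivative_def)
qed

lemma cderiv_partial: "cderiv f f' u \<Longrightarrow> partial k f u = f' (axis k 1)"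
  unfolding partial_def by (rule DERIV_imp_deriv, rule cderiv_line) simp

lemma cderiv_nth: "cderiv (\<lambda>u. u $ i) (\<lambda>h. h $ i) u"
  unfolding cderiv_def by (simp add: bounded_linear_imp_has_derivative bounded_linear_vec_nth)

lemma cderiv_diff: "cderiv f f' u \<Longrightarrow> cderiv g g' u \<Longrightarrow> cderiv (\<lambda>u. f u - g u) (\<lambda>h. f' h - g' h) u"
  unfolding cderiv_def by (auto intro!: derivative_eq_intros simp: algebra_simps)

lemma cderiv_add: "cderiv f f' u \<Longrightarrow> cderiv g g' u \<Longrightarrow> cderiv (\<lambda>u. f u + g u) (\<lambda>h. f' h + g' h) u"
  unfolding cderiv_def by (auto intro!: derivative_eq_intros simp: algebra_simps)

lemma cderiv_mult: "cderiv f f' u \<Longrightarrow> cderiv g g' u \<Longrightarrow>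
    cderiv (\<lambda>u. f u * g u) (\<lambda>h. f u * g' h + f' h * g u) u"
  unfolding cderiv_def by (auto intro!: derivative_eq_intros simp: algebra_simps)

lemma cderiv_compose:
  assumes "cderiv f f' u" "(g has_field_derivative d) (at (f u))"
  shows "cderiv (\<lambda>u. g (f u)) (\<lambda>h. d * f' h) u"
  using has_derivative_compose[of f f' u UNIV g "(*) d"] assms
  by (simp add: cderiv_def has_field_derivative_def)

lemma cderiv_unique: "cderiv f f' u \<Longrightarrow> cderiv f g' u \<Longrightarrow> f' = g'"
  unfolding cderiv_def using has_derivative_unique by blast

lemma cderiv_transform:
  assumes "cderiv f f' u" "\<forall>\<^sub>F v in nhds u. f v = g v"
  shows "cderiv g f' u"
proof -
  have "\<forall>\<^sub>F v in at u. f v = g v"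
    unfolding eventually_at_filter using assms(2) by (rule eventually_mono) simp
  thus ?thesis
    using has_derivative_transform_eventually[of f f' u UNIV g] assms(1) eventually_nhds_x_imp_x[OF assms(2)]
    by (simp add: cderiv_def)
qed

lemma cderiv_components:
  fixes f :: "complex^3 \<Rightarrow> complex"
  assumes "cderiv f f' u"
  shows "f' h = h$1 * f' (axis 1 1) + h$2 * f' (axis 2 1) + h$3 * f' (axis 3 1)"
proof -
  have "h = h$1 *s axis 1 1 + h$2 *s axis 2 1 + h$3 *s axis 3 1"
    by (simp add: vec_eq_iff forall_3 axis_def)
  moreover have "f' (a + b) = f' a + f' b" for a b
    using assms has_derivative_bounded_linear linear_simps(1) unfolding cderiv_def by blast
  moreover have "f' (c *s a) = c * f' a" for a c using assms by (simp add: cderiv_def)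
  ultimately show ?thesis by metis
qed

lemma distinct_entries_diff:
  "distinct_entries u \<longleftrightarrow> u$1 \<noteq> u$2 \<and> u$1 \<noteq> u$3 \<and> u$2 \<noteq> u$3"
  unfolding distinct_entries_def forall_3 by auto

text \<open>The differential of \<open>x_of\<close> at \<open>u\<close>. It vanishes along
  translations and dilations, the directions tangent to the fibres.\<close>

definition x_deriv :: "complex^3 \<Rightarrow> complex^3 \<Rightarrow> complex" where
  "x_deriv u h = ((h$2 - h$1) - x_of u * (h$3 - h$1)) / (u$3 - u$1)"

lemma cderiv_x_of:
  assumes "u$3 \<noteq> u$1"
  shows "cderiv x_of (x_deriv u) u"
proof -
  have i: "cderiv (\<lambda>v. inverse (v$3 - v$1)) (\<lambda>h. - (inverse (u$3 - u$1) ^ Suc (Suc 0)) * (h$3 - h$1)) u"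
    by (rule cderiv_compose[OF cderiv_diff[OF cderiv_nth cderiv_nth]]) (rule DERIV_inverse, use assms in simp)
  have "cderiv x_of (\<lambda>h. (u$2 - u$1) * (- (inverse (u$3 - u$1) ^ Suc (Suc 0)) * (h$3 - h$1))
      + (h$2 - h$1) * inverse (u$3 - u$1)) u"
    unfolding x_of_def divide_inverse by (rule cderiv_mult[OF cderiv_diff[OF cderiv_nth cderiv_nth] i])
  moreover have "(u$2 - u$1) * (- (inverse (u$3 - u$1) ^ Suc (Suc 0)) * (h$3 - h$1))
      + (h$2 - h$1) * inverse (u$3 - u$1) = x_deriv u h" for h
    using assms by (simp add: x_deriv_def x_of_def divide_simps)
  ultimately show ?thesis by simp
qed

text \<open>The coefficients of the system split along the translations and dilations of \<open>u\<close>, which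
  integrate to the conjugation by \<open>(u\<^sub>3 - u\<^sub>1)\<^sup>\<Theta>\<close>, and along \<open>x\<close>.\<close>

lemma V_sub_eq:
  assumes "distinct_entries u"
  shows "V_sub k u A $ i $ j = (axis k 1 $ 3 - axis k 1 $ 1) / (u$3 - u$1) * (if i = j then 0 else A $ i $ j)
     - x_deriv u (axis k 1) * Omega_hat (x_of u) A $ i $ j"
proof -
  have d: "u$1 - u$2 \<noteq> 0" "u$2 - u$1 \<noteq> 0" "u$1 - u$3 \<noteq> 0" "u$3 - u$1 \<noteq> 0" "u$2 - u$3 \<noteq> 0" "u$3 - u$2 \<noteq> 0"
    using assms by (auto simp: distinct_entries_diff)
  define t where "t = u$3 - u$1"
  define s where "s = u$2 - u$1"
  have u: "u$2 = u$1 + s" "u$3 = u$1 + t" by (simp_all add: s_def t_def)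
  have nz: "s \<noteq> 0" "t \<noteq> 0" "s - t \<noteq> 0" "t - s \<noteq> 0" using d by (auto simp: s_def t_def)
  have x: "x_of u = s / t" by (simp add: x_of_def s_def t_def)
  have "1 - s / t = (t - s) / t" using nz by (simp add: divide_simps)
  hence "\<forall>k i j. V_sub k u A $ i $ j = (axis k 1 $ 3 - axis k 1 $ 1) / (u$3 - u$1) * (if i = j then 0 else A $ i $ j)
     - x_deriv u (axis k 1) * Omega_hat (x_of u) A $ i $ j"
    unfolding forall_3 V_sub_def vec_lambda_beta x_deriv_def Omega_hat_nth kron_def axis_def x u
    using nz by (simp add: divide_simps) (simp add: algebra_simps)
  thus ?thesis by blast
qed

text \<open>The off-diagonal part of \<open>A\<close> is \<open>A\<close> plus the diagonal matrix
  of \<open>\<theta>\<close>, by the condition on the diagonal. Its commutator with \<open>A\<close>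
  is thus that of this diagonal matrix alone, the infinitesimal form of conjugation by a
  power.\<close>

lemma commutator_V_sub:
  assumes "distinct_entries u" and diag: "\<And>i. A $ i $ i = - \<theta> $ i"
  shows "commutator (V_sub k u A) A $ i $ j
    = (\<theta> $ i - \<theta> $ j) * ((axis k 1 $ 3 - axis k 1 $ 1) / (u$3 - u$1)) * A $ i $ j
      + x_deriv u (axis k 1) * commutator A (Omega_hat (x_of u) A) $ i $ j"
proof -
  define c where "c = (axis k 1 $ 3 - axis k 1 $ 1) / (u$3 - u$1)"
  define d where "d = x_deriv u (axis k 1)"
  define H where "H = Omega_hat (x_of u) A"
  have V: "V_sub k u A $ i $ j = c * (A $ i $ j + (if i = j then \<theta> $ i else 0)) - d * H $ i $ j" for i j
    unfolding V_sub_eq[OF assms(1)] c_def d_def H_def by (simp add: diag)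
  have "\<forall>i j. commutator (V_sub k u A) A $ i $ j = (\<theta> $ i - \<theta> $ j) * c * A $ i $ j + d * commutator A H $ i $ j"
    unfolding forall_3 commutator_nth_3 V by (simp add: algebra_simps)
  thus ?thesis unfolding c_def d_def H_def by blast
qed

definition rescale :: "complex^'n \<Rightarrow> complex^'n^'n \<Rightarrow> complex^'n^'n" where
  "rescale e A = (\<chi> i j. e $ i * A $ i $ j / e $ j)"

lemma rescale_inverse: "(\<And>i. e $ i \<noteq> 0) \<Longrightarrow> rescale (\<chi> i. inverse (e $ i)) (rescale e A) = A"
  by (simp add: rescale_def vec_eq_iff field_simps)

lemma rescale_right:
  assumes "\<And>i. e $ i \<noteq> 0"
  shows "A *v r = c *s r \<Longrightarrow> rescale e A *v (\<chi> i. e $ i * r $ i) = c *s (\<chi> i. e $ i * r $ i)"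
proof (subst vec_eq_iff, intro allI)
  fix i assume "A *v r = c *s r"
  hence "e $ i * (\<Sum>j\<in>UNIV. A $ i $ j * r $ j) = e $ i * (c * r $ i)"
    by (simp add: matrix_vector_mult_def vec_eq_iff)
  thus "(rescale e A *v (\<chi> i. e $ i * r $ i)) $ i = (c *s (\<chi> i. e $ i * r $ i)) $ i"
    using assms by (simp add: rescale_def matrix_vector_mult_def sum_distrib_left mult_ac)
qed

lemma rescale_left:
  assumes "\<And>i. e $ i \<noteq> 0"
  shows "l v* A = c *s l \<Longrightarrow> (\<chi> i. l $ i / e $ i) v* rescale e A = c *s (\<chi> i. l $ i / e $ i)"
proof (subst vec_eq_iff, intro allI)
  fix i assume "l v* A = c *s l"
  hence "(\<Sum>j\<in>UNIV. l $ j * A $ j $ i) / e $ i = c * l $ i / e $ i"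
    by (simp add: vector_matrix_mult_def vec_eq_iff)
  thus "((\<chi> i. l $ i / e $ i) v* rescale e A) $ i = (c *s (\<chi> i. l $ i / e $ i)) $ i"
    using assms by (simp add: rescale_def vector_matrix_mult_def sum_divide_distrib)
qed

lemma eigenvalues_rescale:
  assumes "\<And>i. e $ i \<noteq> 0"
  shows "eigenvalues (rescale e A) = eigenvalues A"
proof -
  have sub: "eigenvalues B \<subseteq> eigenvalues (rescale e B)" if "\<And>i. e $ i \<noteq> 0" for e :: "complex^'n" and B
  proof
    fix c assume "c \<in> eigenvalues B"
    then obtain v where "v \<noteq> 0" "B *v v = c *s v" by (auto simp: eigenvalues_def)
    moreover from this have "(\<chi> i. e $ i * v $ i) \<noteq> 0" using that by (auto simp: vec_eq_iff)
    ultimately show "c \<in> eigenvalues (rescale e B)"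
      unfolding eigenvalues_def using rescale_right[OF that] by blast
  qed
  have "eigenvalues (rescale e A) \<subseteq> eigenvalues (rescale (\<chi> i. inverse (e $ i)) (rescale e A))"
    by (rule sub) (use assms in simp)
  thus ?thesis using sub[OF assms, of A] unfolding rescale_inverse[OF assms] by blast
qed

lemma constraints_rescale:
  assumes "\<And>i. e $ i \<noteq> 0"
  shows "constraints \<theta> \<theta>inf (rescale e A) \<longleftrightarrow> constraints \<theta> \<theta>inf A"
  unfolding constraints_def eigenvalues_rescale[OF assms] using assms by (simp add: rescale_def)

lemma formulae_defined_rescale:
  assumes e: "\<And>i. e $ i \<noteq> 0"
  shows "formulae_defined \<theta> \<theta>inf u (rescale e A) \<longleftrightarrow> formulae_defined \<theta> \<theta>inf u A"
proof -
  have imp: "formulae_defined \<theta> \<theta>inf u (rescale e B)" if "formulae_defined \<theta> \<theta>inf u B" "\<And>i. e $ i \<noteq> 0"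
    for e B
  proof -
    from that(1) obtain l r where *: "l v* B = mu_plus \<theta> \<theta>inf *s l" "B *v r = mu_minus \<theta> \<theta>inf *s r"
      "\<forall>i. l $ i * r $ i \<noteq> 0" "(\<Sum>i\<in>UNIV. u $ i * (l $ i * r $ i)) \<noteq> 0" unfolding formulae_defined_def by blast
    have **: "(\<chi> i. l $ i / e $ i) $ i * (\<chi> i. e $ i * r $ i) $ i = l $ i * r $ i" for i using that(2) by simp
    show ?thesis unfolding formulae_defined_def
      by (intro exI[of _ "\<chi> i. l $ i / e $ i"] exI[of _ "\<chi> i. e $ i * r $ i"] conjI
          rescale_left[OF that(2) *(1)] rescale_right[OF that(2) *(2)], unfold **) (fact *)+
  qed
  show ?thesis using imp[of A e] imp[of "rescale e A" "\<chi> i. inverse (e $ i)"] e rescale_inverse[OF e] by auto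
qed

lemma commutator_Omega_hat_rescale:
  assumes "\<And>i. e $ i \<noteq> 0"
  shows "commutator (rescale e A) (Omega_hat x (rescale e A)) = rescale e (commutator A (Omega_hat x A))"
proof -
  have "Omega_hat x (rescale e A) = rescale e (Omega_hat x A)"
    by (simp add: vec_eq_iff forall_3 Omega_hat_nth rescale_def)
  moreover have "commutator (rescale e A) (rescale e B) = rescale e (commutator A B)" for B
    using assms by (simp add: vec_eq_iff commutator_nth_3 rescale_def ring_distribs add_divide_distrib diff_divide_distrib)
  ultimately show ?thesis by simp
qed

lemma isCont_tendsto_nhds: "isCont f a \<Longrightarrow> (f \<longlongrightarrow> f a) (nhds a)"
  by (simp only: isCont_def tendsto_at_iff_tendsto_nhds)

section \<open>Correspondence between solutions in \<open>u\<close> and in \<open>x\<close>\<close>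

locale admissible_setting = PVI_parameters +
  fixes X :: "complex set" and D :: "(complex^3) set" and L :: "complex^3 \<Rightarrow> complex"
  assumes admissible: "admissible_domains X D L"
begin

lemma domain:
  "open D" "connected D" "D \<noteq> {}" "u \<in> D \<Longrightarrow> distinct_entries u" "x_of ` D = X"
  "x \<in> X \<Longrightarrow> connected {u\<in>D. x_of u = x}" "continuous_on D L" "u \<in> D \<Longrightarrow> exp (L u) = u$3 - u$1"
  using admissible by (auto simp: admissible_domains_def)

lemma D_nz:
  assumes "u \<in> D"
  shows "u$3 - u$1 \<noteq> 0" "u$3 \<noteq> u$1"
  using domain(4)[OF assms] unfolding distinct_entries_diff by auto

lemma x_of_D: "u \<in> D \<Longrightarrow> x_of u \<in> X"
  using domain(5) by blast

end

sublocale admissible_setting \<subseteq> reduced_system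
proof unfold_locales
  show "open X" "simply_connected X" using admissible by (auto simp: admissible_domains_def)
  show "X \<noteq> {}" using domain(3,5) by blast
  have "x_of u \<noteq> 0 \<and> x_of u \<noteq> 1" if "u \<in> D" for u
    using domain(4)[OF that] D_nz[OF that] by (auto simp: x_of_def distinct_entries_diff divide_simps)
  thus "0 \<notin> X" "1 \<notin> X" using domain(5) by auto
qed

context admissible_setting
begin

lemma ev_D: "u \<in> D \<Longrightarrow> \<forall>\<^sub>F v in nhds u. v \<in> D"
  using domain(1) by (rule eventually_nhds_in_open)

text \<open>\<open>L\<close> is only assumed continuous. Near \<open>u\<close> it differs from a
  holomorphic logarithm by a multiple of \<open>2 pi i\<close>, and continuity makes this multiple
  constant.\<close>

lemma cderiv_L:
  assumes u: "u \<in> D"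
  shows "cderiv L (\<lambda>h. (h$3 - h$1) / (u$3 - u$1)) u"
proof -
  let ?t = "u$3 - u$1"
  \<comment> \<open>Division by the value at \<open>u\<close> moves the argument to a neighbourhood
    of \<open>1\<close>, away from the branch cut.\<close>
  let ?l = "\<lambda>v. Ln ((v$3 - v$1) / ?t)"
  have t: "?t \<noteq> 0" using D_nz[OF u] by simp
  have "cderiv (\<lambda>v. (v$3 - v$1)) (\<lambda>h. (h$3 - h$1)) u"
    by (rule cderiv_diff[OF cderiv_nth cderiv_nth])
  moreover have "((\<lambda>z. Ln (z / ?t)) has_field_derivative 1 / ?t) (at ?t)"
    using t by (auto intro!: derivative_eq_intros simp: complex_nonpos_Reals_iff)
  ultimately have l: "cderiv ?l (\<lambda>h. 1 / ?t * (h$3 - h$1)) u"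
    by (rule cderiv_compose)
  hence "isCont ?l u" unfolding cderiv_def using has_derivative_continuous by blast
  moreover have "isCont L u" using domain(1,7) u continuous_on_eq_continuous_at by blast
  ultimately have "isCont (\<lambda>v. L v - L u - ?l v) u" by (intro isCont_diff continuous_const)
  from isCont_tendsto_nhds[OF this] have "((\<lambda>v. L v - L u - ?l v) \<longlongrightarrow> 0) (nhds u)"
    using t by simp
  \<comment> \<open>A bound smaller than pi keeps the difference in the strip where
    \<open>Ln\<close> inverts \<open>exp\<close>.\<close>
  hence "\<forall>\<^sub>F v in nhds u. dist (L v - L u - ?l v) 0 < 1" by (rule tendstoD) simp
  with ev_D[OF u] have "\<forall>\<^sub>F v in nhds u. ?l v + L u = L v"
  proof eventually_elim
    case (elim v)
    have "exp (L v - L u - ?l v) = 1"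
      using t elim(1) u D_nz[OF elim(1)] by (simp add: exp_diff domain(8))
    moreover have "\<bar>Im (L v - L u - ?l v)\<bar> < 1" using elim(2) abs_Im_le_cmod[of "L v - L u - ?l v"] by simp
    hence "- pi < Im (L v - L u - ?l v)" "Im (L v - L u - ?l v) \<le> pi"
      using pi_gt3 by linarith+
    hence "Ln (exp (L v - L u - ?l v)) = L v - L u - ?l v" by (rule Ln_exp)
    ultimately have "L v - L u = ?l v" by simp
    thus ?case unfolding diff_eq_eq by (rule sym)
  qed
  moreover have "cderiv (\<lambda>v. ?l v + L u) (\<lambda>h. 1 / ?t * (h$3 - h$1) + 0) u"
    by (rule cderiv_add[OF l]) (simp add: cderiv_def)
  ultimately show ?thesis using cderiv_transform by fastforce
qed

definition gauge :: "complex^3 \<Rightarrow> complex^3" where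
  "gauge u = (\<chi> i. exp (L u * \<theta> $ i))"

lemma gauge_nz: "gauge u $ i \<noteq> 0"
  by (simp add: gauge_def)

lemma gauge_quotient: "gauge u $ i / gauge u $ j = exp (L u * (\<theta> $ i - \<theta> $ j))"
  by (simp add: gauge_def exp_diff right_diff_distrib)

definition ungauge :: "complex^3 \<Rightarrow> complex^3^3 \<Rightarrow> complex^3^3" where
  "ungauge u = rescale (\<chi> i. inverse (gauge u $ i))"

lemma ungauge_rescale: "ungauge u (rescale (gauge u) A) = A"
  unfolding ungauge_def by (rule rescale_inverse[OF gauge_nz])

lemma rescale_ungauge: "rescale (gauge u) (ungauge u A) = A"
  using rescale_inverse[of "\<chi> i. inverse (gauge u $ i)" A] gauge_nz[of u]
  by (simp add: ungauge_def)

lemma ungauge_nth: "ungauge u A $ i $ j = exp (L u * - (\<theta> $ i - \<theta> $ j)) * A $ i $ j"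
  by (simp add: ungauge_def rescale_def gauge_def exp_minus exp_diff field_simps)

lemma lift_Omega_eq: "lift_Omega \<theta> D L W = restrict (\<lambda>u. rescale (gauge u) (W (x_of u))) D"
  unfolding lift_Omega_def
  by (rule restrict_ext) (simp add: vec_eq_iff diagonal_conj_nth rescale_def gauge_def exp_minus divide_inverse)

lemma cderiv_gauge:
  assumes u: "u \<in> D"
  shows "cderiv (\<lambda>u. exp (L u * c)) (\<lambda>h. exp (L u * c) * c * ((h$3 - h$1) / (u$3 - u$1))) u"
  by (rule cderiv_compose[OF cderiv_L[OF u]]) (auto intro!: derivative_eq_intros)

definition V_equation :: "(complex^3 \<Rightarrow> complex^3^3) \<Rightarrow> complex^3 \<Rightarrow> bool" where
  "V_equation V u \<longleftrightarrow> (\<forall>k. partial_matrix k V u = commutator (V_sub k u (V u)) (V u))"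

text \<open>Removal of the gauge factor cancels the term with
  \<open>\<theta> $ i - \<theta> $ j\<close> in \<open>commutator_V_sub\<close>. The three partial
  equations are then the values on the basis vectors of one complex-linear identity, which is the
  chain rule for a function of \<open>x\<close> alone.\<close>

lemma V_equation_iff:
  assumes u: "u \<in> D" and V: "\<And>i j. \<exists>f'. cderiv (\<lambda>u. V u $ i $ j) f' u"
    and diag: "\<And>i. V u $ i $ i = - \<theta> $ i"
  shows "V_equation V u \<longleftrightarrow> (\<forall>i j. cderiv (\<lambda>u. ungauge u (V u) $ i $ j)
     (\<lambda>h. x_deriv u h * commutator (ungauge u (V u)) (Omega_hat (x_of u) (ungauge u (V u))) $ i $ j) u)"
proof -
  obtain f' where f': "\<And>i j. cderiv (\<lambda>u. V u $ i $ j) (f' i j) u" using V by metis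
  let ?K = "\<lambda>i j. commutator (V u) (Omega_hat (x_of u) (V u)) $ i $ j"
  let ?e = "\<lambda>i j. exp (L u * - (\<theta> $ i - \<theta> $ j))"
  let ?dL = "\<lambda>h. (h$3 - h$1) / (u$3 - u$1)"
  define g where "g = (\<lambda>i j h. ?e i j * f' i j h + ?e i j * - (\<theta> $ i - \<theta> $ j) * ?dL h * V u $ i $ j)"
  have g: "cderiv (\<lambda>u. ungauge u (V u) $ i $ j) (g i j) u" for i j
    unfolding g_def ungauge_nth by (rule cderiv_mult[OF cderiv_gauge[OF u] f'])
  have g_eq: "g i j h = ?e i j * (f' i j h - (\<theta> $ i - \<theta> $ j) * ?dL h * V u $ i $ j)" for i j h
    unfolding g_def by algebra
  have K: "commutator (ungauge u (V u)) (Omega_hat (x_of u) (ungauge u (V u))) $ i $ j = ?e i j * ?K i j" for i j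
  proof -
    have "?e i j * ?K i j = ungauge u (commutator (V u) (Omega_hat (x_of u) (V u))) $ i $ j"
      by (simp only: ungauge_nth)
    thus ?thesis unfolding ungauge_def by (subst commutator_Omega_hat_rescale) (simp_all add: gauge_nz)
  qed
  have xl: "x_deriv u h = h$1 * x_deriv u (axis 1 1) + h$2 * x_deriv u (axis 2 1) + h$3 * x_deriv u (axis 3 1)" for h
    by (rule cderiv_components[OF cderiv_x_of[OF D_nz(2)[OF u]]])
  have "V_equation V u \<longleftrightarrow> (\<forall>k i j. f' i j (axis k 1) = (\<theta> $ i - \<theta> $ j) * ?dL (axis k 1) * V u $ i $ j
      + x_deriv u (axis k 1) * ?K i j)"
    unfolding V_equation_def vec_eq_iff commutator_V_sub[OF domain(4)[OF u] diag]
    by (simp add: partial_matrix_def cderiv_partial[OF f'])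
  also have "\<dots> \<longleftrightarrow> (\<forall>k i j. g i j (axis k 1) = x_deriv u (axis k 1) * (?e i j * ?K i j))"
  proof -
    have "a = b + c \<longleftrightarrow> exp z * (a - b) = exp z * c" for a b c z :: complex by auto
    thus ?thesis unfolding g_eq by (simp only: mult.left_commute[of "x_deriv _ _" "exp _"])
  qed
  also have "\<dots> \<longleftrightarrow> (\<forall>i j. g i j = (\<lambda>h. x_deriv u h * (?e i j * ?K i j)))"
  proof
    assume *: "\<forall>k i j. g i j (axis k 1) = x_deriv u (axis k 1) * (?e i j * ?K i j)"
    show "\<forall>i j. g i j = (\<lambda>h. x_deriv u h * (?e i j * ?K i j))"
    proof (intro allI ext)
      fix i j h
      show "g i j h = x_deriv u h * (?e i j * ?K i j)"
        unfolding cderiv_components[OF g, of i j h] xl[of h] using * by (simp add: algebra_simps)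
    qed
  qed auto
  also have "\<dots> \<longleftrightarrow> (\<forall>i j. cderiv (\<lambda>u. ungauge u (V u) $ i $ j) (\<lambda>h. x_deriv u h * (?e i j * ?K i j)) u)"
    using g cderiv_unique[OF g] by (auto dest: sym) 
  finally show ?thesis unfolding K .
qed

lemma V_solutions_iff:
  "V \<in> V_solutions \<theta> \<theta>inf D \<longleftrightarrow> V \<in> extensional D \<and> (\<forall>u\<in>D. \<forall>i j. \<exists>f'. cderiv (\<lambda>u. V u $ i $ j) f' u)
     \<and> (\<forall>u\<in>D. V_equation V u) \<and> (\<forall>u\<in>D. constraints \<theta> \<theta>inf (V u))"
proof -
  have "V_regular_on D V \<longleftrightarrow> (\<forall>u\<in>D. \<forall>i j. \<exists>f'. cderiv (\<lambda>u. V u $ i $ j) f' u)"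
    using domain(4) unfolding V_regular_on_def holomorphic3_on_iff distinct_entries_def by blast
  thus ?thesis using domain(4) unfolding V_solutions_def V_equation_def by blast
qed

lemma cderiv_restrict:
  assumes "u \<in> D" "cderiv (\<lambda>u. G u $ i $ j) f' u"
  shows "cderiv (\<lambda>u. restrict G D u $ i $ j) f' u"
  using assms(2) by (rule cderiv_transform) (use ev_D[OF assms(1)] in \<open>auto elim!: eventually_mono\<close>)

lemma lift_Omega_solution:
  assumes W: "W \<in> Omega_solutions \<theta> \<theta>inf X"
  shows "lift_Omega \<theta> D L W \<in> V_solutions \<theta> \<theta>inf D"
  unfolding V_solutions_iff
proof (intro conjI ballI allI)
  let ?V = "lift_Omega \<theta> D L W"
  show "?V \<in> extensional D" by (simp add: lift_Omega_def)
  fix u assume u: "u \<in> D"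
  show c: "constraints \<theta> \<theta>inf (?V u)"
    using u Omega_solutionsD(3)[OF W x_of_D[OF u]] by (simp add: lift_Omega_eq constraints_rescale[OF gauge_nz])
  have Wc: "cderiv (\<lambda>u. W (x_of u) $ i $ j)
     (\<lambda>h. commutator (W (x_of u)) (Omega_hat (x_of u) (W (x_of u))) $ i $ j * x_deriv u h) u" for i j
    by (rule cderiv_compose[OF cderiv_x_of[OF D_nz(2)[OF u]] Omega_solutionsD(2)[OF W x_of_D[OF u]]])
  show d: "\<exists>f'. cderiv (\<lambda>u. ?V u $ i $ j) f' u" for i j
    unfolding lift_Omega_eq
    by (rule exI, rule cderiv_restrict[OF u], unfold rescale_def vec_lambda_beta)
      (simp only: times_divide_eq_left[symmetric] gauge_quotient, rule cderiv_mult[OF cderiv_gauge[OF u] Wc])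
  have ug: "ungauge v (?V v) = W (x_of v)" if "v \<in> D" for v
    using that by (simp add: lift_Omega_eq ungauge_rescale)
  have "cderiv (\<lambda>u. ungauge u (?V u) $ i $ j) (\<lambda>h. commutator (W (x_of u)) (Omega_hat (x_of u) (W (x_of u))) $ i $ j * x_deriv u h) u" for i j
    using Wc by (rule cderiv_transform) (use ev_D[OF u] ug in \<open>auto elim!: eventually_mono\<close>)
  thus "V_equation ?V u"
    using V_equation_iff[of u ?V, OF u d] c by (simp add: ug[OF u] mult.commute constraints_def)
qed

lemma lift_Omega_inj:
  assumes "W \<in> extensional X" "W' \<in> extensional X" "lift_Omega \<theta> D L W = lift_Omega \<theta> D L W'"
  shows "W = W'"
proof (rule extensionalityI[OF assms(1,2)])
  fix x assume "x \<in> X"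
  then obtain u where u: "u \<in> D" "x = x_of u" using domain(5) by blast
  have "rescale (gauge u) (W x) = rescale (gauge u) (W' x)"
    using fun_cong[OF assms(3), of u] u by (simp add: lift_Omega_eq)
  thus "W x = W' x" by (metis ungauge_rescale)
qed

text \<open>The differential of the ungauged solution is a multiple of \<open>x_deriv\<close>, hence
  zero along fibres of \<open>x_of\<close>. Inside a ball a fibre is part of a linear subspace, so
  the solution is constant there; connectedness of the fibre gives the global statement.\<close>

lemma ungauge_constant_on_fibre:
  assumes V: "V \<in> V_solutions \<theta> \<theta>inf D" and u: "u \<in> D" "v \<in> D" "x_of u = x_of v"
  shows "ungauge u (V u) = ungauge v (V v)"
proof -
  let ?F = "{w\<in>D. x_of w = x_of u}"
  let ?G = "\<lambda>u. ungauge u (V u)"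
  note Vs = V[unfolded V_solutions_iff]
  have dG: "cderiv (\<lambda>u. ?G u $ i $ j) (\<lambda>h. x_deriv w h * commutator (?G w) (Omega_hat (x_of w) (?G w)) $ i $ j) w"
    if "w \<in> D" for w i j
    using V_equation_iff[OF that, of V] Vs that by (simp add: constraints_def)
  have loc: "\<forall>\<^sub>F w in at a within ?F. ?G a = ?G w" if a: "a \<in> ?F" for a
  proof -
    obtain e where e: "e > 0" "ball a e \<subseteq> D" using domain(1) a openE by blast
    have G: "?G a = ?G w" if w: "w \<in> ball a e" "w \<in> ?F" for w
    proof (subst vec_eq_iff, intro allI, subst vec_eq_iff, intro allI)
      fix i j
      define h where "h = w - a"
      define S where "S = {z::complex. a + z *s h \<in> ball a e}"
      have "convex S" unfolding S_def by (rule convex_line_preimage[OF convex_ball])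
      moreover have "((\<lambda>z. ?G (a + z *s h) $ i $ j) has_field_derivative 0) (at z within S)" if "z \<in> S" for z
      proof -
        let ?p = "a + z *s h"
        have p: "?p \<in> D" using that e by (auto simp: S_def)
        \<comment> \<open>Points of the fibre satisfy a linear equation with coefficient
          \<open>x_of u\<close>, and so does their difference \<open>h\<close>. The line through
          \<open>a\<close> in direction \<open>h\<close> stays in the fibre, and
          \<open>x_deriv\<close> annihilates its direction.\<close>
        have ha: "a$2 - a$1 = x_of u * (a$3 - a$1)" "w$2 - w$1 = x_of u * (w$3 - w$1)"
          using a w D_nz[of a] D_nz[of w] by (auto simp: x_of_def field_simps)
        moreover have "h$2 - h$1 = (w$2 - w$1) - (a$2 - a$1)" "h$3 - h$1 = (w$3 - w$1) - (a$3 - a$1)"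
          by (simp_all add: h_def)
        ultimately have h: "h$2 - h$1 = x_of u * (h$3 - h$1)" by (simp only: right_diff_distrib)
        have "?p$2 - ?p$1 = (a$2 - a$1) + z * (h$2 - h$1)" "?p$3 - ?p$1 = (a$3 - a$1) + z * (h$3 - h$1)"
          by (simp_all add: algebra_simps)
        hence "?p$2 - ?p$1 = x_of u * (?p$3 - ?p$1)" using h ha(1) by (simp add: algebra_simps)
        hence "x_of ?p = x_of u" using D_nz(1)[OF p] by (simp add: x_of_def[of ?p])
        hence "x_deriv ?p h = 0" using h by (simp add: x_deriv_def)
        with cderiv_line[OF dG[OF p, of i j]] show ?thesis
          by (simp add: has_field_derivative_at_within)
      qed
      ultimately have "\<exists>c. \<forall>z\<in>S. ?G (a + z *s h) $ i $ j = c"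
        by (rule has_field_derivative_zero_constant)
      then obtain c where c: "\<forall>z\<in>S. ?G (a + z *s h) $ i $ j = c" by blast
      have "0 \<in> S" "1 \<in> S" using e w by (auto simp: S_def h_def)
      from bspec[OF c this(1)] bspec[OF c this(2)] show "?G a $ i $ j = ?G w $ i $ j" by (simp add: h_def)
    qed
    show ?thesis unfolding eventually_at
    proof (intro exI[of _ e] conjI ballI impI e(1))
      fix w assume "w \<in> ?F" "w \<noteq> a \<and> dist w a < e"
      thus "?G a = ?G w" by (intro G) (simp_all add: dist_commute)
    qed
  qed
  show ?thesis
    by (rule connected_local_const[of ?F u v]) (use u loc domain(6)[OF x_of_D[OF u(1)]] in auto)
qed

lemma V_solution_is_lift:
  assumes V: "V \<in> V_solutions \<theta> \<theta>inf D"
  obtains W where "W \<in> Omega_solutions \<theta> \<theta>inf X" "V = lift_Omega \<theta> D L W"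
proof -
  let ?G = "\<lambda>u. ungauge u (V u)"
  note Vs = V[unfolded V_solutions_iff]
  have dG: "cderiv (\<lambda>u. ?G u $ i $ j) (\<lambda>h. x_deriv w h * commutator (?G w) (Omega_hat (x_of w) (?G w)) $ i $ j) w"
    if "w \<in> D" for w i j
    using V_equation_iff[OF that, of V] Vs that by (simp add: constraints_def)
  \<comment> \<open>The choice of a point in the fibre is immaterial by
    \<open>ungauge_constant_on_fibre\<close>.\<close>
  define W where "W = restrict (\<lambda>x. ?G (SOME u. u \<in> D \<and> x_of u = x)) X"
  have WG: "W (x_of u) = ?G u" if u: "u \<in> D" for u
  proof -
    have "(SOME v. v \<in> D \<and> x_of v = x_of u) \<in> D \<and> x_of (SOME v. v \<in> D \<and> x_of v = x_of u) = x_of u"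
      by (rule someI[of _ u]) (use u in simp)
    thus ?thesis using ungauge_constant_on_fibre[OF V _ u] x_of_D[OF u] by (simp add: W_def)
  qed
  have "W \<in> Omega_solutions \<theta> \<theta>inf X" unfolding Omega_solutions_def
  proof (intro CollectI conjI ballI allI)
    show "W \<in> extensional X" by (simp add: W_def)
    fix x assume "x \<in> X"
    then obtain u where u: "u \<in> D" "x = x_of u" using domain(5) by blast
    show "constraints \<theta> \<theta>inf (W x)"
      using Vs u gauge_nz by (simp add: WG u(2) ungauge_def constraints_rescale)
    fix i j
    \<comment> \<open>Moving the second coordinate by \<open>z * (u$3 - u$1)\<close> shifts
      \<open>x\<close> by exactly \<open>z\<close>: a slice transverse to the fibres, parametrised
      by \<open>x\<close>.\<close>
    define h where "h = (u$3 - u$1) *s (axis 2 1 :: complex^3)"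
    have hn: "h $ 1 = 0" "h $ 2 = u$3 - u$1" "h $ 3 = 0" by (simp_all add: h_def axis_def)
    have nz: "u$3 - u$1 \<noteq> 0" using D_nz[OF u(1)] by simp
    have p: "x_of (u + z *s h) = x + z" for z
      using nz by (simp add: x_of_def hn u(2) field_simps)
    have "((\<lambda>z. ?G (u + z *s h) $ i $ j) has_field_derivative x_deriv u h * commutator (?G u) (Omega_hat (x_of u) (?G u)) $ i $ j) (at 0)"
      by (rule cderiv_line) (use dG[OF u(1)] in simp)
    moreover have "x_deriv u h = 1" using nz by (simp add: x_deriv_def hn)
    ultimately have dz: "((\<lambda>z. ?G (u + z *s h) $ i $ j) has_field_derivative commutator (W x) (Omega_hat x (W x)) $ i $ j) (at 0)"
      by (simp add: WG[OF u(1)] u(2))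
    have ev: "\<forall>\<^sub>F z in nhds 0. ?G (u + z *s h) $ i $ j = W (x + z) $ i $ j"
    proof -
      have "isCont (\<lambda>z. u + z *s h) 0"
        by (rule has_derivative_continuous[OF has_derivative_line])
      from isCont_tendsto_nhds[OF this] have "filterlim (\<lambda>z. u + z *s h) (nhds u) (nhds 0)" by simp
      from eventually_compose_filterlim[OF ev_D[OF u(1)] this]
      show ?thesis by eventually_elim (simp add: WG p flip: p)
    qed
    have "((\<lambda>z. W (x + z) $ i $ j) has_field_derivative commutator (W x) (Omega_hat x (W x)) $ i $ j) (at 0)"
      using dz unfolding DERIV_cong_ev[OF refl ev refl] .
    thus "((\<lambda>t. W t $ i $ j) has_field_derivative commutator (W x) (Omega_hat x (W x)) $ i $ j) (at x)"
      using DERIV_shift[of "\<lambda>t. W t $ i $ j" _ 0 x] by (simp add: add.commute)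
  qed
  moreover have "V = lift_Omega \<theta> D L W"
    by (rule extensionalityI[of _ D]) (use Vs in \<open>simp_all add: lift_Omega_eq WG rescale_ungauge\<close>)
  ultimately show ?thesis using that by blast
qed

theorem lift_Omega_bij: "bij_betw (lift_Omega \<theta> D L) (Omega_solutions \<theta> \<theta>inf X) (V_solutions \<theta> \<theta>inf D)"
proof (rule bij_betw_imageI)
  show "inj_on (lift_Omega \<theta> D L) (Omega_solutions \<theta> \<theta>inf X)"
    by (rule inj_onI) (use lift_Omega_inj Omega_solutionsD(1) in blast)
  show "lift_Omega \<theta> D L ` Omega_solutions \<theta> \<theta>inf X = V_solutions \<theta> \<theta>inf D"
    using lift_Omega_solution V_solution_is_lift by blast
qed

lemma lift_Omega_solution_iff:
  assumes "W \<in> extensional X"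
  shows "lift_Omega \<theta> D L W \<in> V_solutions \<theta> \<theta>inf D \<longleftrightarrow> W \<in> Omega_solutions \<theta> \<theta>inf X"
  using lift_Omega_solution V_solution_is_lift lift_Omega_inj[OF assms] Omega_solutionsD(1) by metis

text \<open>The products \<open>l $ i * r $ i\<close> sum to zero, so their sum weighted by
  \<open>u\<close> is invariant under translation of \<open>u\<close> and scales with
  \<open>u$3 - u$1\<close>.\<close>

lemma formulae_defined_x_of:
  assumes u: "u \<in> D"
  shows "formulae_defined \<theta> \<theta>inf u A \<longleftrightarrow> formulae_defined \<theta> \<theta>inf (vector [0, x_of u, 1]) A"
proof -
  have eq: "(\<Sum>i\<in>UNIV. u $ i * (l $ i * r $ i)) = (u$3 - u$1) * (x_of u * (l$2 * r$2) + l$3 * r$3)"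
    if "A *v r = \<mu>m *s r" "l v* A = \<mu>p *s l" for l r
  proof -
    have "l$1 * r$1 = - (l$2 * r$2) - l$3 * r$3" using left_right_orthogonal[OF that] by algebra
    moreover have "(u$3 - u$1) * x_of u = u$2 - u$1" using D_nz[OF u] by (simp add: x_of_def)
    ultimately show ?thesis by (simp add: sum_3) algebra
  qed
  have "formulae_defined \<theta> \<theta>inf u A \<longleftrightarrow> (\<exists>l r. l v* A = \<mu>p *s l \<and> A *v r = \<mu>m *s r \<and>
        (\<forall>i. l $ i * r $ i \<noteq> 0) \<and> x_of u * (l$2 * r$2) + l$3 * r$3 \<noteq> 0)"
    unfolding formulae_defined_def by (intro ex_cong1 conj_cong refl) (use eq D_nz(1)[OF u] in simp)
  thus ?thesis unfolding formulae_defined_normalized .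
qed

lemma lift_Omega_defined:
  "lift_Omega \<theta> D L ` Omega_solutions_def_on \<theta> \<theta>inf X = V_solutions_def_on \<theta> \<theta>inf D"
proof -
  have key: "(\<forall>u\<in>D. formulae_defined \<theta> \<theta>inf u (lift_Omega \<theta> D L W u)) \<longleftrightarrow>
     (\<forall>x\<in>X. formulae_defined \<theta> \<theta>inf (vector [0, x, 1]) (W x))" for W
    unfolding domain(5)[symmetric]
    by (simp add: lift_Omega_eq formulae_defined_rescale[OF gauge_nz] formulae_defined_x_of)
  have image: "f ` {W\<in>S. P W} = {V\<in>f ` S. Q V}" if "\<And>W. Q (f W) \<longleftrightarrow> P W"
    for f :: "(complex \<Rightarrow> complex^3^3) \<Rightarrow> complex^3 \<Rightarrow> complex^3^3" and S P Q
    using that by auto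
  show ?thesis
    unfolding Omega_solutions_def_on_def V_solutions_def_on_def
      bij_betw_imp_surj_on[OF lift_Omega_bij, symmetric] by (rule image) (rule key)
qed

lemma conj_class_lift: "conj_class D (lift_Omega \<theta> D L W) = lift_Omega \<theta> D L ` conj_class X W"
proof -
  let ?c = "\<lambda>c1 c2. vector [c1, c2, 1] :: complex^3"
  have eq: "restrict (\<lambda>u. \<chi> i j. ?c c1 c2 $ i * lift_Omega \<theta> D L W u $ i $ j / ?c c1 c2 $ j) D
    = lift_Omega \<theta> D L (restrict (\<lambda>x. \<chi> i j. ?c c1 c2 $ i * W x $ i $ j / ?c c1 c2 $ j) X)" for c1 c2
    unfolding lift_Omega_eq by (rule restrict_ext) (simp add: x_of_D vec_eq_iff rescale_def mult_ac)
  show ?thesis unfolding conj_class_eq eq by auto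
qed

theorem lift_Omega_family_bij:
  "bij_betw (\<lambda>y. lift_Omega \<theta> D L ` Omega_family \<theta> \<theta>inf X y) (PVI_solutions \<theta> \<theta>inf X)
     (conj_class D ` V_solutions_def_on \<theta> \<theta>inf D)"
proof -
  have ext: "conj_class X W \<subseteq> extensional X" for W by (auto simp: conj_class_def)
  \<comment> \<open>Classes consist of extensional functions, on which \<open>lift_Omega\<close> is
    injective; hence so is its action on classes.\<close>
  have "inj_on ((`) (lift_Omega \<theta> D L)) (conj_class X ` Omega_solutions_def_on \<theta> \<theta>inf X)"
  proof (rule inj_onI)
    fix A B assume "A \<in> conj_class X ` Omega_solutions_def_on \<theta> \<theta>inf X"
      "B \<in> conj_class X ` Omega_solutions_def_on \<theta> \<theta>inf X" and eq: "lift_Omega \<theta> D L ` A = lift_Omega \<theta> D L ` B"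
    hence "A \<subseteq> extensional X" "B \<subseteq> extensional X" using ext by blast+
    moreover have "inj_on (lift_Omega \<theta> D L) (extensional X)"
      by (rule inj_onI) (rule lift_Omega_inj)
    ultimately show "A = B" using eq by (meson inj_on_image_eq_iff)
  qed
  hence "bij_betw ((`) (lift_Omega \<theta> D L)) (conj_class X ` Omega_solutions_def_on \<theta> \<theta>inf X)
      (conj_class D ` V_solutions_def_on \<theta> \<theta>inf D)"
    unfolding bij_betw_def lift_Omega_defined[symmetric] by (simp add: image_image conj_class_lift)
  from bij_betw_trans[OF Omega_family_bij this] show ?thesis by (simp add: comp_def)
qed

end

section \<open>Analytic continuation\<close>

lemma norm_vec_smult: "norm (z *s h) = cmod z * norm h" for h :: "complex^'n"
  by (simp add: norm_vec_def L2_set_def norm_mult power_mult_distrib sum_distrib_left[symmetric] real_sqrt_mult)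

lemma open_line_preimage:
  fixes h :: "complex^'n"
  assumes "open B"
  shows "open {z. v + z *s h \<in> B}"
proof -
  have "continuous_on UNIV (\<lambda>z. v + z *s h)"
    using has_derivative_continuous[OF has_derivative_line] continuous_at_imp_continuous_on by blast
  from open_vimage[OF assms this] show ?thesis by (simp add: vimage_def)
qed

text \<open>Holomorphy along complex lines is all that the identity theorem below uses, and ring
  operations preserve it. Every argument then reduces to functions of one variable.\<close>

definition line_holomorphic_on :: "(complex^'n \<Rightarrow> complex) \<Rightarrow> (complex^'n) set \<Rightarrow> bool" where
  "line_holomorphic_on f E \<longleftrightarrow> (\<forall>v h. (\<lambda>z. f (v + z *s h)) holomorphic_on {z. v + z *s h \<in> E})"

lemma line_holomorphic_on_const: "line_holomorphic_on (\<lambda>u. c) E"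
  and line_holomorphic_on_nth: "line_holomorphic_on (\<lambda>u. u $ i) E"
  and line_holomorphic_on_diff: "line_holomorphic_on f E \<Longrightarrow> line_holomorphic_on g E \<Longrightarrow> line_holomorphic_on (\<lambda>u. f u - g u) E"
  and line_holomorphic_on_add: "line_holomorphic_on f E \<Longrightarrow> line_holomorphic_on g E \<Longrightarrow> line_holomorphic_on (\<lambda>u. f u + g u) E"
  and line_holomorphic_on_minus: "line_holomorphic_on f E \<Longrightarrow> line_holomorphic_on (\<lambda>u. - f u) E"
  and line_holomorphic_on_mult: "line_holomorphic_on f E \<Longrightarrow> line_holomorphic_on g E \<Longrightarrow> line_holomorphic_on (\<lambda>u. f u * g u) E"
  unfolding line_holomorphic_on_def by (auto intro!: holomorphic_intros)

lemmas line_holomorphic_intros = line_holomorphic_on_const line_holomorphic_on_nth line_holomorphic_on_diff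
  line_holomorphic_on_add line_holomorphic_on_minus line_holomorphic_on_mult

lemma holomorphic3_imp_line_holomorphic:
  assumes "open E" "holomorphic3_on f E"
  shows "line_holomorphic_on f E"
  unfolding line_holomorphic_on_def
proof (intro allI)
  fix v h
  show "(\<lambda>z. f (v + z *s h)) holomorphic_on {z. v + z *s h \<in> E}"
    unfolding holomorphic_on_open[OF open_line_preimage[OF assms(1)]]
    using assms(2) cderiv_line unfolding holomorphic3_on_iff by blast
qed

text \<open>\<open>p\<close> and \<open>w\<close> lie on a complex line whose parameters inside the
  ball form a convex set, so the identity theorem in one variable carries the zeros near
  \<open>w\<close> to \<open>p\<close>.\<close>

lemma line_holomorphic_ball_eq_0:
  assumes f: "line_holomorphic_on f E" and B: "ball u e \<subseteq> E"
    and w: "w \<in> ball u e" and U: "open U" "w \<in> U" "\<And>v. v \<in> U \<Longrightarrow> f v = 0" and p: "p \<in> ball u e"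
  shows "f p = 0"
proof -
  define h where "h = p - w"
  define S where "S = {z. w + z *s h \<in> ball u e}"
  define T where "T = {z. w + z *s h \<in> ball u e \<inter> U}"
  have "f (w + 1 *s h) = 0"
  proof (rule analytic_continuation_open[of T S "\<lambda>z. f (w + z *s h)" "\<lambda>_. 0"])
    show "open T" "open S" unfolding T_def S_def using U(1) by (intro open_line_preimage open_Int open_ball; assumption)+
    show "connected S" unfolding S_def by (intro convex_connected convex_line_preimage convex_ball)
    have "0 \<in> T" using w U(2) by (simp add: T_def)
    thus "T \<noteq> {}" by blast
    show "T \<subseteq> S" by (auto simp: T_def S_def)
    show "(\<lambda>z. f (w + z *s h)) holomorphic_on S"
      using f B unfolding line_holomorphic_on_def S_def by (meson Collect_mono holomorphic_on_subset subsetD)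
    show "f (w + z *s h) = 0" if "z \<in> T" for z using that U(3) by (simp add: T_def)
    show "1 \<in> S" using p by (simp add: S_def h_def)
  qed simp
  thus ?thesis by (simp add: h_def)
qed

text \<open>The interior of the zero set is open, and a ball in \<open>E\<close> that meets it lies
  inside it. Hence its complement in \<open>E\<close> is open as well, and connectedness
  decides.\<close>

lemma line_holomorphic_identity:
  assumes f: "line_holomorphic_on f E" and E: "open E" "connected E"
    and U: "open U" "U \<noteq> {}" "U \<subseteq> E" "\<And>v. v \<in> U \<Longrightarrow> f v = 0" and u: "u \<in> E"
  shows "f u = 0"
proof -
  define Z where "Z = interior {u\<in>E. f u = 0}"
  have Z: "open Z" "Z \<subseteq> E" "\<And>v. v \<in> Z \<Longrightarrow> f v = 0" unfolding Z_def using interior_subset by auto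
  have "U \<subseteq> Z" unfolding Z_def using U by (intro interior_maximal) auto
  have "open (E - Z)"
  proof (subst open_contains_ball, intro ballI)
    fix a assume a: "a \<in> E - Z"
    then obtain e where e: "e > 0" "ball a e \<subseteq> E" using E(1) openE by blast
    have "w \<notin> Z" if w: "w \<in> ball a e" for w
    proof
      assume "w \<in> Z"
      hence "f p = 0" if "p \<in> ball a e" for p
        using line_holomorphic_ball_eq_0[OF f e(2) w Z(1) _ Z(3) that] by blast
      hence "ball a e \<subseteq> Z" unfolding Z_def using e(2) by (intro interior_maximal) auto
      thus False using a e(1) centre_in_ball by blast
    qed
    thus "\<exists>e>0. ball a e \<subseteq> E - Z" using e by blast
  qed
  moreover have "Z \<inter> E \<noteq> {}" using \<open>U \<subseteq> Z\<close> U(2,3) by blast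
  ultimately have "(E - Z) \<inter> E = {}"
    using connectedD[OF E(2) Z(1), of "E - Z"] by blast
  thus ?thesis using u Z(3) by blast
qed

text \<open>Taylor's formula to first order, with Cauchy's bound
  \<open>fact 2 * M / \<rho>^2\<close> for the second derivative. The radius
  \<open>3 * \<rho>\<close> leaves room for closed discs of radius \<open>\<rho>\<close> about all
  points of \<open>ball 0 \<rho>\<close>.\<close>

lemma second_order_bound:
  assumes hol: "\<phi> holomorphic_on ball 0 (3 * \<rho>)" and M: "\<And>s. s \<in> ball 0 (3 * \<rho>) \<Longrightarrow> cmod (\<phi> s) \<le> M"
    and \<rho>: "\<rho> > 0" and s: "s \<in> ball 0 \<rho>"
  shows "cmod (\<phi> s - \<phi> 0 - deriv \<phi> 0 * s) \<le> 2 * M / \<rho>^2 * cmod s ^ 2"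
proof -
  have sub: "cball w \<rho> \<subseteq> ball 0 (3 * \<rho>)" if "w \<in> ball 0 \<rho>" for w :: complex
  proof
    fix x assume "x \<in> cball w \<rho>"
    hence "norm (x - w) \<le> \<rho>" by (simp add: dist_norm norm_minus_commute)
    hence "norm x < 3 * \<rho>" using that norm_triangle_sub[of x w] \<rho> by simp
    thus "x \<in> ball 0 (3 * \<rho>)" by simp
  qed
  have "cmod ((\<lambda>i. (deriv ^^ i) \<phi>) 0 s - (\<Sum>i\<le>1. (deriv ^^ i) \<phi> 0 * (s - 0)^i / fact i))
      \<le> (2 * M / \<rho>^2) * cmod (s - 0) ^ Suc 1 / fact 1"
  proof (rule complex_Taylor[of "ball 0 \<rho>"])
    fix i x assume x: "x \<in> ball (0::complex) \<rho>"
    have "((deriv ^^ i) \<phi> has_field_derivative deriv ((deriv ^^ i) \<phi>) x) (at x)"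
      by (rule holomorphic_derivI[OF holomorphic_higher_deriv[OF hol open_ball] open_ball])
        (use subsetD[OF sub[OF x], of x] \<rho> in simp)
    thus "((deriv ^^ i) \<phi> has_field_derivative (deriv ^^ Suc i) \<phi> x) (at x within ball 0 \<rho>)"
      by (simp add: has_field_derivative_at_within)
  next
    fix x assume x: "x \<in> ball (0::complex) \<rho>"
    have "norm ((deriv ^^ 2) \<phi> x) \<le> fact 2 * M / \<rho> ^ 2"
    proof (rule Cauchy_inequality)
      have hc: "\<phi> holomorphic_on cball x \<rho>" using holomorphic_on_subset[OF hol sub[OF x]] .
      show "\<phi> holomorphic_on ball x \<rho>" using holomorphic_on_subset[OF hc ball_subset_cball] .
      show "continuous_on (cball x \<rho>) \<phi>" using hc by (rule holomorphic_on_imp_continuous_on)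
      show "norm (\<phi> y) \<le> M" if "norm (x - y) = \<rho>" for y
        using that sub[OF x] by (intro M) (auto simp: dist_norm)
    qed (rule \<rho>)
    thus "cmod ((deriv ^^ Suc 1) \<phi> x) \<le> 2 * M / \<rho>^2" by (simp add: numeral_2_eq_2)
  qed (use s \<rho> in auto)
  thus ?thesis by (simp add: diff_diff_eq power2_eq_square)
qed

text \<open>The difference quotients converge locally uniformly, because the second derivatives are
  locally bounded by Cauchy's inequality.\<close>

lemma partial_line_holomorphic:
  assumes E: "open E" and f: "holomorphic3_on f E"
  shows "line_holomorphic_on (partial k f) E"
  unfolding line_holomorphic_on_def
proof (intro allI)
  fix v h :: "complex^3"
  define e :: "complex^3" where "e = axis k 1"
  have e1: "norm e = 1" by (simp add: e_def norm_axis_1)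
  let ?S = "{z. v + z *s h \<in> E}"
  define g where "g = (\<lambda>z. partial k f (v + z *s h))"
  have "g field_differentiable (at z0)" if z0: "z0 \<in> ?S" for z0
  proof -
    define p0 where "p0 = v + z0 *s h"
    obtain \<epsilon> where \<epsilon>: "\<epsilon> > 0" "cball p0 \<epsilon> \<subseteq> E" using E z0 open_contains_cball unfolding p0_def by blast
    have "continuous_on (cball p0 \<epsilon>) f"
    proof (rule continuous_at_imp_continuous_on, intro ballI)
      fix p assume "p \<in> cball p0 \<epsilon>"
      thus "isCont f p" using f \<epsilon>(2) has_derivative_continuous unfolding holomorphic3_on_def by blast
    qed
    hence "bounded (f ` cball p0 \<epsilon>)" by (intro compact_imp_bounded compact_continuous_image compact_cball)
    then obtain M where M: "\<And>p. p \<in> cball p0 \<epsilon> \<Longrightarrow> cmod (f p) \<le> M" unfolding bounded_iff by blast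
    \<comment> \<open>Moving \<open>z\<close> by less than \<open>\<rho>\<close> along
      \<open>h\<close> and then by less than \<open>3 * \<rho>\<close> along \<open>e\<close> stays
      in the ball of radius \<open>\<epsilon>\<close>.\<close>
    define \<rho> where "\<rho> = \<epsilon> / (norm h + 3)"
    have nh: "norm h + 3 > 0" using norm_ge_zero[of h] by linarith
    have \<rho>: "\<rho> > 0" using \<epsilon>(1) nh by (simp add: \<rho>_def)
    have "\<rho> * (norm h + 3) = \<epsilon>" using nh by (simp add: \<rho>_def)
    hence \<rho>\<epsilon>: "\<rho> * norm h + 3 * \<rho> = \<epsilon>" by (simp add: algebra_simps)
    have inE: "v + z *s h + s *s e \<in> cball p0 \<epsilon>" if "z \<in> ball z0 \<rho>" "s \<in> ball 0 (3 * \<rho>)" for z s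
    proof -
      have "v + z *s h + s *s e - p0 = (z - z0) *s h + s *s e" by (simp add: p0_def vec_eq_iff algebra_simps)
      hence "norm (v + z *s h + s *s e - p0) \<le> norm ((z - z0) *s h) + norm (s *s e)"
        by (simp only: norm_triangle_ineq)
      also have "\<dots> = cmod (z - z0) * norm h + cmod s" by (simp only: norm_vec_smult e1 mult_1_right)
      also have "\<dots> \<le> \<rho> * norm h + 3 * \<rho>"
        using that by (intro add_mono mult_right_mono) (auto simp: dist_norm norm_minus_commute)
      finally show ?thesis unfolding \<rho>\<epsilon> by (simp add: dist_norm norm_minus_commute)
    qed
    \<comment> \<open>Nonzero increments tending to zero; the offset 2 keeps even the first of them
      strictly inside \<open>ball 0 \<rho>\<close>.\<close>
    define s where "s = (\<lambda>n. complex_of_real (\<rho> / real (n + 2)))"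
    have sn: "cmod (s n) = \<rho> / real (n + 2)" "s n \<noteq> 0" for n
      unfolding s_def norm_of_real of_real_eq_0_iff using \<rho> by simp_all
    have s\<rho>: "s n \<in> ball 0 \<rho>" "s n \<in> ball 0 (3 * \<rho>)" for n
    proof -
      have "\<rho> / real (n + 2) < \<rho>" using \<rho> by (simp add: divide_simps)
      thus "s n \<in> ball 0 \<rho>" "s n \<in> ball 0 (3 * \<rho>)" using \<rho> by (simp_all add: sn)
    qed
    define F where "F = (\<lambda>n z. (f (v + z *s h + s n *s e) - f (v + z *s h)) / s n)"
    have line: "(\<lambda>z. f (a + z *s b)) holomorphic_on T" if "open T" "\<And>z. z \<in> T \<Longrightarrow> a + z *s b \<in> E" for a b T
      using holomorphic3_imp_line_holomorphic[OF E f] that unfolding line_holomorphic_on_def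
      by (meson holomorphic_on_subset mem_Collect_eq subsetI)
    have "g holomorphic_on ball z0 \<rho>"
    proof (rule holomorphic_uniform_sequence[of _ F])
      fix n
      have "(\<lambda>z. f (v + s n *s e + z *s h)) holomorphic_on ball z0 \<rho>" "(\<lambda>z. f (v + z *s h)) holomorphic_on ball z0 \<rho>"
        using inE[OF _ s\<rho>(2)[of n]] inE[of _ 0] \<rho> \<epsilon>(2)
        by (intro line open_ball; force simp: algebra_simps)+
      thus "F n holomorphic_on ball z0 \<rho>"
        unfolding F_def using sn(2) by (intro holomorphic_intros) (simp_all add: algebra_simps)
    next
      have bound: "cmod (F n z - g z) \<le> 2 * M / \<rho>^2 * cmod (s n)" if z: "z \<in> ball z0 \<rho>" for n z
      proof -
        define \<phi> where "\<phi> = (\<lambda>t. f (v + z *s h + t *s e))"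
        have "\<phi> holomorphic_on ball 0 (3 * \<rho>)" unfolding \<phi>_def
          using inE[OF z] \<epsilon>(2) by (intro line open_ball) blast
        hence "cmod (\<phi> (s n) - \<phi> 0 - deriv \<phi> 0 * s n) \<le> 2 * M / \<rho>^2 * cmod (s n) ^ 2"
          by (rule second_order_bound[OF _ _ \<rho> s\<rho>(1)]) (use M inE[OF z] in \<open>auto simp: \<phi>_def\<close>)
        moreover have gz: "g z = deriv \<phi> 0" by (simp add: g_def partial_def \<phi>_def e_def)
        moreover have "F n z * s n = \<phi> (s n) - \<phi> 0" using sn(2)[of n] by (simp add: F_def \<phi>_def)
        ultimately have "cmod ((F n z - g z) * s n) \<le> 2 * M / \<rho>^2 * cmod (s n) ^ 2"
          by (simp only: left_diff_distrib)
        hence "cmod (F n z - g z) * cmod (s n) \<le> 2 * M / \<rho>^2 * cmod (s n) * cmod (s n)"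
          by (simp add: norm_mult power2_eq_square mult.assoc)
        thus ?thesis by (rule mult_right_le_imp_le) (use sn(2) in simp)
      qed
      have "(\<lambda>n. 2 * M / \<rho>^2 * (\<rho> * (1 / real (n + 2)))) \<longlonglongrightarrow> 2 * M / \<rho>^2 * (\<rho> * 0)"
        by (intro tendsto_intros LIMSEQ_ignore_initial_segment lim_1_over_n)
      hence lim: "(\<lambda>n. 2 * M / \<rho>^2 * cmod (s n)) \<longlonglongrightarrow> 0" by (simp add: sn)
      have ul: "uniform_limit (ball z0 \<rho>) F g sequentially"
        unfolding uniform_limit_iff
      proof (intro allI impI)
        fix \<eta> :: real assume "\<eta> > 0"
        with lim have "\<forall>\<^sub>F n in sequentially. 2 * M / \<rho>^2 * cmod (s n) < \<eta>" by (rule order_tendstoD(2))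
        thus "\<forall>\<^sub>F n in sequentially. \<forall>z\<in>ball z0 \<rho>. dist (F n z) (g z) < \<eta>"
          by eventually_elim (unfold dist_norm, intro ballI le_less_trans[OF bound])
      qed
      fix x assume "x \<in> ball z0 \<rho>"
      then obtain d where "d > 0" "cball x d \<subseteq> ball z0 \<rho>" by (meson open_ball open_contains_cball)
      thus "\<exists>d>0. cball x d \<subseteq> ball z0 \<rho> \<and> uniform_limit (cball x d) F g sequentially"
        using uniform_limit_on_subset[OF ul] by blast
    qed simp
    thus ?thesis using \<rho> by (meson centre_in_ball holomorphic_on_imp_differentiable_at open_ball)
  qed
  thus "(\<lambda>z. partial k f (v + z *s h)) holomorphic_on ?S"
    unfolding g_def[symmetric] holomorphic_on_def by (simp add: field_differentiable_at_within)
qed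

text \<open>Multiplied by the Vandermonde determinant, the equations are holomorphic in \<open>u\<close> also where
  entries of \<open>u\<close> coincide.\<close>

definition vandermonde :: "complex^3 \<Rightarrow> complex" where
  "vandermonde u = (u$1 - u$2) * (u$1 - u$3) * (u$2 - u$3)"

text \<open>The polynomial \<open>vandermonde u / (u $ i - u $ j)\<close> in position (i,j), written
  without division so that it is meaningful where entries coincide.\<close>

definition vandermonde_quotient :: "complex^3 \<Rightarrow> complex^3^3" where
  "vandermonde_quotient u = vector
     [vector [0, (u$1 - u$3) * (u$2 - u$3), (u$1 - u$2) * (u$2 - u$3)],
      vector [- ((u$1 - u$3) * (u$2 - u$3)), 0, (u$1 - u$2) * (u$1 - u$3)],
      vector [- ((u$1 - u$2) * (u$2 - u$3)), - ((u$1 - u$2) * (u$1 - u$3)), 0]]"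

definition V_sub_cleared :: "3 \<Rightarrow> complex^3 \<Rightarrow> complex^3^3 \<Rightarrow> complex^3^3" where
  "V_sub_cleared k u A = (\<chi> i j. A $ i $ j * (kron i k - kron j k) * vandermonde_quotient u $ i $ j)"

lemma vandermonde_nz: "vandermonde u \<noteq> 0 \<longleftrightarrow> distinct_entries u"
  by (auto simp: vandermonde_def distinct_entries_diff)

lemma V_sub_cleared:
  assumes "distinct_entries u"
  shows "V_sub_cleared k u A $ i $ j = vandermonde u * V_sub k u A $ i $ j"
proof -
  have "u$1 \<noteq> u$2" "u$2 \<noteq> u$1" "u$1 \<noteq> u$3" "u$3 \<noteq> u$1" "u$2 \<noteq> u$3" "u$3 \<noteq> u$2"
    using assms unfolding distinct_entries_diff by auto
  hence "\<forall>i j. i \<noteq> j \<longrightarrow> vandermonde_quotient u $ i $ j = vandermonde u / (u $ i - u $ j)"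
    unfolding forall_3 vandermonde_quotient_def vector_3 vandermonde_def
    by (simp add: divide_simps) (simp add: algebra_simps)
  moreover have "\<forall>i. vandermonde_quotient u $ i $ i = 0" by (simp add: forall_3 vandermonde_quotient_def)
  ultimately show ?thesis by (cases "i = j") (simp_all add: V_sub_cleared_def V_sub_def)
qed

lemma V_equation_cleared:
  assumes "distinct_entries u"
  shows "P = commutator (V_sub k u A) A \<longleftrightarrow>
    (\<forall>i j. vandermonde u * P $ i $ j - commutator (V_sub_cleared k u A) A $ i $ j = 0)"
proof -
  have "commutator (V_sub_cleared k u A) A $ i $ j = vandermonde u * commutator (V_sub k u A) A $ i $ j" for i j
    unfolding commutator_nth_3 V_sub_cleared[OF assms] by (simp add: algebra_simps)
  thus ?thesis using assms by (simp add: vec_eq_iff flip: vandermonde_nz)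
qed

lemma line_holomorphic_commutator_cleared:
  assumes "\<And>i j. line_holomorphic_on (\<lambda>u. V u $ i $ j) E"
  shows "line_holomorphic_on (\<lambda>u. commutator (V_sub_cleared k u (V u)) (V u) $ i $ j) E"
proof -
  have "\<forall>i j. line_holomorphic_on (\<lambda>u. vandermonde_quotient u $ i $ j) E"
    unfolding forall_3 vandermonde_quotient_def vector_3 by (intro conjI line_holomorphic_intros)
  hence "line_holomorphic_on (\<lambda>u. V_sub_cleared k u (V u) $ i $ j) E" for i j
    unfolding V_sub_cleared_def vec_lambda_beta by (intro line_holomorphic_intros assms) blast
  thus ?thesis unfolding commutator_nth_3 by (intro line_holomorphic_intros assms)
qed

section \<open>Solutions on larger domains\<close>

context admissible_setting
begin

text \<open>Diagonal, determinant, \<open>minor_sum\<close> and the cleared equations are all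
  conditions that a line-holomorphic function vanish, so they spread from the open set
  \<open>D\<close> to the connected set \<open>E\<close>. Where the entries of \<open>u\<close> are
  distinct the Vandermonde factor is nonzero and can be divided out again.\<close>

lemma V_solutions_continuation:
  assumes E: "open E" "connected E" "D \<subseteq> E" and V: "V \<in> extensional E" "V_regular_on E V"
    and VD: "restrict V D \<in> V_solutions \<theta> \<theta>inf D"
  shows "V \<in> V_solutions \<theta> \<theta>inf E"
proof -
  have hol: "holomorphic3_on (\<lambda>u. V u $ i $ j) E" for i j using V(2) by (simp add: V_regular_on_def)
  have lh: "line_holomorphic_on (\<lambda>u. V u $ i $ j) E" for i j
    by (rule holomorphic3_imp_line_holomorphic[OF E(1) hol])
  have consD: "(\<forall>i. V u $ i $ i = - \<theta> $ i) \<and> det (V u) = 0 \<and> minor_sum (V u) = \<mu>p * \<mu>m" if "u \<in> D" for u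
    using VD that unfolding V_solutions_def constraints_iff by simp
  note ident = line_holomorphic_identity[OF _ E(1,2) domain(1,3) E(3)]
  have cons: "constraints \<theta> \<theta>inf (V u)" if u: "u \<in> E" for u
    unfolding constraints_iff
  proof (intro conjI allI)
    fix i
    have "V u $ i $ i - (- \<theta> $ i) = 0"
      by (rule ident[OF _ _ u, of "\<lambda>u. V u $ i $ i - (- \<theta> $ i)"]) (intro line_holomorphic_intros lh, use consD in simp)
    thus "V u $ i $ i = - \<theta> $ i" by (simp only: right_minus_eq)
  next
    have d: "line_holomorphic_on (\<lambda>u. det (V u)) E"
      unfolding det_3 by (intro line_holomorphic_intros lh)
    show "det (V u) = 0" by (rule ident[OF d _ u]) (use consD in simp)
    have m: "line_holomorphic_on (\<lambda>u. minor_sum (V u) - \<mu>p * \<mu>m) E"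
      unfolding minor_sum_def by (intro line_holomorphic_intros lh)
    have "minor_sum (V u) - \<mu>p * \<mu>m = 0" by (rule ident[OF m _ u]) (use consD in simp)
    thus "minor_sum (V u) = \<mu>p * \<mu>m" by simp
  qed
  have "partial_matrix k V u = commutator (V_sub k u (V u)) (V u)" if u: "u \<in> E" "distinct_entries u" for u k
    unfolding V_equation_cleared[OF u(2)]
  proof (intro allI)
    fix i j
    let ?f = "\<lambda>u. vandermonde u * partial_matrix k V u $ i $ j - commutator (V_sub_cleared k u (V u)) (V u) $ i $ j"
    show "?f u = 0"
    proof (rule ident[OF _ _ u(1), of ?f])
      show "line_holomorphic_on ?f E"
        unfolding vandermonde_def partial_matrix_def vec_lambda_beta
        by (intro line_holomorphic_intros line_holomorphic_commutator_cleared partial_line_holomorphic lh E(1) hol)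
      fix w assume w: "w \<in> D"
      have "partial_matrix k (restrict V D) w = partial_matrix k V w"
      proof -
        have "partial k (\<lambda>u. restrict V D u $ a $ b) w = partial k (\<lambda>u. V u $ a $ b) w" for a b
        proof -
          obtain f' where f': "cderiv (\<lambda>u. V u $ a $ b) f' w" using hol E(3) w unfolding holomorphic3_on_iff by blast
          show ?thesis using cderiv_partial[OF f'] cderiv_partial[OF cderiv_restrict[OF w f']] by simp
        qed
        thus ?thesis by (simp add: partial_matrix_def)
      qed
      moreover have "partial_matrix k (restrict V D) w
          = commutator (V_sub k w (restrict V D w)) (restrict V D w)"
        using VD w domain(4)[OF w] unfolding V_solutions_def by blast
      ultimately have "partial_matrix k V w = commutator (V_sub k w (V w)) (V w)" using w by simp
      thus "?f w = 0" unfolding V_equation_cleared[OF domain(4)[OF w]] by blast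
    qed
  qed
  with cons V show ?thesis unfolding V_solutions_def by blast
qed

lemma V_solutions_restrict:
  assumes E: "D \<subseteq> E" and V: "V \<in> V_solutions \<theta> \<theta>inf E"
  shows "restrict V D \<in> V_solutions \<theta> \<theta>inf D"
proof -
  have hol: "holomorphic3_on (\<lambda>u. V u $ i $ j) E" for i j using V by (simp add: V_solutions_def V_regular_on_def)
  have d: "\<exists>f'. cderiv (\<lambda>u. V u $ i $ j) f' u" if "u \<in> D" for u i j
    using hol E that unfolding holomorphic3_on_iff by blast
  show ?thesis unfolding V_solutions_iff
  proof (intro conjI ballI allI)
    fix u assume u: "u \<in> D"
    show "\<exists>f'. cderiv (\<lambda>u. restrict V D u $ i $ j) f' u" for i j
      using d[OF u] cderiv_restrict[OF u] by blast
    show "constraints \<theta> \<theta>inf (restrict V D u)" using V E u by (auto simp: V_solutions_def)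
    have "partial_matrix k (restrict V D) u = partial_matrix k V u" for k
    proof -
      have "partial k (\<lambda>u. restrict V D u $ a $ b) u = partial k (\<lambda>u. V u $ a $ b) u" for a b
      proof -
        obtain f' where f': "cderiv (\<lambda>u. V u $ a $ b) f' u" using d[OF u] by blast
        show ?thesis using cderiv_partial[OF f'] cderiv_partial[OF cderiv_restrict[OF u f']] by simp
      qed
      thus ?thesis by (simp add: partial_matrix_def)
    qed
    thus "V_equation (restrict V D) u"
      using V E u domain(4)[OF u] unfolding V_equation_def V_solutions_def by auto
  qed simp
qed

end

lemma PVI_parametersI:
  assumes "\<theta>inf \<noteq> 0" "\<theta>inf \<noteq> \<theta>$1 + \<theta>$2 + \<theta>$3" "\<theta>inf \<noteq> - (\<theta>$1 + \<theta>$2 + \<theta>$3)"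
  shows "PVI_parameters \<theta> \<theta>inf"
proof
  show "mu_plus \<theta> \<theta>inf \<noteq> 0"
    using assms(2) by (simp add: mu_plus_def algebra_simps)
  have "\<theta>inf = - 2 * mu_minus \<theta> \<theta>inf - (\<theta>$1 + \<theta>$2 + \<theta>$3)"
    by (simp add: mu_minus_def field_simps)
  thus "mu_minus \<theta> \<theta>inf \<noteq> 0" using assms(3) by auto
qed (rule assms(1))

(* The conjuncts: equivalence of the systems in u and in x; their equivalence with PVI through the
   explicit formulae; the one-to-one correspondences with classes of solutions in x and in u;
   solutions in u on larger domains, which may contain points with coinciding entries; and
   discreteness of the set of points at which the formulae are not defined. *)
theorem theorem2p1:
  fixes \<theta> :: "complex^3" and \<theta>inf :: complex
    and X :: "complex set" and D :: "(complex^3) set" and L :: "complex^3 \<Rightarrow> complex"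
  assumes "\<theta>inf \<noteq> 0" and "\<theta>inf \<noteq> \<theta>$1 + \<theta>$2 + \<theta>$3" and "\<theta>inf \<noteq> - (\<theta>$1 + \<theta>$2 + \<theta>$3)"
    and "admissible_domains X D L"
  shows
    "bij_betw (lift_Omega \<theta> D L) (Omega_solutions \<theta> \<theta>inf X) (V_solutions \<theta> \<theta>inf D)
     \<and>
     (\<forall>y\<in>PVI_domain X. \<forall>W\<in>Omega_family \<theta> \<theta>inf X y.
        (W \<in> Omega_solutions \<theta> \<theta>inf X \<longleftrightarrow> y \<in> PVI_solutions \<theta> \<theta>inf X) \<and>
        (lift_Omega \<theta> D L W \<in> V_solutions \<theta> \<theta>inf D \<longleftrightarrow> y \<in> PVI_solutions \<theta> \<theta>inf X))
     \<and>
     bij_betw (Omega_family \<theta> \<theta>inf X) (PVI_solutions \<theta> \<theta>inf X)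
       (conj_class X ` Omega_solutions_def_on \<theta> \<theta>inf X)
     \<and>
     bij_betw (\<lambda>y. lift_Omega \<theta> D L ` Omega_family \<theta> \<theta>inf X y) (PVI_solutions \<theta> \<theta>inf X)
       (conj_class D ` V_solutions_def_on \<theta> \<theta>inf D)
     \<and>
     (\<forall>E V. open E \<and> connected E \<and> D \<subseteq> E \<and> V \<in> extensional E \<and> V_regular_on E V \<longrightarrow>
        (V \<in> V_solutions \<theta> \<theta>inf E \<longleftrightarrow> restrict V D \<in> V_solutions \<theta> \<theta>inf D))
     \<and>
     (\<forall>W\<in>Omega_solutions \<theta> \<theta>inf X.
        let B = {x\<in>X. \<not> formulae_defined \<theta> \<theta>inf (vector [0, x, 1]) (W x)} in
        (B sparse_in X \<or> B = X) \<and>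
        (\<theta>inf \<noteq> 1 \<and> (\<forall>i. - \<theta> $ i \<notin> {0, mu_plus \<theta> \<theta>inf, mu_minus \<theta> \<theta>inf}) \<longrightarrow> B sparse_in X))"
proof -
  interpret PVI_parameters \<theta> \<theta>inf using assms(1-3) by (rule PVI_parametersI)
  interpret admissible_setting \<theta> \<theta>inf X D L by unfold_locales (rule assms(4))
  have family: "(W \<in> Omega_solutions \<theta> \<theta>inf X \<longleftrightarrow> y \<in> PVI_solutions \<theta> \<theta>inf X) \<and>
      (lift_Omega \<theta> D L W \<in> V_solutions \<theta> \<theta>inf D \<longleftrightarrow> y \<in> PVI_solutions \<theta> \<theta>inf X)"
    if "y \<in> PVI_domain X" "W \<in> Omega_family \<theta> \<theta>inf X y" for y W
  proof -
    have "W \<in> extensional X" using that(2) by (auto simp: Omega_family_def)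
    thus ?thesis using Omega_family_solution_iff[OF that] lift_Omega_solution_iff by blast
  qed
  show ?thesis
    unfolding Let_def
    by (intro conjI ballI allI impI lift_Omega_bij Omega_family_bij lift_Omega_family_bij)
      (use family V_solutions_continuation V_solutions_restrict undefined_points_sparse in \<open>blast+\<close>)
qed

end
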